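(* Let $n\ge 2$ and let $P=\mathrm{Op}_h^w(p)$ satisfy the standing assumptions below. Fix $C>0$. There exist $h_0>0$ and $K>0$ (independent of $h$, $\lambda$, $u$) such that for every $h\in(0,h_0]$, every eigenvalue $\lambda\in\mathrm{Spec}(P)$ with $|\lambda|<Ch$, and every $u\in L^2(\mathbb{R}^n)$ with $\|u\|_{L^2}=1$ and $(P-\lambda)u=0$ on $\mathbb{R}^n$, we have $u\in L^\infty(\mathbb{R}^n)$ and \[ \|u\|_{L^\infty(\mathbb{R}^n)}\le K h^{-\frac{n}{4}}. \] Consequently (by interpolation with $\|u\|_{L^2}=1$), \[ \|u\|_{L^p(\mathbb{R}^n)}\le K h^{\frac{n}{2p}-\frac{n}{4}},\qquad 2\le p\le\infty . \]
   Context: Standing assumptions. $0<h\le 1$ is a semiclassical parameter. The symbol $p\in C^\infty(\mathbb{R}^{2n};\mathbb{C})$, $X=(x,\xi)\in\mathbb{R}^{2n}$, $\langle X\rangle=\sqrt{1+|X|^2}$, satisfies: (i) $\partial^\alpha p\in L^\infty(\mathbb{R}^{2n})$ for all multi-indices $|\alpha|\ge 2$; (ii) $\mathrm{Re}\,p(X)\ge 0$ for all $X$; (iii) there is $C_1>1$ with $\mathrm{Re}\,p(X)\ge \langle X\rangle^2/C_1$ for $|X|\ge C_1$; (iv) $(\mathrm{Re}\,p)^{-1}(0)=\{0\}$; (v) $\mathrm{Im}\,p(0)=0$ and $\nabla\mathrm{Im}\,p(0)=0$; (vi) with $q(X)=\tfrac12 p''(0)X\cdot X$ (where $p''$ is the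 Hessian, so $p(X)=q(X)+\mathcal{O}(|X|^3)$ as $X\to0$), the quadratic form $\mathrm{Re}\,q$ is positive definite. The operator $P=\mathrm{Op}_h^w(p)$ is the semiclassical Weyl quantization \[ (\mathrm{Op}_h^w(p)u)(x)=\frac{1}{(2\pi h)^n}\int_{\mathbb{R}^n}\int_{\mathbb{R}^n} e^{\frac{i}{h}(x-y)\cdot\xi}\,p\Big(\frac{x+y}{2},\xi\Big)u(y)\,dy\,d\xi, \] viewed as a closed densely defined operator on $L^2(\mathbb{R}^n)$ with domain $\mathcal{D}(P)=\{u\in L^2(\mathbb{R}^n):(-h^2\Delta+|x|^2)u\in L^2(\mathbb{R}^n)\}$; its spectrum is discrete. *)

theory Defs
  imports "HOL-Analysis.Analysis"
begin

fun dderiv :: "'a::euclidean_space list \<Rightarrow> ('a \<Rightarrow> 'b::real_normed_vector) \<Rightarrow> 'a \<Rightarrow> 'b" where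
  "dderiv [] f = f"
| "dderiv (v # vs) f = (\<lambda>x. frechet_derivative (dderiv vs f) (at x) v)"

definition smooth_fun :: "('a::euclidean_space \<Rightarrow> 'b::real_normed_vector) \<Rightarrow> bool" where
  "smooth_fun f \<longleftrightarrow> (\<forall>vs. set vs \<subseteq> Basis \<longrightarrow> (\<forall>x. dderiv vs f differentiable (at x)))"

definition schwartz :: "('a::euclidean_space \<Rightarrow> complex) \<Rightarrow> bool" where
  "schwartz f \<longleftrightarrow> smooth_fun f \<and>
     (\<forall>vs k. set vs \<subseteq> Basis \<longrightarrow> bounded (range (\<lambda>x. (1 + norm x) ^ k *\<^sub>R dderiv vs f x)))"

definition weyl_op :: "real \<Rightarrow> ((real^'n) \<times> (real^'n) \<Rightarrow> complex) \<Rightarrow>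
     (real^'n \<Rightarrow> complex) \<Rightarrow> real^'n \<Rightarrow> complex" where
  "weyl_op h p u x =
     complex_of_real (1 / (2 * pi * h) ^ CARD('n)) *
     (\<integral>\<xi>. (\<integral>y. exp (\<i> * complex_of_real (((x - y) \<bullet> \<xi>) / h)) *
                 p ((1/2) *\<^sub>R (x + y), \<xi>) * u y \<partial>lebesgue) \<partial>lebesgue)"

definition harm_osc :: "real \<Rightarrow> (real^'n \<Rightarrow> complex) \<Rightarrow> real^'n \<Rightarrow> complex" where
  "harm_osc h u x = - complex_of_real (h\<^sup>2) * (\<Sum>i\<in>Basis. dderiv [i, i] u x)
                    + complex_of_real ((norm x)\<^sup>2) * u x"

definition L2 :: "(real^'n \<Rightarrow> complex) \<Rightarrow> bool" where
  "L2 u \<longleftrightarrow> u \<in> borel_measurable lebesgue \<and> integrable lebesgue (\<lambda>x. (norm (u x))\<^sup>2)"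

(* u lies in the domain D(P) = {u in L^2 : (-h^2 Delta + |x|^2) u in L^2} (distributional sense) *)
definition in_domain :: "real \<Rightarrow> (real^'n \<Rightarrow> complex) \<Rightarrow> bool" where
  "in_domain h u \<longleftrightarrow> L2 u \<and> (\<exists>g. L2 g \<and> (\<forall>\<phi>. schwartz \<phi> \<longrightarrow>
      (\<integral>x. u x * cnj (harm_osc h \<phi> x) \<partial>lebesgue) = (\<integral>x. g x * cnj (\<phi> x) \<partial>lebesgue)))"

(* (P - lambda) u = 0 for P = Op_h^w(p): u in D(P) and, in the sense of distributions,
   <u, Op_h^w(conj p) phi> = lambda <u, phi> for all Schwartz phi
   (Op_h^w(conj p) is the formal adjoint of Op_h^w(p)). *)
definition weyl_eigenfunction :: "real \<Rightarrow> ((real^'n) \<times> (real^'n) \<Rightarrow> complex) \<Rightarrow> complex \<Rightarrow>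
     (real^'n \<Rightarrow> complex) \<Rightarrow> bool" where
  "weyl_eigenfunction h p lam u \<longleftrightarrow> in_domain h u \<and>
     (\<forall>\<phi>. schwartz \<phi> \<longrightarrow>
        (\<integral>x. u x * cnj (weyl_op h (\<lambda>X. cnj (p X)) \<phi> x) \<partial>lebesgue)
        = lam * (\<integral>x. u x * cnj (\<phi> x) \<partial>lebesgue))"

definition standing_symbol :: "('a::euclidean_space \<Rightarrow> complex) \<Rightarrow> bool" where
  "standing_symbol p \<longleftrightarrow>
     smooth_fun p \<and>
     (\<forall>vs. set vs \<subseteq> Basis \<longrightarrow> length vs \<ge> 2 \<longrightarrow> bounded (range (dderiv vs p))) \<and>
     (\<forall>X. Re (p X) \<ge> 0) \<and>
     (\<exists>C1>1. \<forall>X. norm X \<ge> C1 \<longrightarrow> Re (p X) \<ge> (1 + (norm X)\<^sup>2) / C1) \<and>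
     {X. Re (p X) = 0} = {0} \<and>
     Im (p 0) = 0 \<and> (\<forall>v. Im (frechet_derivative p (at 0) v) = 0) \<and>
     (\<forall>X. X \<noteq> 0 \<longrightarrow> Re ((1/2) * dderiv [X, X] p 0) > 0)"

end

theory Submission
  imports Defs "HOL-Probability.Probability"
begin

text \<open>
  The rescaling \<open>x = sqrt h * y\<close> turns \<open>P / h\<close> into the Weyl quantization, with parameter one, of the
  symbol \<open>p (sqrt h * Y) / h\<close>. This symbol has bounded derivatives of order at least two, its gradient grows linearly, and
  its real part is at least \<open>c |Y|\<^sup>2\<close>, all uniformly in \<open>h \<le> 1\<close>. Test the equation against
  the coherent state centred at \<open>Z\<close> and let \<open>V Z\<close> be the scalar product of the eigenfunction with it. The
  Weyl operator multiplies the coherent state by the value of the symbol at \<open>Z\<close>, up to a remainder of size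
  \<open>O(|Z|)\<close> which is concentrated near \<open>Z\<close> in phase space faster than any power. Hence \<open>|Z|\<^sup>2 |V Z|\<close>
  is bounded by \<open>|Z|\<close> times a rapidly decaying average of \<open>|V|\<close> around \<open>Z\<close>. Each use of this inequality
  gains one power of decay, so \<open>V\<close> decays faster than any power, uniformly in \<open>h\<close>; Fourier inversion
  then bounds the rescaled eigenfunction in the supremum norm.
\<close>

section \<open>Integrals of products and Gaussians\<close>

text \<open>The equation is given only weakly, against Schwartz functions, and the triple integral
  behind the Weyl operator on a Gaussian need not converge absolutely, since the modulus of the
  integrand has no decay in the frequency variable. All bounds on the operator therefore come from
  integration by parts inside iterated integrals, and the classes of symbols and test functions are
  chosen to be stable under what this produces. Uniformity in \<open>h\<close> and in the centre
  \<open>Z\<close> is obtained by treating the translated, centred and normalised symbols as one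
  indexed family, with one constant per estimate for the whole family. The normalising factor
  \<open>h * bracket Z\<close> reflects the size of the gradient of the rescaled symbol at
  \<open>Z\<close>. The eigenfunction itself is merely measurable, so the final inversion is carried
  out by duality: a product with a window is tested against continuous integrable functions, which
  yields an almost everywhere bound.\<close>

abbreviation bracket :: "'a::real_normed_vector \<Rightarrow> real" where
  "bracket x \<equiv> 1 + norm x"

definition gauss :: "'a::euclidean_space \<Rightarrow> real" where
  "gauss x = exp (- (x \<bullet> x) / 2)"

lemma lborel_integral_affine:
  fixes f :: "'a::euclidean_space \<Rightarrow> 'b::{banach, second_countable_topology}"
  assumes f [measurable]: "f \<in> borel_measurable borel" and c: "c \<noteq> 0"
  shows "(\<integral>x. f x \<partial>lborel) = \<bar>c\<bar> ^ DIM('a) *\<^sub>R (\<integral>x. f (t + c *\<^sub>R x) \<partial>lborel)"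
  by (subst lborel_affine[OF c, of t]) (simp add: integral_density integral_distr)

lemma lborel_integrable_affine_iff:
  fixes f :: "'a::euclidean_space \<Rightarrow> 'b::{banach, second_countable_topology}"
  assumes f [measurable]: "f \<in> borel_measurable borel" and c: "c \<noteq> 0"
  shows "integrable lborel f \<longleftrightarrow> integrable lborel (\<lambda>x. f (t + c *\<^sub>R x))"
proof -
  have "integrable lborel f \<longleftrightarrow> integrable lborel (\<lambda>x. \<bar>c\<bar> ^ DIM('a) *\<^sub>R f (t + c *\<^sub>R x))"
    by (subst lborel_affine[OF c, of t]) (simp add: integrable_density integrable_distr_eq)
  also have "\<dots> \<longleftrightarrow> integrable lborel (\<lambda>x. f (t + c *\<^sub>R x))"
    using integrable_scaleR_right[of "inverse (\<bar>c\<bar> ^ DIM('a))" lborel "\<lambda>x. \<bar>c\<bar> ^ DIM('a) *\<^sub>R f (t + c *\<^sub>R x)"] c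
    by auto
  finally show ?thesis .
qed

lemma lborel_integral_translate:
  fixes f :: "'a::euclidean_space \<Rightarrow> 'b::{banach, second_countable_topology}"
  assumes "f \<in> borel_measurable borel"
  shows "(\<integral>x. f (x + t) \<partial>lborel) = (\<integral>x. f x \<partial>lborel)"
  using lborel_integral_affine[OF assms, of 1 t] by (simp add: add.commute)

lemma lborel_integrable_translate_iff:
  fixes f :: "'a::euclidean_space \<Rightarrow> 'b::{banach, second_countable_topology}"
  assumes "f \<in> borel_measurable borel"
  shows "integrable lborel (\<lambda>x. f (x + t)) \<longleftrightarrow> integrable lborel f"
  using lborel_integrable_affine_iff[OF assms, of 1 t] by (simp add: add.commute)

text \<open>\<open>lborel\<close> is the image of the product of the one-dimensional measures under
  the coordinate sum, so both claims reduce to the product measure on coordinate functions.\<close>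

lemma
  fixes f :: "'a::euclidean_space \<Rightarrow> real \<Rightarrow> 'b::{real_normed_field, banach, second_countable_topology}"
  assumes f: "\<And>b. b \<in> Basis \<Longrightarrow> integrable lborel (f b)"
  shows integrable_prod_Basis: "integrable lborel (\<lambda>x::'a. \<Prod>b\<in>Basis. f b (x \<bullet> b))"
    and integral_prod_Basis:
      "(\<integral>x. (\<Prod>b\<in>Basis. f b (x \<bullet> b)) \<partial>lborel) = (\<Prod>b\<in>Basis. \<integral>t. f b t \<partial>lborel)"
proof -
  interpret product_sigma_finite "\<lambda>_::'a. lborel :: real measure" ..
  have m: "(\<lambda>x::'a. \<Prod>b\<in>Basis. f b (x \<bullet> b)) \<in> borel_measurable borel"
    using f by (intro borel_measurable_prod) (auto intro!: measurable_compose[OF borel_measurable_inner borel_measurable_integrable, simplified])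
  have m2: "(\<lambda>g. \<Sum>b\<in>Basis. g b *\<^sub>R b) \<in> (\<Pi>\<^sub>M b\<in>Basis. lborel) \<rightarrow>\<^sub>M (borel::'a measure)"
    by measurable
  have eq: "(\<Prod>b\<in>Basis. f b ((\<Sum>b\<in>Basis. g b *\<^sub>R b) \<bullet> b)) = (\<Prod>b\<in>Basis. f b (g b))" for g :: "'a \<Rightarrow> real"
    by (intro prod.cong refl arg_cong[where f="f _"]) (simp add: inner_sum_left inner_Basis if_distrib cong: if_cong)
  show "integrable lborel (\<lambda>x::'a. \<Prod>b\<in>Basis. f b (x \<bullet> b))"
    by (subst lborel_eq, subst integrable_distr_eq[OF m2 m], unfold eq, rule product_integrable_prod)
       (use f in auto)
  show "(\<integral>x. (\<Prod>b\<in>Basis. f b (x \<bullet> b)) \<partial>lborel) = (\<Prod>b\<in>Basis. \<integral>t. f b t \<partial>lborel)"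
    by (subst lborel_eq, subst integral_distr[OF m2 m], unfold eq, rule product_integral_prod)
       (use f in auto)
qed

lemma integrable_inverse_one_plus_square: "integrable lborel (\<lambda>x::real. inverse (1 + x\<^sup>2))"
  using integrable_inverse_1_plus_square by (simp add: set_integrable_def)

text \<open>The exponent is twice the dimension because \<open>bracket x ^ 2\<close> dominates each
  \<open>1 + (x \<bullet> b)\<^sup>2\<close>, and the product of these factors over the basis has an
  integrable inverse.\<close>

lemma integrable_bracket_power:
  fixes k :: nat
  assumes "2 * DIM('a) \<le> k"
  shows "integrable lborel (\<lambda>x::'a::euclidean_space. 1 / bracket x ^ k)"
proof (rule Bochner_Integration.integrable_bound)
  show "integrable lborel (\<lambda>x::'a. \<Prod>b\<in>Basis. inverse (1 + (x \<bullet> b)\<^sup>2))"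
    by (rule integrable_prod_Basis) (rule integrable_inverse_one_plus_square)
  show "AE x in lborel. norm (1 / bracket x ^ k) \<le> norm (\<Prod>b\<in>Basis. inverse (1 + ((x::'a) \<bullet> b)\<^sup>2))"
  proof (intro always_eventually allI)
    fix x :: 'a
    have "(\<Prod>b\<in>(Basis::'a set). 1 + (x \<bullet> b)\<^sup>2) \<le> (\<Prod>b\<in>(Basis::'a set). bracket x ^ 2)"
    proof (intro prod_mono conjI)
      fix b :: 'a assume "b \<in> Basis"
      then have "(x \<bullet> b)\<^sup>2 \<le> (norm x)\<^sup>2"
        by (simp add: Basis_le_norm abs_le_square_iff[symmetric])
      then show "1 + (x \<bullet> b)\<^sup>2 \<le> bracket x ^ 2"
        using norm_ge_zero[of x] unfolding power2_sum one_power2 by linarith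
    qed auto
    also have "\<dots> = bracket x ^ (2 * DIM('a))"
      by (simp add: power_mult)
    also have "\<dots> \<le> bracket x ^ k"
      using assms by (intro power_increasing) auto
    finally have "(\<Prod>b\<in>(Basis::'a set). 1 + (x \<bullet> b)\<^sup>2) \<le> bracket x ^ k" .
    moreover have "0 < (\<Prod>b\<in>(Basis::'a set). 1 + (x \<bullet> b)\<^sup>2)"
      by (intro prod_pos) (simp add: add_pos_nonneg)
    ultimately have "1 / bracket x ^ k \<le> 1 / (\<Prod>b\<in>(Basis::'a set). 1 + (x \<bullet> b)\<^sup>2)"
      by (intro divide_left_mono) (auto intro!: mult_pos_pos zero_less_power add_pos_nonneg)
    then show "norm (1 / bracket x ^ k) \<le> norm (\<Prod>b\<in>Basis. inverse (1 + (x \<bullet> b)\<^sup>2))"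
      by (simp add: prod_inversef[symmetric] divide_inverse abs_mult power_abs[symmetric] prod_nonneg abs_prod add_nonneg_nonneg)
  qed
qed measurable

section \<open>Gaussians and their Fourier integrals\<close>

lemma
  fixes s :: real
  shows integrable_iexp_std_normal: "integrable lborel (\<lambda>x. iexp (s * x) * complex_of_real (exp (- x\<^sup>2 / 2)))"
    and integral_iexp_std_normal: "(\<integral>x. iexp (s * x) * complex_of_real (exp (- x\<^sup>2 / 2)) \<partial>lborel)
      = complex_of_real (sqrt (2 * pi) * exp (- s\<^sup>2 / 2))"
proof -
  have i: "integrable lborel (\<lambda>x::real. exp (- x\<^sup>2 / 2))"
    using integrable_normal_density[of 1 0, THEN integrable_mult_right, of "sqrt (2*pi)"]
    by (simp add: normal_density_def)
  then have "integrable lborel (\<lambda>x::real. complex_of_real (exp (- x\<^sup>2 / 2)))"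
    by (rule integrable_of_real)
  then show "integrable lborel (\<lambda>x. iexp (s * x) * complex_of_real (exp (- x\<^sup>2 / 2)))"
    by (rule Bochner_Integration.integrable_bound) (auto simp: norm_mult)
  \<comment> \<open>The characteristic function of the standard normal law is the wanted integral up
    to the factor \<open>1 / sqrt (2 * pi)\<close> in its density.\<close>
  have "complex_of_real (exp (- s\<^sup>2 / 2)) = (\<integral>x. iexp (s * x) \<partial>std_normal_distribution)"
    using fun_cong[OF char_std_normal_distribution, of s] by (simp add: char_def)
  also have "\<dots> = (\<integral>x. std_normal_density x *\<^sub>R iexp (s * x) \<partial>lborel)"
    by (subst integral_density) (auto simp: normal_density_nonneg)
  also have "\<dots> = (\<integral>x. complex_of_real (1 / sqrt (2*pi)) * (iexp (s * x) * complex_of_real (exp (- x\<^sup>2 / 2))) \<partial>lborel)"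
    by (intro Bochner_Integration.integral_cong) (auto simp: std_normal_density_def scaleR_conv_of_real mult_ac)
  finally show "(\<integral>x. iexp (s * x) * complex_of_real (exp (- x\<^sup>2 / 2)) \<partial>lborel)
      = complex_of_real (sqrt (2 * pi) * exp (- s\<^sup>2 / 2))"
    by (simp add: field_simps)
qed

lemma gauss_pos [simp]: "0 < gauss x" and gauss_le_1: "gauss x \<le> 1" and gauss_minus [simp]: "gauss (- x) = gauss x"
  and gauss_0 [simp]: "gauss 0 = 1" and abs_gauss [simp]: "\<bar>gauss x\<bar> = gauss x" and gauss_nonneg [simp]: "0 \<le> gauss x"
  by (auto simp: gauss_def)

lemma continuous_on_gauss [continuous_intros]:
  "continuous_on S f \<Longrightarrow> continuous_on S (\<lambda>x. gauss (f x))"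
  unfolding gauss_def by (intro continuous_intros) auto

lemma borel_measurable_gauss [measurable]: "gauss \<in> borel_measurable borel"
  by (intro borel_measurable_continuous_onI continuous_intros)

lemma gauss_eq_prod: "gauss (x::'a::euclidean_space) = (\<Prod>b\<in>Basis. exp (- (x \<bullet> b)\<^sup>2 / 2))"
  by (simp add: gauss_def exp_sum[symmetric] euclidean_inner[of x x] power2_eq_square sum_negf sum_divide_distrib)

lemma
  fixes z :: "'a::euclidean_space"
  shows integrable_iexp_gauss: "integrable lborel (\<lambda>x. iexp (z \<bullet> x) * complex_of_real (gauss x))"
    and integral_iexp_gauss: "(\<integral>x. iexp (z \<bullet> x) * complex_of_real (gauss x) \<partial>lborel)
       = complex_of_real (sqrt (2 * pi) ^ DIM('a) * gauss z)"
proof -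
  define f where "f b t = iexp ((z \<bullet> b) * t) * complex_of_real (exp (- t\<^sup>2 / 2))" for b t
  have eq: "iexp (z \<bullet> x) * complex_of_real (gauss x) = (\<Prod>b\<in>Basis. f b (x \<bullet> b))" for x
    unfolding gauss_eq_prod f_def prod.distrib
    by (simp add: exp_sum euclidean_inner[of z x] sum_distrib_left mult_ac)
  have f: "integrable lborel (f b)" for b
    unfolding f_def by (rule integrable_iexp_std_normal)
  show "integrable lborel (\<lambda>x. iexp (z \<bullet> x) * complex_of_real (gauss x))"
    unfolding eq by (rule integrable_prod_Basis) (rule f)
  have "(\<integral>x. iexp (z \<bullet> x) * complex_of_real (gauss x) \<partial>lborel) = (\<Prod>b\<in>Basis. \<integral>t. f b t \<partial>lborel)"
    unfolding eq by (rule integral_prod_Basis) (rule f)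
  also have "\<dots> = (\<Prod>b\<in>Basis. complex_of_real (sqrt (2 * pi) * exp (- (z \<bullet> b)\<^sup>2 / 2)))"
    unfolding f_def integral_iexp_std_normal ..
  finally show "(\<integral>x. iexp (z \<bullet> x) * complex_of_real (gauss x) \<partial>lborel)
       = complex_of_real (sqrt (2 * pi) ^ DIM('a) * gauss z)"
    by (simp add: gauss_eq_prod prod.distrib flip: of_real_prod)
qed

lemma integrable_gauss: "integrable lborel (gauss :: 'a::euclidean_space \<Rightarrow> real)"
  using integrable_norm[OF integrable_iexp_gauss[of 0]] by (simp add: gauss_nonneg)

lemma integral_gauss: "(\<integral>x. gauss (x::'a::euclidean_space) \<partial>lborel) = sqrt (2 * pi) ^ DIM('a)"
  using integral_iexp_gauss[of "0::'a"] by (simp add: integral_complex_of_real del: of_real_mult of_real_power)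

text \<open>Trades a weight at one point for the weights at a shifted point and at the shift; every
  passage between decay around a centre and decay around the origin rests on it.\<close>

lemma Peetre: "bracket x \<le> bracket (x + y) * bracket (y::'a::real_normed_vector)"
proof -
  have "norm x \<le> norm (x + y) + norm y"
    using norm_triangle_ineq4[of "x + y" y] by simp
  moreover have "0 \<le> norm (x + y) * norm y" by simp
  ultimately show ?thesis unfolding ring_distribs by linarith
qed

section \<open>Integration by parts and Parseval's identity\<close>

lemma integrable_pair_bound:
  fixes f :: "'a::euclidean_space \<times> 'b::euclidean_space \<Rightarrow> 'c::{banach, second_countable_topology}"
    and g :: "'a \<Rightarrow> real" and h :: "'b \<Rightarrow> real"
  assumes [measurable]: "f \<in> borel_measurable (lborel \<Otimes>\<^sub>M lborel)"
    and g: "integrable lborel g" and h: "integrable lborel h"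
    and bound: "\<And>x y. norm (f (x, y)) \<le> g x * h y"
  shows "integrable (lborel \<Otimes>\<^sub>M lborel) f"
proof (rule lborel_pair.Fubini_integrable)
  have int: "integrable lborel (\<lambda>y. f (x, y))" for x
    by (rule Bochner_Integration.integrable_bound[of _ "\<lambda>y. g x * h y"])
       (use h bound in \<open>auto intro!: always_eventually order_trans[OF bound]\<close>)
  then show "AE x in lborel. integrable lborel (\<lambda>y. f (x, y))"
    by simp
  have le: "(\<integral>y. norm (f (x, y)) \<partial>lborel) \<le> g x * (\<integral>y. h y \<partial>lborel)" for x
  proof -
    have "(\<integral>y. norm (f (x, y)) \<partial>lborel) \<le> (\<integral>y. g x * h y \<partial>lborel)"
      by (intro integral_mono int[THEN integrable_norm] integrable_mult_right h bound)
    then show ?thesis by simp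
  qed
  show "integrable lborel (\<lambda>x. \<integral>y. norm (f (x, y)) \<partial>lborel)"
    by (rule Bochner_Integration.integrable_bound[of _ "\<lambda>x. g x * (\<integral>y. h y \<partial>lborel)"])
       (use g le in \<open>auto intro!: always_eventually order_trans[OF le]\<close>)
qed simp

text \<open>Translation invariance makes the integral of the increment vanish, and Fubini identifies
  it with the integral of \<open>F'\<close>. The hypothesis is an increment formula, not a
  derivative, so that it also covers an \<open>F\<close> that is itself a parameter
  integral.\<close>

lemma integral_zero_of_increment:
  fixes F F' :: "'a::euclidean_space \<Rightarrow> complex"
  assumes F: "integrable lborel F" and F': "integrable lborel F'"
    and inc: "\<And>z. F (z + e) - F z = (\<integral>s. indicator {0..1::real} s *\<^sub>R F' (z + s *\<^sub>R e) \<partial>lborel)"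
  shows "(\<integral>z. F' z \<partial>lborel) = 0"
proof -
  have [measurable]: "F \<in> borel_measurable borel" "F' \<in> borel_measurable borel"
    using F F' by auto
  let ?G = "\<lambda>(s, z). indicator {0..1::real} s *\<^sub>R F' (z + s *\<^sub>R e)"
  have transl: "integrable lborel (\<lambda>z. F' (z + s *\<^sub>R e))" for s
    using F' by (simp add: lborel_integrable_translate_iff)
  have G: "integrable (lborel \<Otimes>\<^sub>M lborel) ?G"
  proof (rule lborel_pair.Fubini_integrable)
    have eq: "(\<integral>y. norm (?G (s, y)) \<partial>lborel) = indicator {0..1} s * (\<integral>z. norm (F' z) \<partial>lborel)" for s
      using lborel_integral_translate[of "\<lambda>z. norm (F' z)" "s *\<^sub>R e"] by simp
    show "integrable lborel (\<lambda>x. \<integral>y. norm (?G (x, y)) \<partial>lborel)"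
      unfolding eq by simp
    show "AE x in lborel. integrable lborel (\<lambda>y. ?G (x, y))"
      using transl by simp
  qed measurable
  have "0 = (\<integral>z. F (z + e) \<partial>lborel) - (\<integral>z. F z \<partial>lborel)"
    by (simp add: lborel_integral_translate)
  also have "\<dots> = (\<integral>z. F (z + e) - F z \<partial>lborel)"
    by (rule Bochner_Integration.integral_diff[symmetric]) (auto simp: lborel_integrable_translate_iff F)
  also have "\<dots> = (\<integral>z. \<integral>s. ?G (s, z) \<partial>lborel \<partial>lborel)"
    by (simp add: inc)
  also have "\<dots> = (\<integral>s. \<integral>z. ?G (s, z) \<partial>lborel \<partial>lborel)"
    using lborel_pair.Fubini_integral[of "\<lambda>s z. ?G (s, z)"] G by simp
  also have "\<dots> = (\<integral>s. indicator {0..1::real} s *\<^sub>R (\<integral>z. F' z \<partial>lborel) \<partial>lborel)"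
    by (simp add: lborel_integral_translate)
  also have "\<dots> = (\<integral>z. F' z \<partial>lborel)"
    by simp
  finally show ?thesis ..
qed

lemma increment_eq_integral:
  fixes F F' :: "'a::euclidean_space \<Rightarrow> complex"
  assumes deriv: "\<And>z. ((\<lambda>t. F (z + t *\<^sub>R e)) has_vector_derivative F' z) (at 0)"
    and cont: "continuous_on UNIV F'"
  shows "F (z + e) - F z = (\<integral>s. indicator {0..1::real} s *\<^sub>R F' (z + s *\<^sub>R e) \<partial>lborel)"
proof -
  have "((\<lambda>t. F (z + t *\<^sub>R e)) has_vector_derivative F' (z + t *\<^sub>R e)) (at t)" for t
  proof -
    have "((\<lambda>s. s - t) has_vector_derivative 1) (at t)"
      by (auto intro!: derivative_eq_intros)
    from vector_diff_chain_at[OF this, of "\<lambda>s. F ((z + t *\<^sub>R e) + s *\<^sub>R e)" "F' (z + t *\<^sub>R e)"]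
    show ?thesis
      using deriv[of "z + t *\<^sub>R e"] by (simp add: o_def algebra_simps)
  qed
  then have "(\<integral>s. indicator {0..1::real} s *\<^sub>R F' (z + s *\<^sub>R e) \<partial>lborel) = F (z + 1 *\<^sub>R e) - F (z + 0 *\<^sub>R e)"
    by (intro integral_FTC_Icc)
       (auto intro: has_vector_derivative_at_within intro!: continuous_intros continuous_on_compose2[OF cont])
  then show ?thesis by simp
qed

lemma integral_derivative_zero:
  fixes F F' :: "'a::euclidean_space \<Rightarrow> complex"
  assumes "\<And>z. ((\<lambda>t. F (z + t *\<^sub>R e)) has_vector_derivative F' z) (at 0)"
    and "continuous_on UNIV F'" "integrable lborel F" "integrable lborel F'"
  shows "(\<integral>z. F' z \<partial>lborel) = 0"
  using assms by (intro integral_zero_of_increment[of F F' e] increment_eq_integral)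

text \<open>The derivative \<open>f'\<close> may grow polynomially in \<open>z\<close>, so
  \<open>f'\<close> need not be integrable in \<open>(y, z)\<close> jointly. Only a segment of unit
  parameter length is exchanged with the \<open>y\<close> integral; integrability in
  \<open>z\<close> is required after the \<open>y\<close> integration.\<close>

lemma integral_derivative_zero_param:
  fixes f f' :: "'b::euclidean_space \<Rightarrow> 'a::euclidean_space \<Rightarrow> complex"
  assumes deriv: "\<And>y z. ((\<lambda>t. f y (z + t *\<^sub>R e)) has_vector_derivative f' y z) (at 0)"
    and cont: "continuous_on UNIV (\<lambda>(y, z). f' y z)"
    and G: "integrable lborel G" "\<And>y. 0 \<le> G y" and bound: "\<And>y z. norm (f' y z) \<le> G y * bracket z ^ m"
    and f: "\<And>z. integrable lborel (\<lambda>y. f y z)"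
    and I: "integrable lborel (\<lambda>z. \<integral>y. f y z \<partial>lborel)" and I': "integrable lborel (\<lambda>z. \<integral>y. f' y z \<partial>lborel)"
  shows "(\<integral>z. \<integral>y. f' y z \<partial>lborel \<partial>lborel) = 0"
proof (rule integral_zero_of_increment[OF I I'])
  fix z
  have c: "continuous_on UNIV (f' y)" for y
  proof -
    have "continuous_on UNIV (\<lambda>z::'a. (y::'b, z))"
      by (rule continuous_on_Pair[OF continuous_on_const continuous_on_id])
    from continuous_on_compose2[OF cont this] show ?thesis by simp
  qed
  have "continuous_on UNIV (\<lambda>p::'b \<times> real. f' (fst p) (z + snd p *\<^sub>R e))"
  proof -
    have "continuous_on UNIV (\<lambda>p::'b \<times> real. (fst p, z + snd p *\<^sub>R e))"
      by (intro continuous_intros)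
    from continuous_on_compose2[OF cont this] show ?thesis by simp
  qed
  then have [measurable]: "(\<lambda>p::'b \<times> real. f' (fst p) (z + snd p *\<^sub>R e)) \<in> borel_measurable (lborel \<Otimes>\<^sub>M lborel)"
    by (simp add: lborel_prod borel_measurable_continuous_onI)
  have int: "integrable (lborel \<Otimes>\<^sub>M lborel) (\<lambda>p::'b \<times> real. indicator {0..1} (snd p) *\<^sub>R f' (fst p) (z + snd p *\<^sub>R e))"
  proof (rule integrable_pair_bound)
    show "integrable lborel (\<lambda>y. G y * (bracket z + norm e) ^ m)"
      using G by simp
    show "norm (indicator {0..1} (snd (y, s)) *\<^sub>R f' (fst (y, s)) (z + snd (y, s) *\<^sub>R e))
      \<le> G y * (bracket z + norm e) ^ m * indicator {0..1::real} s" for y s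
    proof (cases "s \<in> {0..1}")
      case True
      then have "norm (z + s *\<^sub>R e) \<le> norm z + norm e"
        by (intro order_trans[OF norm_triangle_ineq] add_left_mono) (auto simp: mult_left_le_one_le)
      then have "norm (f' y (z + s *\<^sub>R e)) \<le> G y * (bracket z + norm e) ^ m"
        by (intro order_trans[OF bound] mult_left_mono power_mono) (auto simp: G)
      with True show ?thesis by simp
    qed simp
  qed auto
  have "(\<integral>y. f y (z + e) \<partial>lborel) - (\<integral>y. f y z \<partial>lborel) = (\<integral>y. f y (z + e) - f y z \<partial>lborel)"
    by (rule Bochner_Integration.integral_diff[symmetric]) (rule f)+
  also have "\<dots> = (\<integral>y. \<integral>s. indicator {0..1::real} s *\<^sub>R f' y (z + s *\<^sub>R e) \<partial>lborel \<partial>lborel)"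
    by (intro Bochner_Integration.integral_cong refl increment_eq_integral deriv c)
  also have "\<dots> = (\<integral>s. \<integral>y. indicator {0..1::real} s *\<^sub>R f' y (z + s *\<^sub>R e) \<partial>lborel \<partial>lborel)"
    using lborel_pair.Fubini_integral[of "\<lambda>y s. indicator {0..1::real} s *\<^sub>R f' y (z + s *\<^sub>R e)"] int
    by (simp add: case_prod_unfold)
  finally show "(\<integral>y. f y (z + e) \<partial>lborel) - (\<integral>y. f y z \<partial>lborel)
    = (\<integral>s. indicator {0..1::real} s *\<^sub>R (\<integral>y. f' y (z + s *\<^sub>R e) \<partial>lborel) \<partial>lborel)"
    by simp
qed

section \<open>Fourier transform and Parseval's identity\<close>

definition FT :: "('a::euclidean_space \<Rightarrow> complex) \<Rightarrow> 'a \<Rightarrow> complex" where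
  "FT f \<beta> = (\<integral>x. iexp (- (\<beta> \<bullet> x)) * f x \<partial>lborel)"

lemma borel_measurable_FT [measurable]:
  assumes [measurable]: "f \<in> borel_measurable borel"
  shows "FT f \<in> borel_measurable borel"
  unfolding FT_def by measurable

lemma norm_FT_le: "integrable lborel f \<Longrightarrow> norm (FT f \<beta>) \<le> (\<integral>x. norm (f x) \<partial>lborel)"
  unfolding FT_def by (rule order_trans[OF integral_norm_bound]) (simp add: norm_mult)

lemma integral_iexp_gauss_scaled:
  fixes z :: "'a::euclidean_space" and \<epsilon> :: real
  assumes "\<epsilon> > 0"
  shows "integrable lborel (\<lambda>x. iexp (z \<bullet> x) * complex_of_real (gauss (\<epsilon> *\<^sub>R x)))"
    and "(\<integral>x. iexp (z \<bullet> x) * complex_of_real (gauss (\<epsilon> *\<^sub>R x)) \<partial>lborel)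
       = complex_of_real ((sqrt (2 * pi) / \<epsilon>) ^ DIM('a) * gauss (z /\<^sub>R \<epsilon>))"
proof -
  let ?f = "\<lambda>x. iexp (z \<bullet> x) * complex_of_real (gauss (\<epsilon> *\<^sub>R x))"
  have eq: "?f (0 + (1 / \<epsilon>) *\<^sub>R x) = iexp ((z /\<^sub>R \<epsilon>) \<bullet> x) * complex_of_real (gauss x)" for x
    using assms by (simp add: divide_inverse)
  show "integrable lborel ?f"
    using assms by (subst lborel_integrable_affine_iff[of _ "1 / \<epsilon>" 0]) (simp_all only: eq integrable_iexp_gauss, auto)
  show "(\<integral>x. ?f x \<partial>lborel) = complex_of_real ((sqrt (2 * pi) / \<epsilon>) ^ DIM('a) * gauss (z /\<^sub>R \<epsilon>))"
    using assms by (subst lborel_integral_affine[of _ "1 / \<epsilon>" 0])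
      (simp_all only: eq integral_iexp_gauss, auto simp: scaleR_conv_of_real power_divide)
qed

lemma integrable_gauss_scaled:
  "\<epsilon> > 0 \<Longrightarrow> integrable lborel (\<lambda>x::'a::euclidean_space. gauss (\<epsilon> *\<^sub>R x))"
  using integrable_norm[OF integral_iexp_gauss_scaled(1)[of \<epsilon> 0]] by simp

text \<open>The Gaussian cut-off in frequency makes the double integral absolutely convergent; its
  own transform then appears as an average of \<open>k\<close> around \<open>x\<close> at scale
  \<open>\<epsilon>\<close>.\<close>

lemma integral_mult_gauss_FT:
  fixes k :: "'a::euclidean_space \<Rightarrow> complex"
  assumes k: "integrable lborel k" and \<epsilon>: "\<epsilon> > 0"
  shows "(\<integral>\<beta>. iexp (- (\<beta> \<bullet> x)) * complex_of_real (gauss (\<epsilon> *\<^sub>R \<beta>)) * FT k (- \<beta>) \<partial>lborel)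
    = complex_of_real (sqrt (2 * pi) ^ DIM('a)) * (\<integral>w. k (x + \<epsilon> *\<^sub>R w) * complex_of_real (gauss w) \<partial>lborel)"
proof -
  have [measurable]: "k \<in> borel_measurable borel" using k by auto
  let ?F = "\<lambda>\<beta> y. (iexp (- (\<beta> \<bullet> x)) * complex_of_real (gauss (\<epsilon> *\<^sub>R \<beta>))) * (iexp (\<beta> \<bullet> y) * k y)"
  have int: "integrable (lborel \<Otimes>\<^sub>M lborel) (\<lambda>(\<beta>, y). ?F \<beta> y)"
    by (rule integrable_pair_bound[OF _ integrable_gauss_scaled[OF \<epsilon>] integrable_norm[OF k]])
       (auto simp: norm_mult)
  have "(\<integral>\<beta>. iexp (- (\<beta> \<bullet> x)) * complex_of_real (gauss (\<epsilon> *\<^sub>R \<beta>)) * FT k (- \<beta>) \<partial>lborel)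
    = (\<integral>\<beta>. \<integral>y. ?F \<beta> y \<partial>lborel \<partial>lborel)"
    unfolding FT_def by simp
  also have "\<dots> = (\<integral>y. \<integral>\<beta>. ?F \<beta> y \<partial>lborel \<partial>lborel)"
    using lborel_pair.Fubini_integral[OF int] by simp
  also have "\<dots> = (\<integral>y. k y * (\<integral>\<beta>. iexp ((y - x) \<bullet> \<beta>) * complex_of_real (gauss (\<epsilon> *\<^sub>R \<beta>)) \<partial>lborel) \<partial>lborel)"
    by (intro Bochner_Integration.integral_cong refl)
       (simp flip: integral_mult_right_zero add: exp_diff exp_minus inner_diff_left inner_commute algebra_simps divide_inverse)
  also have "\<dots> = (\<integral>y. k y * complex_of_real ((sqrt (2 * pi) / \<epsilon>) ^ DIM('a) * gauss ((y - x) /\<^sub>R \<epsilon>)) \<partial>lborel)"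
    by (simp only: integral_iexp_gauss_scaled(2)[OF \<epsilon>])
  also have "\<dots> = \<bar>\<epsilon>\<bar> ^ DIM('a) *\<^sub>R (\<integral>w. k (x + \<epsilon> *\<^sub>R w) * complex_of_real ((sqrt (2 * pi) / \<epsilon>) ^ DIM('a) * gauss w) \<partial>lborel)"
    using \<epsilon> by (subst lborel_integral_affine[of _ \<epsilon> x]) simp_all
  also have "\<dots> = \<bar>\<epsilon>\<bar> ^ DIM('a) *\<^sub>R (complex_of_real ((sqrt (2 * pi) / \<epsilon>) ^ DIM('a)) * (\<integral>w. k (x + \<epsilon> *\<^sub>R w) * complex_of_real (gauss w) \<partial>lborel))"
    by (simp only: of_real_mult mult.left_commute[of "k _"] integral_mult_right_zero)
  finally show ?thesis
    using \<epsilon> by (simp add: scaleR_conv_of_real power_divide)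
qed

lemma tendsto_gauss_average:
  fixes k :: "'a::euclidean_space \<Rightarrow> complex"
  assumes cont: "continuous_on UNIV k" and B: "\<And>x. norm (k x) \<le> B" and e: "e \<longlonglongrightarrow> 0"
  shows "(\<lambda>j. \<integral>w. k (x + e j *\<^sub>R w) * complex_of_real (gauss w) \<partial>lborel)
    \<longlonglongrightarrow> complex_of_real (sqrt (2 * pi) ^ DIM('a)) * k x"
proof -
  have [measurable]: "k \<in> borel_measurable borel"
    using cont by (rule borel_measurable_continuous_onI)
  have "(\<lambda>j. \<integral>w. k (x + e j *\<^sub>R w) * complex_of_real (gauss w) \<partial>lborel)
     \<longlonglongrightarrow> (\<integral>w. k x * complex_of_real (gauss (w::'a)) \<partial>lborel)"
  proof (rule integral_dominated_convergence[where w = "\<lambda>w. B * gauss w"])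
    show "AE w in lborel. (\<lambda>j. k (x + e j *\<^sub>R w) * complex_of_real (gauss w)) \<longlonglongrightarrow> k x * complex_of_real (gauss w)"
    proof (intro always_eventually allI tendsto_mult tendsto_const)
      fix w
      have "(\<lambda>j. x + e j *\<^sub>R w) \<longlonglongrightarrow> x"
        using e by (auto intro!: tendsto_eq_intros)
      then show "(\<lambda>j. k (x + e j *\<^sub>R w)) \<longlonglongrightarrow> k x"
        by (rule continuous_on_tendsto_compose[OF cont]) auto
    qed
  qed (auto simp: integrable_gauss norm_mult intro!: mult_right_mono B)
  also have "(\<integral>w. k x * complex_of_real (gauss (w::'a)) \<partial>lborel) = complex_of_real (sqrt (2 * pi) ^ DIM('a)) * k x"
    by (simp add: integral_complex_of_real integral_gauss)
  finally show ?thesis .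
qed

text \<open>The form is bilinear, with \<open>FT k (- \<beta>)\<close> in place of a conjugate. Only
  the product of the two transforms is assumed integrable, so the frequency integral is first
  regularised by a Gaussian.\<close>

lemma Parseval:
  fixes h k :: "'a::euclidean_space \<Rightarrow> complex"
  assumes h: "integrable lborel h" and k: "integrable lborel k"
    and cont: "continuous_on UNIV k" and B: "\<And>x. norm (k x) \<le> B"
    and hk: "integrable lborel (\<lambda>\<beta>. FT h \<beta> * FT k (- \<beta>))"
  shows "(\<integral>\<beta>. FT h \<beta> * FT k (- \<beta>) \<partial>lborel) = complex_of_real ((2 * pi) ^ DIM('a)) * (\<integral>x. h x * k x \<partial>lborel)"
proof (rule LIMSEQ_unique)
  have [measurable]: "k \<in> borel_measurable borel" "h \<in> borel_measurable borel" using h k by auto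
  define e where "e j = 1 / real (Suc j)" for j
  have e: "e j > 0" "e \<longlonglongrightarrow> 0" for j
    unfolding e_def using LIMSEQ_Suc[OF lim_const_over_n[of 1]] by auto
  \<comment> \<open>\<open>T j\<close> is evaluated twice: directly, where the Gaussian factor tends
    to one, and by Fubini, where it turns into an average of \<open>k\<close> at scale
    \<open>e j\<close>.\<close>
  define T where "T j = (\<integral>\<beta>. complex_of_real (gauss (e j *\<^sub>R \<beta>)) * (FT h \<beta> * FT k (- \<beta>)) \<partial>lborel)" for j
  show "T \<longlonglongrightarrow> (\<integral>\<beta>. FT h \<beta> * FT k (- \<beta>) \<partial>lborel)"
    unfolding T_def
  proof (rule integral_dominated_convergence[where w = "\<lambda>\<beta>. norm (FT h \<beta> * FT k (- \<beta>))"])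
    show "AE \<beta>::'a in lborel. (\<lambda>j. complex_of_real (gauss (e j *\<^sub>R \<beta>)) * (FT h \<beta> * FT k (- \<beta>))) \<longlonglongrightarrow> FT h \<beta> * FT k (- \<beta>)"
    proof (intro always_eventually allI)
      fix \<beta> :: 'a
      have "(\<lambda>j. complex_of_real (gauss (e j *\<^sub>R \<beta>))) \<longlonglongrightarrow> complex_of_real (gauss (0 *\<^sub>R \<beta>))"
        unfolding gauss_def using e(2) by (intro tendsto_intros) auto
      from tendsto_mult[OF this tendsto_const[of "FT h \<beta> * FT k (- \<beta>)"]]
      show "(\<lambda>j. complex_of_real (gauss (e j *\<^sub>R \<beta>)) * (FT h \<beta> * FT k (- \<beta>))) \<longlonglongrightarrow> FT h \<beta> * FT k (- \<beta>)"
        by simp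
    qed
    next
    show "integrable lborel (\<lambda>\<beta>. norm (FT h \<beta> * FT k (- \<beta>)))"
      using hk by (rule integrable_norm)
  qed (auto simp: norm_mult gauss_le_1 mult_left_le_one_le)
  let ?S = "\<lambda>j x. \<integral>w. k (x + e j *\<^sub>R w) * complex_of_real (gauss w) \<partial>lborel"
  have S: "norm (?S j x) \<le> B * sqrt (2 * pi) ^ DIM('a)" for j x
  proof -
    have "norm (?S j x) \<le> (\<integral>w. B * gauss (w::'a) \<partial>lborel)"
    proof (rule Bochner_Integration.integral_norm_bound_integral)
      show "integrable lborel (\<lambda>w. k (x + e j *\<^sub>R w) * complex_of_real (gauss w))"
        by (rule Bochner_Integration.integrable_bound[of _ "\<lambda>w. B * gauss w"])
           (auto simp: integrable_gauss norm_mult intro!: always_eventually order_trans[OF _ abs_ge_self] mult_right_mono B)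
    qed (auto simp: integrable_gauss norm_mult intro!: mult_right_mono B)
    then show ?thesis by (simp add: integral_gauss)
  qed
  have T: "T j = complex_of_real (sqrt (2 * pi) ^ DIM('a)) * (\<integral>x. h x * ?S j x \<partial>lborel)" for j
  proof -
    let ?F = "\<lambda>x \<beta>. h x * (iexp (- (\<beta> \<bullet> x)) * complex_of_real (gauss (e j *\<^sub>R \<beta>)) * FT k (- \<beta>))"
    have int: "integrable (lborel \<Otimes>\<^sub>M lborel) (\<lambda>(x, \<beta>). ?F x \<beta>)"
      by (rule integrable_pair_bound[OF _ integrable_norm[OF h]
            integrable_mult_right[OF integrable_gauss_scaled[OF e(1)], of "\<integral>x. norm (k x) \<partial>lborel" j]])
         (auto simp: norm_mult mult.assoc mult.commute[of "gauss _"] intro!: mult_left_mono mult_right_mono norm_FT_le k)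
    have "T j = (\<integral>\<beta>. \<integral>x. ?F x \<beta> \<partial>lborel \<partial>lborel)"
      unfolding T_def by (intro Bochner_Integration.integral_cong refl)
         (simp add: FT_def flip: integral_mult_right_zero integral_mult_left_zero add: mult_ac)
    also have "\<dots> = (\<integral>x. \<integral>\<beta>. ?F x \<beta> \<partial>lborel \<partial>lborel)"
      by (rule lborel_pair.Fubini_integral[OF int])
    also have "\<dots> = (\<integral>x. h x * (\<integral>\<beta>. iexp (- (\<beta> \<bullet> x)) * complex_of_real (gauss (e j *\<^sub>R \<beta>)) * FT k (- \<beta>) \<partial>lborel) \<partial>lborel)"
      by simp
    also have "\<dots> = (\<integral>x. complex_of_real (sqrt (2 * pi) ^ DIM('a)) * (h x * ?S j x) \<partial>lborel)"
      by (simp only: integral_mult_gauss_FT[OF k e(1)] mult.left_commute)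
    finally show ?thesis by simp
  qed
  have "(\<lambda>j. \<integral>x. h x * ?S j x \<partial>lborel) \<longlonglongrightarrow> (\<integral>x. h x * (complex_of_real (sqrt (2 * pi) ^ DIM('a)) * k x) \<partial>lborel)"
  proof (rule integral_dominated_convergence[where w = "\<lambda>x. norm (h x) * (B * sqrt (2 * pi) ^ DIM('a))"])
    show "AE x in lborel. (\<lambda>j. h x * ?S j x) \<longlonglongrightarrow> h x * (complex_of_real (sqrt (2 * pi) ^ DIM('a)) * k x)"
      by (intro always_eventually allI tendsto_mult tendsto_const tendsto_gauss_average[OF cont B e(2)])
  qed (use h in \<open>auto simp: norm_mult intro!: mult_left_mono S\<close>)
  then have "T \<longlonglongrightarrow> complex_of_real (sqrt (2 * pi) ^ DIM('a)) * (\<integral>x. h x * (complex_of_real (sqrt (2 * pi) ^ DIM('a)) * k x) \<partial>lborel)"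
    unfolding T by (intro tendsto_intros)
  also have "complex_of_real (sqrt (2 * pi) ^ DIM('a)) * (\<integral>x. h x * (complex_of_real (sqrt (2 * pi) ^ DIM('a)) * k x) \<partial>lborel)
     = complex_of_real ((2 * pi) ^ DIM('a)) * (\<integral>x. h x * k x \<partial>lborel)"
  proof -
    have "complex_of_real (sqrt (2 * pi) ^ DIM('a)) * complex_of_real (sqrt (2 * pi) ^ DIM('a)) = complex_of_real ((2 * pi) ^ DIM('a))"
      by (simp only: of_real_mult[symmetric] power_mult_distrib[symmetric] real_sqrt_mult_self) simp
    then show ?thesis
      by (simp only: mult.left_commute[of "h _"] integral_mult_right_zero) (simp only: mult.assoc[symmetric])
  qed
  finally show "T \<longlonglongrightarrow> complex_of_real ((2 * pi) ^ DIM('a)) * (\<integral>x. h x * k x \<partial>lborel)" .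
qed

text \<open>Test with continuous approximations of the phase of \<open>h\<close> on \<open>{x. norm (h x) > K}\<close>.\<close>
lemma AE_norm_le_of_continuous_test:
  fixes h :: "'a::euclidean_space \<Rightarrow> complex"
  assumes h: "integrable lborel h" and K: "0 \<le> K"
    and test: "\<And>k B. continuous_on UNIV k \<Longrightarrow> (\<And>x. norm (k x) \<le> B) \<Longrightarrow> integrable lborel k \<Longrightarrow>
       norm (\<integral>x. h x * k x \<partial>lborel) \<le> K * (\<integral>x. norm (k x) \<partial>lborel)"
  shows "AE x in lborel. norm (h x) \<le> K"
proof -
  have hm [measurable]: "h \<in> borel_measurable borel" using h by auto
  have cnj_m: "cnj \<in> borel_measurable borel"
    by (intro borel_measurable_continuous_onI continuous_intros)
  define T where "T x = (if norm (h x) > K then cnj (sgn (h x)) else 0)" for x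
  have Tm [measurable]: "T \<in> borel_measurable borel"
    unfolding T_def sgn_div_norm by (intro measurable_If measurable_compose[OF _ cnj_m]) measurable
  have Tm': "T \<in> borel_measurable lebesgue"
    by (rule measurable_completion) simp
  \<comment> \<open>A measurable function is a pointwise limit of continuous functions off a
    negligible set, which supplies the approximations of the phase.\<close>
  have "T measurable_on UNIV"
    by (rule lebesgue_measurable_imp_measurable_on[OF Tm']) simp
  then obtain N g where N: "negligible N" and g: "\<And>n. continuous_on UNIV (g n)"
      and lim: "\<And>x. x \<notin> N \<Longrightarrow> (\<lambda>n. g n x) \<longlonglongrightarrow> T x"
    unfolding measurable_on_def by auto
  have AE_lim: "AE x in lborel. (\<lambda>n. g n x) \<longlonglongrightarrow> T x"
  proof -
    have "AE x in lebesgue. x \<notin> N"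
      using N by (simp add: negligible_iff_null_sets AE_not_in)
    then have "AE x in lborel. x \<notin> N"
      by (simp add: AE_completion_iff)
    then show ?thesis using lim by auto
  qed
  \<comment> \<open>Division by the maximum with one maps the values into the unit disc continuously
    and does not disturb the limit, as \<open>norm (T x) \<le> 1\<close>; the Gaussian makes the
    test functions integrable with a common majorant.\<close>
  define k where "k n x = g n x / complex_of_real (max 1 (norm (g n x))) * complex_of_real (gauss x)" for n x
  have k_cont: "continuous_on UNIV (k n)" for n
    unfolding k_def by (intro continuous_intros g) auto
  then have [measurable]: "k n \<in> borel_measurable borel" for n
    by (rule borel_measurable_continuous_onI)
  have k_le: "norm (k n x) \<le> gauss x" for n x
  proof -
    have "norm (g n x) / max 1 (norm (g n x)) \<le> 1"
      by (subst pos_divide_le_eq) (auto simp: less_max_iff_disj)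
    moreover have "norm (k n x) = norm (g n x) / max 1 (norm (g n x)) * gauss x"
      by (simp add: k_def norm_mult norm_divide)
    ultimately show ?thesis
      using mult_right_mono[of _ 1 "gauss x"] by (simp only: gauss_nonneg mult_1_left)
  qed
  have k_int: "integrable lborel (k n)" for n
    by (rule Bochner_Integration.integrable_bound[OF integrable_gauss]) (auto simp: k_le)
  have T_le: "norm (T x) \<le> 1" for x
    by (auto simp: T_def norm_sgn)
  have k_lim: "AE x in lborel. (\<lambda>n. k n x) \<longlonglongrightarrow> T x * complex_of_real (gauss x)"
    using AE_lim
  proof eventually_elim
    case (elim x)
    have "(\<lambda>n. k n x) \<longlonglongrightarrow> T x / complex_of_real (max 1 (norm (T x))) * complex_of_real (gauss x)"
      unfolding k_def using elim by (intro tendsto_intros) auto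
    then show ?case using T_le[of x] by (simp add: max_absorb1)
  qed
  let ?w = "\<lambda>x. if norm (h x) > K then gauss x else 0"
  have "norm (\<integral>x. h x * (T x * complex_of_real (gauss x)) \<partial>lborel) \<le> K * (\<integral>x. norm (T x * complex_of_real (gauss x)) \<partial>lborel)"
  proof (rule LIMSEQ_le)
    show "(\<lambda>n. norm (\<integral>x. h x * k n x \<partial>lborel)) \<longlonglongrightarrow> norm (\<integral>x. h x * (T x * complex_of_real (gauss x)) \<partial>lborel)"
    proof (intro tendsto_norm integral_dominated_convergence[where w = "\<lambda>x. norm (h x)"])
      show "AE x in lborel. (\<lambda>n. h x * k n x) \<longlonglongrightarrow> h x * (T x * complex_of_real (gauss x))"
        using k_lim by eventually_elim (intro tendsto_intros)
      show "AE x in lborel. norm (h x * k n x) \<le> norm (h x)" for n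
        using order_trans[OF k_le gauss_le_1] by (auto simp: norm_mult mult_left_le)
    qed (use h in auto)
    show "(\<lambda>n. K * (\<integral>x. norm (k n x) \<partial>lborel)) \<longlonglongrightarrow> K * (\<integral>x. norm (T x * complex_of_real (gauss x)) \<partial>lborel)"
    proof (intro tendsto_intros integral_dominated_convergence[where w = gauss])
      show "AE x in lborel. (\<lambda>n. norm (k n x)) \<longlonglongrightarrow> norm (T x * complex_of_real (gauss x))"
        using k_lim by eventually_elim (intro tendsto_intros)
    qed (auto simp: k_le integrable_gauss)
    show "\<exists>N. \<forall>n\<ge>N. norm (\<integral>x. h x * k n x \<partial>lborel) \<le> K * (\<integral>x. norm (k n x) \<partial>lborel)"
      using test[OF k_cont order_trans[OF k_le gauss_le_1] k_int] by auto
  qed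
  also have "(\<integral>x. h x * (T x * complex_of_real (gauss x)) \<partial>lborel) = complex_of_real (\<integral>x. norm (h x) * ?w x \<partial>lborel)"
  proof -
    have "z * cnj (sgn z) = complex_of_real (norm z)" for z
    proof (cases "z = 0")
      case False
      have "z * cnj (sgn z) = complex_of_real (inverse (norm z)) * (z * cnj z)"
        by (simp add: sgn_div_norm scaleR_conv_of_real)
      with False show ?thesis
        unfolding complex_norm_square[symmetric] by (simp add: power2_eq_square)
    qed simp
    then have "h x * (T x * complex_of_real (gauss x)) = complex_of_real (norm (h x) * ?w x)" for x
      by (simp add: T_def flip: mult.assoc)
    then show ?thesis by (simp only: integral_complex_of_real)
  qed
  also have "K * (\<integral>x. norm (T x * complex_of_real (gauss x)) \<partial>lborel) \<le> (\<integral>x. K * ?w x \<partial>lborel)"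
  proof -
    have "norm (T x * complex_of_real (gauss x)) = ?w x" for x
      using K by (auto simp: T_def norm_mult norm_sgn)
    then show ?thesis by simp
  qed
  finally have le: "norm (complex_of_real (\<integral>x. norm (h x) * ?w x \<partial>lborel)) \<le> (\<integral>x. K * ?w x \<partial>lborel)" .
  have w_int: "integrable lborel ?w"
    by (rule Bochner_Integration.integrable_bound[OF integrable_gauss]) auto
  have hw_int: "integrable lborel (\<lambda>x. norm (h x) * ?w x)"
    by (rule Bochner_Integration.integrable_bound[OF integrable_norm[OF h]])
       (auto simp: gauss_le_1 mult_left_le)
  \<comment> \<open>\<open>?w\<close> is supported where \<open>norm (h x) > K\<close>, so the
    integrand is nonnegative while the tested inequality makes its integral nonpositive; it must
    vanish almost everywhere.\<close>
  have "(\<integral>x. norm (h x) * ?w x - K * ?w x \<partial>lborel) \<le> 0"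
    using le w_int hw_int by (subst Bochner_Integration.integral_diff) auto
  moreover have nn: "0 \<le> norm (h x) * ?w x - K * ?w x" for x
    by (auto simp flip: left_diff_distrib)
  ultimately have "(\<integral>x. norm (h x) * ?w x - K * ?w x \<partial>lborel) = 0"
    by (intro antisym integral_nonneg_AE) auto
  then have "AE x in lborel. norm (h x) * ?w x - K * ?w x = 0"
    using w_int hw_int nn by (subst (asm) integral_nonneg_eq_0_iff_AE) auto
  then show ?thesis
  proof eventually_elim
    case (elim x)
    then have "norm (h x) = K" if "norm (h x) > K"
      using that by (simp flip: left_diff_distrib) (metis gauss_pos less_irrefl)
    then show ?case by force
  qed
qed

section \<open>Symbols and Hermite functions\<close>

lemma dderiv_append: "dderiv (vs @ ws) f = dderiv vs (dderiv ws f)"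
  by (induction vs) auto

lemma smooth_fun_dderiv: "smooth_fun f \<Longrightarrow> set ws \<subseteq> Basis \<Longrightarrow> smooth_fun (dderiv ws f)"
  unfolding smooth_fun_def by (metis dderiv_append le_sup_iff set_append)

lemma smooth_fun_differentiable: "smooth_fun f \<Longrightarrow> f differentiable (at x)"
  unfolding smooth_fun_def by (metis dderiv.simps(1) empty_subsetI list.set(1))

lemma smooth_fun_continuous: "smooth_fun f \<Longrightarrow> continuous_on UNIV f"
  by (intro differentiable_imp_continuous_on) (simp add: differentiable_on_def smooth_fun_differentiable)

lemma has_vector_derivative_line:
  assumes "f differentiable (at x)"
  shows "((\<lambda>t. f (x + t *\<^sub>R v)) has_vector_derivative frechet_derivative f (at x) v) (at 0)"
proof -
  have "(f has_derivative frechet_derivative f (at x)) (at (x + 0 *\<^sub>R v))"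
    using assms by (simp add: frechet_derivative_works)
  moreover have "((\<lambda>t. x + t *\<^sub>R v) has_vector_derivative v) (at 0)"
    by (auto intro!: derivative_eq_intros)
  ultimately show ?thesis
    using vector_derivative_diff_chain_within[of "\<lambda>t. x + t *\<^sub>R v" v 0 UNIV f]
    by (simp add: o_def has_derivative_at_withinI)
qed

lemma smooth_fun_has_vector_derivative:
  assumes "smooth_fun f" and "((\<lambda>t. g t) has_vector_derivative v) (at t)"
  shows "((\<lambda>t. f (g t)) has_vector_derivative frechet_derivative f (at (g t)) v) (at t)"
proof -
  have "(f has_derivative frechet_derivative f (at (g t))) (at (g t))"
    using smooth_fun_differentiable[OF assms(1)] by (simp add: frechet_derivative_works)
  then show ?thesis
    using vector_derivative_diff_chain_within[of g v t UNIV f] assms(2)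
    by (simp add: o_def has_derivative_at_withinI)
qed

text \<open>Each derivative gets one constant for the whole index set, which is how uniformity in
  the semiclassical parameter and in the centre is carried along. Using the same quadratic weight
  for all derivatives makes the notion stable under differentiation.\<close>

definition symbol_family :: "'i set \<Rightarrow> ('i \<Rightarrow> 'a::euclidean_space \<Rightarrow> complex) \<Rightarrow> bool" where
  "symbol_family S a \<longleftrightarrow> (\<forall>i\<in>S. smooth_fun (a i)) \<and>
     (\<forall>vs. set vs \<subseteq> Basis \<longrightarrow> (\<exists>C. \<forall>i\<in>S. \<forall>X. norm (dderiv vs (a i) X) \<le> C * bracket X ^ 2))"

lemma symbol_family_dderiv:
  assumes "symbol_family S a" "set ws \<subseteq> Basis"
  shows "symbol_family S (\<lambda>i. dderiv ws (a i))"
  unfolding symbol_family_def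
proof (intro conjI ballI allI impI)
  show "smooth_fun (dderiv ws (a i))" if "i \<in> S" for i
    using assms that by (auto simp: symbol_family_def smooth_fun_dderiv)
  fix vs :: "'b list" assume "set vs \<subseteq> Basis"
  then have "set (vs @ ws) \<subseteq> Basis" using assms by simp
  then show "\<exists>C. \<forall>i\<in>S. \<forall>X. norm (dderiv vs (dderiv ws (a i)) X) \<le> C * bracket X ^ 2"
    using assms(1) unfolding symbol_family_def by (metis dderiv_append)
qed

lemma symbol_family_bound:
  assumes "symbol_family S a"
  obtains C where "C \<ge> 0" "\<And>i X. i \<in> S \<Longrightarrow> norm (a i X) \<le> C * bracket X ^ 2"
proof -
  have "set [] \<subseteq> (Basis :: 'b set)" by simp
  then obtain C where C: "\<And>i X. i \<in> S \<Longrightarrow> norm (dderiv [] (a i) X) \<le> C * bracket X ^ 2"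
    using assms unfolding symbol_family_def by blast
  show thesis
  proof (rule that[of "max C 0"])
    fix i and X :: 'b assume "i \<in> S"
    have "C * bracket X ^ 2 \<le> max C 0 * bracket X ^ 2"
      by (intro mult_right_mono) auto
    with C[OF \<open>i \<in> S\<close>, of X] show "norm (a i X) \<le> max C 0 * bracket X ^ 2" by simp
  qed simp
qed

lemma symbol_family_smooth: "symbol_family S a \<Longrightarrow> i \<in> S \<Longrightarrow> smooth_fun (a i)"
  by (simp add: symbol_family_def)

text \<open>A Gaussian of rate \<open>c\<close> with real linear term \<open>w\<close> and frequency
  \<open>d\<close>. The standard window and the coherent states in the original variables both have
  this form up to a constant factor, so one argument gives the decay of both.\<close>

definition gexp :: "real \<Rightarrow> 'a::euclidean_space \<Rightarrow> 'a \<Rightarrow> 'a \<Rightarrow> complex" where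
  "gexp c w d x = exp (complex_of_real (- c * (x \<bullet> x) + x \<bullet> w) + \<i> * complex_of_real (x \<bullet> d))"

text \<open>Polynomials times \<open>g\<close>, presented by closure rules so that stability under
  derivatives and rapid decay become inductions.\<close>

inductive gpoly :: "('a::euclidean_space \<Rightarrow> complex) \<Rightarrow> ('a \<Rightarrow> complex) \<Rightarrow> bool" for g where
  gpoly_base: "gpoly g g"
| gpoly_inner: "gpoly g f \<Longrightarrow> gpoly g (\<lambda>x. complex_of_real (x \<bullet> w) * f x)"
| gpoly_scale: "gpoly g f \<Longrightarrow> gpoly g (\<lambda>x. z * f x)"
| gpoly_add: "gpoly g f \<Longrightarrow> gpoly g f' \<Longrightarrow> gpoly g (\<lambda>x. f x + f' x)"

text \<open>Differentiability and closure are proved in one induction, because the derivative of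
  \<open>f\<close> times a linear function contains both \<open>f\<close> and its
  derivative.\<close>

lemma gpoly_derivative:
  assumes "gpoly (gexp c w d) f"
  shows "(\<forall>x. f differentiable (at x)) \<and> (\<forall>v. gpoly (gexp c w d) (\<lambda>x. frechet_derivative f (at x) v))"
  using assms
proof induction
  case gpoly_base
  let ?D = "\<lambda>x v. (complex_of_real (- 2 * c) * complex_of_real (x \<bullet> v) + (complex_of_real (v \<bullet> w) + \<i> * complex_of_real (v \<bullet> d))) * gexp c w d x"
  have D: "(gexp c w d has_derivative ?D x) (at x)" for x
  proof -
    let ?l = "\<lambda>x. complex_of_real (- c * (x \<bullet> x) + x \<bullet> w) + \<i> * complex_of_real (x \<bullet> d)"
    have l: "(?l has_derivative (\<lambda>v. complex_of_real (- 2 * c) * complex_of_real (x \<bullet> v) + (complex_of_real (v \<bullet> w) + \<i> * complex_of_real (v \<bullet> d)))) (at x)"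
      by (rule derivative_eq_intros refl)+ (auto simp: fun_eq_iff algebra_simps inner_commute)
    have "(exp has_derivative (*) (exp (?l x))) (at (?l x))"
      using DERIV_exp by (simp add: has_field_derivative_def)
    from has_derivative_compose[OF l this] show ?thesis
      by (simp add: gexp_def[abs_def] mult.commute)
  qed
  have fd: "frechet_derivative (gexp c w d) (at x) = ?D x" for x
    by (rule frechet_derivative_at[OF D, symmetric])
  have "gpoly (gexp c w d) (\<lambda>x. ?D x v)" for v
    using gpoly.gpoly_add[OF gpoly.gpoly_scale[OF gpoly.gpoly_inner[OF gpoly.gpoly_base]] gpoly.gpoly_scale[OF gpoly.gpoly_base],
        of "gexp c w d" "complex_of_real (- 2 * c)" v "complex_of_real (v \<bullet> w) + \<i> * complex_of_real (v \<bullet> d)"]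
    by (simp only: distrib_right mult.assoc)
  moreover have "gexp c w d differentiable (at x)" for x
    using D unfolding differentiable_def by blast
  ultimately show ?case unfolding fd by blast
next
  case (gpoly_inner f u)
  then have f: "(f has_derivative frechet_derivative f (at x)) (at x)" for x
    by (simp add: frechet_derivative_works)
  let ?D = "\<lambda>x v. complex_of_real (x \<bullet> u) * frechet_derivative f (at x) v + complex_of_real (v \<bullet> u) * f x"
  have D: "((\<lambda>x. complex_of_real (x \<bullet> u) * f x) has_derivative ?D x) (at x)" for x
    by (rule derivative_eq_intros f refl)+ simp
  have fd: "frechet_derivative (\<lambda>x. complex_of_real (x \<bullet> u) * f x) (at x) = ?D x" for x
    by (rule frechet_derivative_at[OF D, symmetric])
  show ?case
  proof (intro conjI allI)
    show "(\<lambda>x. complex_of_real (x \<bullet> u) * f x) differentiable (at x)" for x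
      using D unfolding differentiable_def by blast
    show "gpoly (gexp c w d) (\<lambda>x. frechet_derivative (\<lambda>x. complex_of_real (x \<bullet> u) * f x) (at x) v)" for v
      unfolding fd using gpoly_inner by (intro gpoly.gpoly_add gpoly.gpoly_inner gpoly.gpoly_scale) auto
  qed
next
  case (gpoly_scale f z)
  then have f: "(f has_derivative frechet_derivative f (at x)) (at x)" for x
    by (simp add: frechet_derivative_works)
  let ?D = "\<lambda>x v. z * frechet_derivative f (at x) v"
  have D: "((\<lambda>x. z * f x) has_derivative ?D x) (at x)" for x
    by (rule derivative_eq_intros f refl)+ simp
  have fd: "frechet_derivative (\<lambda>x. z * f x) (at x) = ?D x" for x
    by (rule frechet_derivative_at[OF D, symmetric])
  show ?case
  proof (intro conjI allI)
    show "(\<lambda>x. z * f x) differentiable (at x)" for x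
      using D unfolding differentiable_def by blast
    show "gpoly (gexp c w d) (\<lambda>x. frechet_derivative (\<lambda>x. z * f x) (at x) v)" for v
      unfolding fd using gpoly_scale by (intro gpoly.gpoly_scale) auto
  qed
next
  case (gpoly_add f g)
  then have f: "(f has_derivative frechet_derivative f (at x)) (at x)"
    and g: "(g has_derivative frechet_derivative g (at x)) (at x)" for x
    by (simp_all add: frechet_derivative_works)
  let ?D = "\<lambda>x v. frechet_derivative f (at x) v + frechet_derivative g (at x) v"
  have D: "((\<lambda>x. f x + g x) has_derivative ?D x) (at x)" for x
    by (rule derivative_eq_intros f g refl)+
  have fd: "frechet_derivative (\<lambda>x. f x + g x) (at x) = ?D x" for x
    by (rule frechet_derivative_at[OF D, symmetric])
  show ?case
  proof (intro conjI allI)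
    show "(\<lambda>x. f x + g x) differentiable (at x)" for x
      using D unfolding differentiable_def by blast
    show "gpoly (gexp c w d) (\<lambda>x. frechet_derivative (\<lambda>x. f x + g x) (at x) v)" for v
      unfolding fd using gpoly_add by (intro gpoly.gpoly_add) auto
  qed
qed

lemma norm_gexp: "norm (gexp c w d x) = exp (- c * (x \<bullet> x) + x \<bullet> w)"
  by (simp add: gexp_def norm_exp_eq_Re)

text \<open>The exponent \<open>k\<close> is generalised in the induction since a linear factor
  costs one power of the weight.\<close>

lemma gpoly_decay:
  assumes "gpoly (gexp c w d) f" and c: "c > 0"
  shows "\<exists>C\<ge>0. \<forall>x. bracket x ^ k * norm (f x) \<le> C"
  using assms(1)
proof (induction arbitrary: k)
  case gpoly_base
  \<comment> \<open>The weight is at most \<open>exp (real k * norm x)\<close> and the linear term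
    contributes at most \<open>norm w * norm x\<close> to the exponent; \<open>m\<close> is their
    total rate, and completing the square against \<open>c\<close> produces
    \<open>m\<^sup>2 / (4 * c)\<close>.\<close>
  define m where "m = real k + norm w"
  have "bracket x ^ k * norm (gexp c w d x) \<le> exp (real k + m\<^sup>2 / (4 * c))" for x
  proof -
    have "bracket x ^ k \<le> exp (norm x) ^ k"
      using exp_ge_add_one_self[of "norm x"] by (intro power_mono) auto
    also have "\<dots> = exp (real k * norm x)"
      by (simp add: exp_of_nat_mult)
    finally have 1: "bracket x ^ k \<le> exp (real k * norm x)" .
    have "x \<bullet> w \<le> norm x * norm w" by (rule norm_cauchy_schwarz)
    then have "norm (gexp c w d x) \<le> exp (- c * (norm x)\<^sup>2 + norm x * norm w)"
      by (simp add: norm_gexp power2_norm_eq_inner)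
    then have "bracket x ^ k * norm (gexp c w d x) \<le> exp (real k * norm x) * exp (- c * (norm x)\<^sup>2 + norm x * norm w)"
      by (intro mult_mono 1) auto
    also have "\<dots> = exp (m * norm x - c * (norm x)\<^sup>2)"
      by (simp add: m_def algebra_simps flip: exp_add)
    also have "m * norm x - c * (norm x)\<^sup>2 \<le> m\<^sup>2 / (4 * c)"
    proof -
      have "0 \<le> (2 * c * norm x - m)\<^sup>2 / (4 * c)" using c by simp
      also have "\<dots> = m\<^sup>2 / (4 * c) - (m * norm x - c * (norm x)\<^sup>2)"
        using c by (simp add: power2_eq_square field_simps)
      finally show ?thesis by simp
    qed
    also have "m\<^sup>2 / (4 * c) \<le> real k + m\<^sup>2 / (4 * c)" by simp
    finally show ?thesis by simp
  qed
  then show ?case by (intro exI[of _ "exp (real k + m\<^sup>2 / (4 * c))"]) auto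
next
  case (gpoly_inner f u)
  obtain C where C: "C \<ge> 0" "\<And>x. bracket x ^ Suc k * norm (f x) \<le> C"
    using gpoly_inner.IH[of "Suc k"] by blast
  have "bracket x ^ k * norm (complex_of_real (x \<bullet> u) * f x) \<le> norm u * C" for x
  proof -
    have "\<bar>x \<bullet> u\<bar> \<le> norm x * norm u" by (rule Cauchy_Schwarz_ineq2)
    also have "\<dots> \<le> bracket x * norm u" by (intro mult_right_mono) auto
    finally have "bracket x ^ k * norm (complex_of_real (x \<bullet> u) * f x) \<le> bracket x ^ k * ((bracket x * norm u) * norm (f x))"
      unfolding norm_mult norm_of_real by (intro mult_left_mono mult_right_mono) auto
    also have "\<dots> = norm u * (bracket x ^ Suc k * norm (f x))" by (simp add: mult_ac)
    also have "\<dots> \<le> norm u * C" by (intro mult_left_mono C) auto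
    finally show ?thesis .
  qed
  then show ?case using C(1) by (intro exI[of _ "norm u * C"]) auto
next
  case (gpoly_scale f z)
  obtain C where C: "C \<ge> 0" "\<And>x. bracket x ^ k * norm (f x) \<le> C"
    using gpoly_scale.IH[of k] by blast
  show ?case
    using C mult_left_mono[OF C(2), of "norm z"]
    by (intro exI[of _ "norm z * C"]) (auto simp: norm_mult mult.left_commute)
next
  case (gpoly_add f g)
  obtain C where C: "C \<ge> 0" "\<And>x. bracket x ^ k * norm (f x) \<le> C"
    using gpoly_add.IH(1)[of k] by blast
  obtain C' where C': "C' \<ge> 0" "\<And>x. bracket x ^ k * norm (g x) \<le> C'"
    using gpoly_add.IH(2)[of k] by blast
  have "bracket x ^ k * norm (f x + g x) \<le> C + C'" for x
  proof -
    have "bracket x ^ k * norm (f x + g x) \<le> bracket x ^ k * (norm (f x) + norm (g x))"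
      by (intro mult_left_mono norm_triangle_ineq) auto
    also have "\<dots> \<le> C + C'" using C(2)[of x] C'(2)[of x] by (simp add: distrib_left)
    finally show ?thesis .
  qed
  then show ?case using C(1) C'(1) by (intro exI[of _ "C + C'"]) auto
qed

lemma gpoly_dderiv:
  "gpoly (gexp c w d) f \<Longrightarrow> gpoly (gexp c w d) (dderiv vs f)"
  by (induction vs) (auto simp: gpoly_derivative)

lemma gpoly_smooth: "gpoly (gexp c w d) f \<Longrightarrow> smooth_fun f"
  unfolding smooth_fun_def using gpoly_dderiv gpoly_derivative by blast

lemma gpoly_schwartz:
  assumes "gpoly (gexp c w d) f" and "c > 0"
  shows "schwartz f"
  unfolding schwartz_def
proof (intro conjI allI impI)
  show "smooth_fun f" using assms(1) by (rule gpoly_smooth)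
  fix vs k
  obtain C where "\<And>x. bracket x ^ k * norm (dderiv vs f x) \<le> C"
    using gpoly_decay[OF gpoly_dderiv[OF assms(1)] assms(2)] by blast
  then show "bounded (range (\<lambda>x. (1 + norm x) ^ k *\<^sub>R dderiv vs f x))"
    by (intro boundedI[of _ C]) auto
qed

abbreviation hermite :: "('a::euclidean_space \<Rightarrow> complex) \<Rightarrow> bool" where
  "hermite \<equiv> gpoly (gexp (1/2) 0 0)"

lemma gexp_gauss: "gexp (1/2) 0 0 x = complex_of_real (gauss x)"
  by (simp add: gexp_def gauss_def exp_of_real[symmetric])

lemma hermite_gauss: "hermite (\<lambda>x. complex_of_real (gauss x))"
  using gpoly_base[of "gexp (1/2) 0 0"] by (simp add: gexp_gauss[abs_def])

lemma hermite_bound: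
  assumes "hermite f"
  obtains C where "C \<ge> 0" "\<And>x. norm (f x) \<le> C / bracket x ^ k"
proof -
  obtain C where C: "C \<ge> 0" "\<And>x. bracket x ^ k * norm (f x) \<le> C"
    using gpoly_decay[OF assms, of k] by auto
  have "0 < bracket x ^ k" for x :: 'a by (simp add: add_pos_nonneg)
  with C show thesis
    by (intro that[of C]) (auto simp: pos_le_divide_eq mult.commute)
qed

section \<open>Weyl quantization of Hermite functions\<close>

text \<open>Words of derivatives stay folded from here on, since the estimates are formulated for
  \<open>dderiv vs\<close> and not for nested Frechet derivatives.\<close>

declare dderiv.simps [simp del]

lemma dderiv_single: "dderiv [b] f = (\<lambda>x. frechet_derivative f (at x) b)"
  by (simp add: dderiv.simps)

text \<open>A convergent sequence of parameters is bounded, so polynomial growth in the parameter is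
  harmless for dominated convergence.\<close>

lemma continuous_on_integral_param:
  fixes f :: "'x::real_normed_vector \<Rightarrow> 'b::euclidean_space \<Rightarrow> complex"
  assumes cont: "\<And>y. continuous_on UNIV (\<lambda>x. f x y)"
    and [measurable]: "\<And>x. f x \<in> borel_measurable borel"
    and bound: "\<And>x y. norm (f x y) \<le> bracket x ^ m * g y"
    and g: "integrable lborel g"
  shows "continuous_on UNIV (\<lambda>x. \<integral>y. f x y \<partial>lborel)"
  unfolding continuous_on_sequentially o_def
proof (intro allI ballI impI)
  fix u x assume *: "(\<forall>n. u n \<in> UNIV) \<and> u \<longlonglongrightarrow> (x::'x)"
  then have "Bseq u" by (intro convergent_imp_Bseq convergentI) auto
  then obtain M where M: "M > 0" "\<And>n. norm (u n) \<le> M"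
    by (auto simp: Bseq_def)
  have g0: "0 \<le> g y" for y
    using order_trans[OF norm_ge_zero bound[of 0 y]] by simp
  show "(\<lambda>n. \<integral>y. f (u n) y \<partial>lborel) \<longlonglongrightarrow> (\<integral>y. f x y \<partial>lborel)"
  proof (rule integral_dominated_convergence[where w = "\<lambda>y. (1 + M) ^ m * g y"])
    show "AE y in lborel. (\<lambda>n. f (u n) y) \<longlonglongrightarrow> f x y"
      using * by (intro always_eventually allI continuous_on_tendsto_compose[OF cont]) auto
    show "AE y in lborel. norm (f (u n) y) \<le> (1 + M) ^ m * g y" for n
    proof (intro always_eventually allI)
      fix y
      have "bracket (u n) ^ m * g y \<le> (1 + M) ^ m * g y"
        using M(2)[of n] by (intro mult_right_mono power_mono g0) auto
      with bound[of "u n" y] show "norm (f (u n) y) \<le> (1 + M) ^ m * g y" by simp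
    qed
  qed (use g in auto)
qed

text \<open>Integration by parts yields decay one coordinate at a time; comparison with the largest
  coordinate converts this into decay of the full weight.\<close>

lemma bracket_power_le_sum:
  fixes x :: "'a::euclidean_space"
  shows "bracket x ^ k \<le> (1 + real DIM('a)) ^ k * (1 + (\<Sum>b\<in>Basis. \<bar>x \<bullet> b\<bar> ^ k))"
proof -
  define m where "m = Max ((\<lambda>b. \<bar>x \<bullet> b\<bar>) ` (Basis::'a set))"
  have le: "\<bar>x \<bullet> b\<bar> \<le> m" if "b \<in> Basis" for b
    unfolding m_def using that by (intro Max_ge) auto
  have "m \<in> (\<lambda>b. \<bar>x \<bullet> b\<bar>) ` (Basis::'a set)"
    unfolding m_def by (intro Max_in) auto
  then obtain b0 where b0: "b0 \<in> Basis" "m = \<bar>x \<bullet> b0\<bar>" by auto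
  have "norm x \<le> (\<Sum>b\<in>Basis. \<bar>x \<bullet> b\<bar>)" by (rule norm_le_l1)
  also have "\<dots> \<le> (\<Sum>b\<in>(Basis::'a set). m)" by (intro sum_mono le)
  finally have n: "norm x \<le> real DIM('a) * m" by simp
  have "bracket x \<le> (1 + real DIM('a)) * max 1 m"
  proof -
    have "real DIM('a) * m \<le> real DIM('a) * max 1 m" by (intro mult_left_mono) auto
    moreover have "1 \<le> max 1 m" by simp
    ultimately show ?thesis using n unfolding distrib_right by linarith
  qed
  then have "bracket x ^ k \<le> ((1 + real DIM('a)) * max 1 m) ^ k"
    by (intro power_mono) auto
  also have "\<dots> = (1 + real DIM('a)) ^ k * max 1 m ^ k" by (rule power_mult_distrib)
  also have "max 1 m ^ k \<le> 1 + (\<Sum>b\<in>Basis. \<bar>x \<bullet> b\<bar> ^ k)"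
  proof -
    have "m ^ k \<le> (\<Sum>b\<in>Basis. \<bar>x \<bullet> b\<bar> ^ k)"
      unfolding b0(2) by (rule member_le_sum) (use b0 in auto)
    moreover have "0 \<le> (\<Sum>b\<in>Basis. \<bar>x \<bullet> b\<bar> ^ k)" by (intro sum_nonneg) auto
    ultimately show ?thesis by (simp add: max_def)
  qed
  finally show ?thesis by (simp add: mult_left_mono)
qed

lemma bracket_decay_of_coordinates:
  fixes x :: "'a::euclidean_space"
  assumes "\<And>b. b \<in> Basis \<Longrightarrow> \<bar>x \<bullet> b\<bar> ^ k * r \<le> B b" and "r \<le> A" and "0 \<le> r"
  shows "bracket x ^ k * r \<le> (1 + real DIM('a)) ^ k * (A + (\<Sum>b\<in>Basis. B b))"
proof -
  have "bracket x ^ k * r \<le> (1 + real DIM('a)) ^ k * (1 + (\<Sum>b\<in>Basis. \<bar>x \<bullet> b\<bar> ^ k)) * r"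
    using assms(3) by (intro mult_right_mono bracket_power_le_sum)
  also have "\<dots> = (1 + real DIM('a)) ^ k * (r + (\<Sum>b\<in>Basis. \<bar>x \<bullet> b\<bar> ^ k * r))"
    by (simp add: algebra_simps sum_distrib_left sum_distrib_right)
  also have "\<dots> \<le> (1 + real DIM('a)) ^ k * (A + (\<Sum>b\<in>Basis. B b))"
    using assms by (intro mult_left_mono add_mono sum_mono) auto
  finally show ?thesis .
qed

text \<open>Up to the factor \<open>(2 * pi) ^ n\<close>, \<open>conj_weyl a \<phi>\<close> is the complex conjugate of \<open>weyl_op 1\<close> for the
  conjugated symbol and the conjugated function; in this form \<open>a\<close> and \<open>\<phi>\<close> enter without conjugation.\<close>
definition weyl_integrand :: "('a::euclidean_space \<times> 'a \<Rightarrow> complex) \<Rightarrow> ('a \<Rightarrow> complex) \<Rightarrow> 'a \<Rightarrow> 'a \<Rightarrow> 'a \<Rightarrow> complex" where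
  "weyl_integrand a \<phi> x \<xi> y = iexp (- ((x - y) \<bullet> \<xi>)) * a ((1/2) *\<^sub>R (x + y), \<xi>) * \<phi> y"

text \<open>The \<open>y\<close> integral is kept as a separate stage: the modulus of the integrand
  has no decay in \<open>\<xi>\<close>, and only this integration turns the oscillation into decay,
  after which the \<open>\<xi>\<close> integral converges absolutely.\<close>

definition weyl_inner :: "('a::euclidean_space \<times> 'a \<Rightarrow> complex) \<Rightarrow> ('a \<Rightarrow> complex) \<Rightarrow> 'a \<Rightarrow> 'a \<Rightarrow> complex" where
  "weyl_inner a \<phi> x \<xi> = (\<integral>y. weyl_integrand a \<phi> x \<xi> y \<partial>lborel)"

definition conj_weyl :: "('a::euclidean_space \<times> 'a \<Rightarrow> complex) \<Rightarrow> ('a \<Rightarrow> complex) \<Rightarrow> 'a \<Rightarrow> complex" where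
  "conj_weyl a \<phi> x = (\<integral>\<xi>. weyl_inner a \<phi> x \<xi> \<partial>lborel)"

lemma hermite_continuous: "hermite \<phi> \<Longrightarrow> continuous_on UNIV \<phi>"
  by (rule smooth_fun_continuous[OF gpoly_smooth])

lemma continuous_on_weyl_integrand:
  assumes a: "continuous_on UNIV a" and \<phi>: "continuous_on UNIV \<phi>"
    and "continuous_on S f" "continuous_on S g" "continuous_on S h"
  shows "continuous_on S (\<lambda>p. weyl_integrand a \<phi> (f p) (g p) (h p))"
  unfolding weyl_integrand_def using assms
  by (intro continuous_intros continuous_on_compose2[OF a] continuous_on_compose2[OF \<phi>]) auto

lemma bracket_half_add:
  fixes x y \<xi> :: "'a::real_normed_vector"
  shows "bracket ((1/2) *\<^sub>R (x + y), \<xi>) \<le> bracket x * bracket \<xi> * bracket y"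
proof -
  have 1: "norm ((1/2) *\<^sub>R (x + y)) \<le> norm x + norm y"
    using norm_triangle_ineq[of x y] norm_ge_zero[of "x+y"] by (simp del: norm_ge_zero)
  have "bracket ((1/2) *\<^sub>R (x + y), \<xi>) \<le> 1 + norm x + norm y + norm \<xi>"
    using norm_Pair_le[of "(1/2) *\<^sub>R (x + y)" \<xi>] 1 by linarith
  also have "\<dots> \<le> bracket x * bracket \<xi> * bracket y"
    by (simp add: algebra_simps)
  finally show ?thesis .
qed

text \<open>Two powers of the decay of \<open>\<phi>\<close> pay for the quadratic growth of the
  symbol in \<open>y\<close>.\<close>

lemma weyl_integrand_bound:
  fixes a :: "'a::euclidean_space \<times> 'a \<Rightarrow> complex"
  assumes a: "\<And>X. norm (a X) \<le> C * bracket X ^ 2" "0 \<le> C"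
    and \<phi>: "\<And>y. norm (\<phi> y) \<le> D / bracket y ^ (k + 2)" "0 \<le> D"
  shows "norm (weyl_integrand a \<phi> x \<xi> y) \<le> C * D * bracket x ^ 2 * bracket \<xi> ^ 2 / bracket y ^ k"
proof -
  have pos: "0 < bracket y" by (simp add: add_pos_nonneg)
  have "norm (weyl_integrand a \<phi> x \<xi> y) = norm (a ((1/2) *\<^sub>R (x + y), \<xi>)) * norm (\<phi> y)"
    by (simp add: weyl_integrand_def norm_mult)
  also have "\<dots> \<le> (C * (bracket x * bracket \<xi> * bracket y) ^ 2) * (D / bracket y ^ (k + 2))"
    using a \<phi> by (intro mult_mono order_trans[OF a(1)] mult_left_mono power_mono bracket_half_add) auto
  also have "\<dots> = C * D * bracket x ^ 2 * bracket \<xi> ^ 2 / bracket y ^ k"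
  proof -
    have "(C * (X * Z * Y) ^ 2) * (D / Y ^ (k + 2)) = C * D * X ^ 2 * Z ^ 2 / Y ^ k" if "0 < Y" for X Y Z :: real
      using that by (simp add: field_simps power_add power2_eq_square)
    from this[OF pos] show ?thesis .
  qed
  finally show ?thesis .
qed

context
  fixes S :: "'i set" and a :: "'i \<Rightarrow> 'a::euclidean_space \<times> 'a \<Rightarrow> complex" and \<phi> :: "'a \<Rightarrow> complex"
  assumes a: "symbol_family S a" and \<phi>: "hermite \<phi>"
begin

lemma weyl_integrand_family_bound:
  obtains C where "C \<ge> 0"
    "\<And>i x \<xi> y. i \<in> S \<Longrightarrow> norm (weyl_integrand (a i) \<phi> x \<xi> y) \<le> C * bracket x ^ 2 * bracket \<xi> ^ 2 / bracket y ^ k"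
proof -
  obtain C where C: "C \<ge> 0" "\<And>i X. i \<in> S \<Longrightarrow> norm (a i X) \<le> C * bracket X ^ 2"
    using symbol_family_bound[OF a] by blast
  obtain D where D: "D \<ge> 0" "\<And>y. norm (\<phi> y) \<le> D / bracket y ^ (k + 2)"
    using hermite_bound[OF \<phi>, of "k + 2"] by blast
  show thesis
    by (rule that[of "C * D"]) (use C D in \<open>auto intro!: weyl_integrand_bound\<close>)
qed

lemma continuous_on_weyl_integrand_family:
  assumes "i \<in> S" "continuous_on T f" "continuous_on T g" "continuous_on T h"
  shows "continuous_on T (\<lambda>p. weyl_integrand (a i) \<phi> (f p) (g p) (h p))"
  using assms by (intro continuous_on_weyl_integrand smooth_fun_continuous symbol_family_smooth[OF a] hermite_continuous[OF \<phi>])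

lemma weyl_integrand_measurable:
  assumes "i \<in> S"
  shows "(\<lambda>y. weyl_integrand (a i) \<phi> x \<xi> y) \<in> borel_measurable borel"
  using assms by (intro borel_measurable_continuous_onI continuous_on_weyl_integrand_family continuous_intros)

lemma weyl_inner_measurable:
  assumes "i \<in> S"
  shows "(\<lambda>p. weyl_inner (a i) \<phi> (fst p) (snd p)) \<in> borel_measurable borel"
proof -
  have [measurable]: "(\<lambda>q::('a \<times> 'a) \<times> 'a. weyl_integrand (a i) \<phi> (fst (fst q)) (snd (fst q)) (snd q)) \<in> borel_measurable (borel \<Otimes>\<^sub>M lborel)"
    using assms
    by (subst measurable_cong_sets[OF sets_pair_measure_cong[OF refl sets_lborel] refl])
       (auto simp: borel_prod intro!: borel_measurable_continuous_onI continuous_on_weyl_integrand_family continuous_intros)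
  then show ?thesis
    unfolding weyl_inner_def by (intro lborel.borel_measurable_lebesgue_integral) (simp add: case_prod_unfold)
qed

lemma weyl_inner_measurable1:
  assumes "i \<in> S"
  shows "(\<lambda>\<xi>. weyl_inner (a i) \<phi> x \<xi>) \<in> borel_measurable borel"
  using measurable_compose[OF _ weyl_inner_measurable[OF assms], of "\<lambda>\<xi>. (x, \<xi>)" borel] by simp

lemma weyl_integrand_integrable:
  assumes i: "i \<in> S"
  shows "integrable lborel (\<lambda>y. weyl_integrand (a i) \<phi> x \<xi> y)"
proof -
  obtain C where C: "C \<ge> 0"
    "\<And>y. norm (weyl_integrand (a i) \<phi> x \<xi> y) \<le> C * bracket x ^ 2 * bracket \<xi> ^ 2 / bracket y ^ (2 * DIM('a))"
    using weyl_integrand_family_bound[of "2 * DIM('a)"] i by metis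
  have "integrable lborel (\<lambda>y::'a. C * bracket x ^ 2 * bracket \<xi> ^ 2 * (1 / bracket y ^ (2 * DIM('a))))"
    by (intro integrable_mult_right integrable_bracket_power) simp
  then show ?thesis
    using C weyl_integrand_measurable[OF i] by (rule_tac Bochner_Integration.integrable_bound) (auto intro!: order_trans[OF C(2)])
qed

lemma weyl_inner_family_bound:
  obtains C where "C \<ge> 0" "\<And>i x \<xi>. i \<in> S \<Longrightarrow> norm (weyl_inner (a i) \<phi> x \<xi>) \<le> C * bracket x ^ 2 * bracket \<xi> ^ 2"
proof -
  let ?k = "2 * DIM('a)"
  obtain C where C: "C \<ge> 0"
    "\<And>i x \<xi> y. i \<in> S \<Longrightarrow> norm (weyl_integrand (a i) \<phi> x \<xi> y) \<le> C * bracket x ^ 2 * bracket \<xi> ^ 2 / bracket y ^ ?k"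
    using weyl_integrand_family_bound[of ?k] by blast
  define J where "J = integral\<^sup>L lborel (\<lambda>y::'a. 1 / bracket y ^ ?k)"
  have J: "J \<ge> 0" unfolding J_def by (intro integral_nonneg_AE) auto
  have int: "integrable lborel (\<lambda>y::'a. 1 / bracket y ^ ?k)"
    by (rule integrable_bracket_power) simp
  show thesis
  proof (rule that[of "C * J"])
    fix i and x \<xi> :: 'a assume i: "i \<in> S"
    have "norm (weyl_inner (a i) \<phi> x \<xi>) \<le> (\<integral>y. C * bracket x ^ 2 * bracket \<xi> ^ 2 * (1 / bracket (y::'a) ^ ?k) \<partial>lborel)"
      unfolding weyl_inner_def
      by (intro Bochner_Integration.integral_norm_bound_integral weyl_integrand_integrable[OF i] integrable_mult_right int)
         (use C(2)[OF i] in auto)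
    also have "\<dots> = C * J * bracket x ^ 2 * bracket \<xi> ^ 2"
      unfolding J_def by (simp only: integral_mult_right_zero) simp
    finally show "norm (weyl_inner (a i) \<phi> x \<xi>) \<le> C * J * bracket x ^ 2 * bracket \<xi> ^ 2" .
  qed (use C J in auto)
qed

end

section \<open>Decay of the inner integral in frequency\<close>

lemma hermite_dderiv: "hermite \<phi> \<Longrightarrow> hermite (dderiv vs \<phi>)"
  by (rule gpoly_dderiv)

lemma Basis_prod_fst: "b \<in> Basis \<Longrightarrow> set [(b, 0)] \<subseteq> Basis" and Basis_prod_snd: "b \<in> Basis \<Longrightarrow> set [(0, b)] \<subseteq> Basis"
  by (auto simp: Basis_prod_def)

text \<open>Integration by parts in \<open>y\<close>: differentiating the exponential produces the
  factor \<open>\<xi> \<bullet> b\<close>, and the derivative moves to the symbol or to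
  \<open>\<phi>\<close>. The half comes from the midpoint in the argument of the symbol.\<close>

lemma weyl_inner_frequency:
  fixes a :: "'i \<Rightarrow> 'a::euclidean_space \<times> 'a \<Rightarrow> complex"
  assumes a: "symbol_family S a" and \<phi>: "hermite \<phi>" and i: "i \<in> S" and b: "b \<in> Basis"
  shows "complex_of_real (\<xi> \<bullet> b) * weyl_inner (a i) \<phi> x \<xi>
    = \<i> * (1/2 * weyl_inner (dderiv [(b, 0)] (a i)) \<phi> x \<xi> + weyl_inner (a i) (dderiv [b] \<phi>) x \<xi>)"
proof -
  note da = symbol_family_dderiv[OF a Basis_prod_fst[OF b]]
  note d\<phi> = hermite_dderiv[OF \<phi>, of "[b]"]
  let ?F' = "\<lambda>y. \<i> * complex_of_real (\<xi> \<bullet> b) * weyl_integrand (a i) \<phi> x \<xi> y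
     + 1/2 * weyl_integrand (dderiv [(b, 0)] (a i)) \<phi> x \<xi> y + weyl_integrand (a i) (dderiv [b] \<phi>) x \<xi> y"
  have "(\<integral>y. ?F' y \<partial>lborel) = 0"
  proof (rule integral_derivative_zero)
    fix y
    let ?m = "\<lambda>t. ((1/2) *\<^sub>R (x + (y + t *\<^sub>R b)), \<xi>)"
    have m: "(?m has_vector_derivative (1/2) *\<^sub>R (b, 0)) (at 0)"
      by (auto intro!: derivative_eq_intros)
    have lin: "frechet_derivative (a i) (at (?m 0)) ((1/2) *\<^sub>R (b, 0)) = (1/2) *\<^sub>R dderiv [(b, 0)] (a i) (?m 0)"
      unfolding dderiv_single
      by (rule linear_cmul[OF linear_frechet_derivative[OF smooth_fun_differentiable[OF symbol_family_smooth[OF a i]]]])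
    have 1: "((\<lambda>t. a i (?m t)) has_vector_derivative (1/2) *\<^sub>R dderiv [(b, 0)] (a i) (?m 0)) (at 0)"
      using smooth_fun_has_vector_derivative[OF symbol_family_smooth[OF a i] m] unfolding lin .
    have 2: "((\<lambda>t. \<phi> (y + t *\<^sub>R b)) has_vector_derivative dderiv [b] \<phi> y) (at 0)"
      unfolding dderiv_single by (rule has_vector_derivative_line[OF smooth_fun_differentiable[OF gpoly_smooth[OF \<phi>]]])
    have 3: "((\<lambda>t. iexp (- ((x - (y + t *\<^sub>R b)) \<bullet> \<xi>))) has_vector_derivative
        \<i> * complex_of_real (\<xi> \<bullet> b) * iexp (- ((x - y) \<bullet> \<xi>))) (at 0)"
    proof -
      have "((\<lambda>t. \<i> * complex_of_real (- ((x - (y + t *\<^sub>R b)) \<bullet> \<xi>))) has_vector_derivative \<i> * complex_of_real (\<xi> \<bullet> b)) (at 0)"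
      proof -
        have "- ((x - (y + t *\<^sub>R b)) \<bullet> \<xi>) = - ((x - y) \<bullet> \<xi>) + t * (\<xi> \<bullet> b)" for t
          by (simp add: algebra_simps inner_commute)
        then show ?thesis
          by (simp only:) (auto intro!: derivative_eq_intros)
      qed
      from field_vector_diff_chain_at[OF this DERIV_exp] show ?thesis by (simp add: o_def)
    qed
    show "((\<lambda>t. weyl_integrand (a i) \<phi> x \<xi> (y + t *\<^sub>R b)) has_vector_derivative ?F' y) (at 0)"
      unfolding weyl_integrand_def
      by (rule has_vector_derivative_eq_rhs[OF has_vector_derivative_mult[OF has_vector_derivative_mult[OF 3 1] 2]])
         (simp add: algebra_simps scaleR_conv_of_real)
  next
    show "continuous_on UNIV ?F'"
      using i by (intro continuous_intros continuous_on_weyl_integrand_family[OF a \<phi>] continuous_on_weyl_integrand_family[OF da \<phi>] continuous_on_weyl_integrand_family[OF a d\<phi>])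
    show "integrable lborel ?F'"
      using i by (intro Bochner_Integration.integrable_add integrable_mult_right weyl_integrand_integrable[OF a \<phi>] weyl_integrand_integrable[OF da \<phi>] weyl_integrand_integrable[OF a d\<phi>])
  qed (rule weyl_integrand_integrable[OF a \<phi> i])
  also have "(\<integral>y. ?F' y \<partial>lborel) = \<i> * complex_of_real (\<xi> \<bullet> b) * weyl_inner (a i) \<phi> x \<xi>
     + 1/2 * weyl_inner (dderiv [(b, 0)] (a i)) \<phi> x \<xi> + weyl_inner (a i) (dderiv [b] \<phi>) x \<xi>"
    using i by (simp add: weyl_inner_def weyl_integrand_integrable[OF a \<phi>] weyl_integrand_integrable[OF da \<phi>] weyl_integrand_integrable[OF a d\<phi>])
  finally have "\<i> * (\<i> * complex_of_real (\<xi> \<bullet> b) * weyl_inner (a i) \<phi> x \<xi>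
     + 1/2 * weyl_inner (dderiv [(b, 0)] (a i)) \<phi> x \<xi> + weyl_inner (a i) (dderiv [b] \<phi>) x \<xi>) = 0" by simp
  then show ?thesis by (simp add: distrib_left flip: mult.assoc) (simp add: algebra_simps)
qed

text \<open>Each integration by parts changes the symbol or the test function, so the induction runs
  over arbitrary \<open>a\<close> and \<open>\<phi>\<close>; it closes because both classes are
  stable under derivatives.\<close>

lemma weyl_inner_decay_coordinate:
  fixes a :: "'i \<Rightarrow> 'a::euclidean_space \<times> 'a \<Rightarrow> complex"
  assumes b: "b \<in> Basis"
  shows "symbol_family S a \<Longrightarrow> hermite \<phi> \<Longrightarrow>
    \<exists>C\<ge>0. \<forall>i\<in>S. \<forall>x \<xi>. \<bar>\<xi> \<bullet> b\<bar> ^ k * norm (weyl_inner (a i) \<phi> x \<xi>) \<le> C * bracket x ^ 2 * bracket \<xi> ^ 2"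
proof (induction k arbitrary: a \<phi>)
  case 0
  then show ?case using weyl_inner_family_bound[OF 0] by (metis mult_1 power_0)
next
  case (Suc k)
  note a = Suc.prems(1) and \<phi> = Suc.prems(2)
  obtain C where C: "C \<ge> 0" "\<And>i x \<xi>. i \<in> S \<Longrightarrow> \<bar>\<xi> \<bullet> b\<bar> ^ k * norm (weyl_inner (dderiv [(b, 0)] (a i)) \<phi> x \<xi>) \<le> C * bracket x ^ 2 * bracket \<xi> ^ 2"
    using Suc.IH[OF symbol_family_dderiv[OF a Basis_prod_fst[OF b]] \<phi>] by blast
  obtain D where D: "D \<ge> 0" "\<And>i x \<xi>. i \<in> S \<Longrightarrow> \<bar>\<xi> \<bullet> b\<bar> ^ k * norm (weyl_inner (a i) (dderiv [b] \<phi>) x \<xi>) \<le> D * bracket x ^ 2 * bracket \<xi> ^ 2"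
    using Suc.IH[OF a hermite_dderiv[OF \<phi>, of "[b]"]] by blast
  have "\<bar>\<xi> \<bullet> b\<bar> ^ Suc k * norm (weyl_inner (a i) \<phi> x \<xi>) \<le> (C + D) * bracket x ^ 2 * bracket \<xi> ^ 2" if i: "i \<in> S" for i x \<xi>
  proof -
    have "\<bar>\<xi> \<bullet> b\<bar> * norm (weyl_inner (a i) \<phi> x \<xi>) = norm (complex_of_real (\<xi> \<bullet> b) * weyl_inner (a i) \<phi> x \<xi>)"
      by (simp add: norm_mult)
    also have "\<dots> \<le> norm (1/2 * weyl_inner (dderiv [(b, 0)] (a i)) \<phi> x \<xi>) + norm (weyl_inner (a i) (dderiv [b] \<phi>) x \<xi>)"
      unfolding weyl_inner_frequency[OF a \<phi> i b] norm_mult[of \<i>] norm_ii mult_1 by (rule norm_triangle_ineq)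
    also have "\<dots> \<le> norm (weyl_inner (dderiv [(b, 0)] (a i)) \<phi> x \<xi>) + norm (weyl_inner (a i) (dderiv [b] \<phi>) x \<xi>)"
      by (simp add: norm_mult)
    finally have "\<bar>\<xi> \<bullet> b\<bar> ^ k * (\<bar>\<xi> \<bullet> b\<bar> * norm (weyl_inner (a i) \<phi> x \<xi>))
       \<le> \<bar>\<xi> \<bullet> b\<bar> ^ k * (norm (weyl_inner (dderiv [(b, 0)] (a i)) \<phi> x \<xi>) + norm (weyl_inner (a i) (dderiv [b] \<phi>) x \<xi>))"
      by (intro mult_left_mono) auto
    then show ?thesis
      using C(2)[OF i, of \<xi> x] D(2)[OF i, of \<xi> x] by (simp add: algebra_simps)
  qed
  then show ?case using C(1) D(1) by (intro exI[of _ "C + D"]) auto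
qed

lemma weyl_inner_decay:
  fixes a :: "'i \<Rightarrow> 'a::euclidean_space \<times> 'a \<Rightarrow> complex"
  assumes a: "symbol_family S a" and \<phi>: "hermite \<phi>"
  obtains C where "C \<ge> 0" "\<And>i x \<xi>. i \<in> S \<Longrightarrow> norm (weyl_inner (a i) \<phi> x \<xi>) \<le> C * bracket x ^ 2 / bracket \<xi> ^ k"
proof -
  obtain A where A: "A \<ge> 0" "\<And>i x \<xi>. i \<in> S \<Longrightarrow> norm (weyl_inner (a i) \<phi> x \<xi>) \<le> A * bracket x ^ 2 * bracket \<xi> ^ 2"
    using weyl_inner_family_bound[OF a \<phi>] by blast
  \<comment> \<open>Two extra powers are requested in order to cancel the factor
    \<open>bracket \<xi> ^ 2\<close> left over from the crude bound.\<close>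
  have "\<exists>B. \<forall>b\<in>(Basis::'a set). 0 \<le> B b \<and> (\<forall>i\<in>S. \<forall>x \<xi>. \<bar>\<xi> \<bullet> b\<bar> ^ (k + 2) * norm (weyl_inner (a i) \<phi> x \<xi>) \<le> B b * bracket x ^ 2 * bracket \<xi> ^ 2)"
    by (intro bchoice ballI) (use weyl_inner_decay_coordinate[OF _ a \<phi>, of _ "k + 2"] in blast)
  then obtain B where B: "\<And>b. b \<in> Basis \<Longrightarrow> 0 \<le> B b" "\<And>b i x \<xi>. b \<in> Basis \<Longrightarrow> i \<in> S \<Longrightarrow>
      \<bar>\<xi> \<bullet> b\<bar> ^ (k + 2) * norm (weyl_inner (a i) \<phi> x \<xi>) \<le> B b * bracket x ^ 2 * bracket \<xi> ^ 2"
    by blast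
  define C where "C = (1 + real DIM('a)) ^ (k + 2) * (A + (\<Sum>b\<in>Basis. B b))"
  have C: "C \<ge> 0" unfolding C_def using A B(1) by (auto intro!: mult_nonneg_nonneg add_nonneg_nonneg sum_nonneg)
  show thesis
  proof (rule that[OF C])
    fix i and x \<xi> :: 'a assume i: "i \<in> S"
    have pos: "0 < bracket \<xi>" by (simp add: add_pos_nonneg)
    have "bracket \<xi> ^ (k + 2) * norm (weyl_inner (a i) \<phi> x \<xi>)
      \<le> (1 + real DIM('a)) ^ (k + 2) * (A * bracket x ^ 2 * bracket \<xi> ^ 2 + (\<Sum>b\<in>Basis. B b * bracket x ^ 2 * bracket \<xi> ^ 2))"
      by (rule bracket_decay_of_coordinates) (use A(2) B(2) i in auto)
    also have "\<dots> = C * bracket x ^ 2 * bracket \<xi> ^ 2"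
    proof -
      have "(\<Sum>b\<in>Basis. B b * bracket x ^ 2 * bracket \<xi> ^ 2) = (\<Sum>b\<in>Basis. B b) * bracket x ^ 2 * bracket \<xi> ^ 2"
        by (simp only: sum_distrib_right)
      then show ?thesis unfolding C_def by (simp only: distrib_left distrib_right mult.assoc)
    qed
    finally have "bracket \<xi> ^ 2 * (bracket \<xi> ^ k * norm (weyl_inner (a i) \<phi> x \<xi>)) \<le> bracket \<xi> ^ 2 * (C * bracket x ^ 2)"
      by (simp add: power_add mult_ac power2_eq_square)
    then have "bracket \<xi> ^ k * norm (weyl_inner (a i) \<phi> x \<xi>) \<le> C * bracket x ^ 2"
      using pos by (simp only: mult_le_cancel_left_pos zero_less_power)
    then show "norm (weyl_inner (a i) \<phi> x \<xi>) \<le> C * bracket x ^ 2 / bracket \<xi> ^ k"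
      using pos by (simp add: pos_le_divide_eq mult.commute)
  qed
qed

section \<open>Decay of the outer integral in position\<close>

lemma bracket_pos: "0 < bracket x"
  by (simp add: add_pos_nonneg)

lemma integrable_bracket_bound:
  fixes f :: "'a::euclidean_space \<Rightarrow> complex"
  assumes "f \<in> borel_measurable borel" and "\<And>x. norm (f x) \<le> C / bracket x ^ (2 * DIM('a))"
  shows "integrable lborel f"
proof (rule Bochner_Integration.integrable_bound)
  show "integrable lborel (\<lambda>x::'a. C * (1 / bracket x ^ (2 * DIM('a))))"
    by (intro integrable_mult_right integrable_bracket_power) simp
  show "AE x in lborel. norm (f x) \<le> norm (C * (1 / bracket x ^ (2 * DIM('a))))"
    using order_trans[OF assms(2) abs_ge_self] by simp
qed (use assms(1) in simp)

text \<open>A number that depends on the dimension only; the \<open>itself\<close> argument makes it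
  a function of the type. It is the common constant in all bounds of integrals by their
  decay.\<close>

definition bracket_mass :: "'a::euclidean_space itself \<Rightarrow> real" where
  "bracket_mass _ = integral\<^sup>L lborel (\<lambda>x::'a. 1 / bracket x ^ (2 * DIM('a)))"

lemma bracket_mass_nonneg: "0 \<le> bracket_mass T"
  unfolding bracket_mass_def by (intro integral_nonneg_AE) auto

lemma norm_integral_bracket_bound:
  fixes f :: "'a::euclidean_space \<Rightarrow> complex"
  assumes "f \<in> borel_measurable borel" and "\<And>x. norm (f x) \<le> C / bracket x ^ (2 * DIM('a))"
  shows "norm (\<integral>x. f x \<partial>lborel) \<le> C * bracket_mass TYPE('a)"
proof -
  have "norm (\<integral>x. f x \<partial>lborel) \<le> integral\<^sup>L lborel (\<lambda>x::'a. C * (1 / bracket x ^ (2 * DIM('a))))"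
    by (intro Bochner_Integration.integral_norm_bound_integral integrable_bracket_bound[OF assms(1)]
        integrable_mult_right integrable_bracket_power) (use assms(2) in auto)
  then show ?thesis by (simp only: integral_mult_right_zero bracket_mass_def)
qed

lemma hermite_inner: "hermite \<phi> \<Longrightarrow> hermite (\<lambda>y. complex_of_real (y \<bullet> b) * \<phi> y)"
  by (rule gpoly.gpoly_inner)

context
  fixes S :: "'i set" and a :: "'i \<Rightarrow> 'a::euclidean_space \<times> 'a \<Rightarrow> complex" and \<phi> :: "'a \<Rightarrow> complex"
  assumes a: "symbol_family S a" and \<phi>: "hermite \<phi>"
begin

lemma weyl_inner_integrable:
  assumes "i \<in> S"
  shows "integrable lborel (\<lambda>\<xi>. weyl_inner (a i) \<phi> x \<xi>)"
proof -
  obtain C where "\<And>\<xi>. norm (weyl_inner (a i) \<phi> x \<xi>) \<le> C * bracket x ^ 2 / bracket \<xi> ^ (2 * DIM('a))"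
    using weyl_inner_decay[OF a \<phi>, of "2 * DIM('a)"] assms by metis
  then show ?thesis
    by (intro integrable_bracket_bound weyl_inner_measurable1[OF a \<phi> assms])
qed

lemma conj_weyl_family_bound:
  obtains C where "C \<ge> 0" "\<And>i x. i \<in> S \<Longrightarrow> norm (conj_weyl (a i) \<phi> x) \<le> C * bracket x ^ 2"
proof -
  obtain C where C: "C \<ge> 0" "\<And>i x \<xi>. i \<in> S \<Longrightarrow> norm (weyl_inner (a i) \<phi> x \<xi>) \<le> C * bracket x ^ 2 / bracket \<xi> ^ (2 * DIM('a))"
    using weyl_inner_decay[OF a \<phi>, of "2 * DIM('a)"] by blast
  show thesis
  proof (rule that[of "C * bracket_mass TYPE('a)"])
    fix i x assume "i \<in> S"
    then have "norm (conj_weyl (a i) \<phi> x) \<le> (C * bracket x ^ 2) * bracket_mass TYPE('a)"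
      unfolding conj_weyl_def by (intro norm_integral_bracket_bound weyl_inner_measurable1[OF a \<phi>] C)
    then show "norm (conj_weyl (a i) \<phi> x) \<le> C * bracket_mass TYPE('a) * bracket x ^ 2"
      by (simp only: mult_ac)
  qed (intro mult_nonneg_nonneg C bracket_mass_nonneg)
qed

lemma continuous_on_weyl_inner:
  assumes "i \<in> S"
  shows "continuous_on UNIV (\<lambda>x. weyl_inner (a i) \<phi> x \<xi>)"
proof -
  obtain C where C: "C \<ge> 0"
    "\<And>x y. norm (weyl_integrand (a i) \<phi> x \<xi> y) \<le> C * bracket x ^ 2 * bracket \<xi> ^ 2 / bracket y ^ (2 * DIM('a))"
    using weyl_integrand_family_bound[OF a \<phi>, of "2 * DIM('a)"] assms by metis
  show ?thesis
    unfolding weyl_inner_def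
  proof (rule continuous_on_integral_param[where m = 2])
    show "integrable lborel (\<lambda>y::'a. C * bracket \<xi> ^ 2 * (1 / bracket y ^ (2 * DIM('a))))"
      by (intro integrable_mult_right integrable_bracket_power) simp
    show "norm (weyl_integrand (a i) \<phi> x \<xi> y) \<le> bracket x ^ 2 * (C * bracket \<xi> ^ 2 * (1 / bracket y ^ (2 * DIM('a))))" for x y
      using C(2)[of x y] by (simp add: mult_ac)
    show "continuous_on UNIV (\<lambda>x. weyl_integrand (a i) \<phi> x \<xi> y)" for y
      by (intro continuous_on_weyl_integrand_family[OF a \<phi> assms] continuous_intros)
  qed (rule weyl_integrand_measurable[OF a \<phi> assms])
qed

lemma continuous_on_conj_weyl:
  assumes "i \<in> S"
  shows "continuous_on UNIV (conj_weyl (a i) \<phi>)"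
proof -
  obtain C where C: "C \<ge> 0" "\<And>x \<xi>. norm (weyl_inner (a i) \<phi> x \<xi>) \<le> C * bracket x ^ 2 / bracket \<xi> ^ (2 * DIM('a))"
    using weyl_inner_decay[OF a \<phi>, of "2 * DIM('a)"] assms by metis
  have "continuous_on UNIV (\<lambda>x. \<integral>\<xi>. weyl_inner (a i) \<phi> x \<xi> \<partial>lborel)"
  proof (rule continuous_on_integral_param[where m = 2])
    show "integrable lborel (\<lambda>y::'a. C * (1 / bracket y ^ (2 * DIM('a))))"
      by (intro integrable_mult_right integrable_bracket_power) simp
    show "norm (weyl_inner (a i) \<phi> x \<xi>) \<le> bracket x ^ 2 * (C * (1 / bracket \<xi> ^ (2 * DIM('a))))" for x \<xi>
      using C(2)[of x \<xi>] by (simp add: mult_ac)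
  qed (use assms in \<open>auto intro: continuous_on_weyl_inner weyl_inner_measurable1[OF a \<phi>]\<close>)
  then show ?thesis by (simp add: conj_weyl_def[abs_def])
qed

lemma conj_weyl_measurable: "i \<in> S \<Longrightarrow> conj_weyl (a i) \<phi> \<in> borel_measurable borel"
  by (intro borel_measurable_continuous_onI continuous_on_conj_weyl)

end

text \<open>Integration by parts in \<open>\<xi>\<close>: the exponential yields the factor
  \<open>x - y\<close>, whose \<open>y\<close> part is absorbed into \<open>\<phi>\<close> while the
  derivative falls on the momentum variable of the symbol. The derivative has to be taken under the
  \<open>y\<close> integral, before any decay in \<open>\<xi>\<close> is available.\<close>

lemma conj_weyl_position:
  fixes a :: "'i \<Rightarrow> 'a::euclidean_space \<times> 'a \<Rightarrow> complex"
  assumes a: "symbol_family S a" and \<phi>: "hermite \<phi>" and i: "i \<in> S" and b: "b \<in> Basis"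
  shows "complex_of_real (x \<bullet> b) * conj_weyl (a i) \<phi> x
    = conj_weyl (a i) (\<lambda>y. complex_of_real (y \<bullet> b) * \<phi> y) x - \<i> * conj_weyl (dderiv [(0, b)] (a i)) \<phi> x"
proof -
  note da = symbol_family_dderiv[OF a Basis_prod_snd[OF b]]
  note d\<phi> = hermite_inner[OF \<phi>, of b]
  let ?\<phi> = "\<lambda>y. complex_of_real (y \<bullet> b) * \<phi> y"
  let ?f' = "\<lambda>y \<xi>. - \<i> * complex_of_real (x \<bullet> b) * weyl_integrand (a i) \<phi> x \<xi> y + \<i> * weyl_integrand (a i) ?\<phi> x \<xi> y
     + weyl_integrand (dderiv [(0, b)] (a i)) \<phi> x \<xi> y"
  have int: "(\<integral>y. ?f' y \<xi> \<partial>lborel) = - \<i> * complex_of_real (x \<bullet> b) * weyl_inner (a i) \<phi> x \<xi> + \<i> * weyl_inner (a i) ?\<phi> x \<xi>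
     + weyl_inner (dderiv [(0, b)] (a i)) \<phi> x \<xi>" for \<xi>
    using i by (simp add: weyl_inner_def weyl_integrand_integrable[OF a \<phi>] weyl_integrand_integrable[OF da \<phi>] weyl_integrand_integrable[OF a d\<phi>])
  obtain C1 where C1: "C1 \<ge> 0" "\<And>i x \<xi> y. i \<in> S \<Longrightarrow> norm (weyl_integrand (a i) \<phi> x \<xi> y) \<le> C1 * bracket x ^ 2 * bracket \<xi> ^ 2 / bracket y ^ (2 * DIM('a))"
    using weyl_integrand_family_bound[OF a \<phi>, of "2 * DIM('a)"] by blast
  obtain C2 where C2: "C2 \<ge> 0" "\<And>i x \<xi> y. i \<in> S \<Longrightarrow> norm (weyl_integrand (a i) ?\<phi> x \<xi> y) \<le> C2 * bracket x ^ 2 * bracket \<xi> ^ 2 / bracket y ^ (2 * DIM('a))"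
    using weyl_integrand_family_bound[OF a d\<phi>, of "2 * DIM('a)"] by blast
  obtain C3 where C3: "C3 \<ge> 0" "\<And>i x \<xi> y. i \<in> S \<Longrightarrow> norm (weyl_integrand (dderiv [(0, b)] (a i)) \<phi> x \<xi> y) \<le> C3 * bracket x ^ 2 * bracket \<xi> ^ 2 / bracket y ^ (2 * DIM('a))"
    using weyl_integrand_family_bound[OF da \<phi>, of "2 * DIM('a)"] by blast
  \<comment> \<open>The point \<open>x\<close> is fixed here, so the majorant may depend on it; what
    matters is integrability in \<open>y\<close> with at most polynomial growth in
    \<open>\<xi>\<close>.\<close>
  define C where "C = (\<bar>x \<bullet> b\<bar> * C1 + C2 + C3) * bracket x ^ 2"
  have "(\<integral>\<xi>. \<integral>y. ?f' y \<xi> \<partial>lborel \<partial>lborel) = 0"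
  proof (rule integral_derivative_zero_param[where G = "\<lambda>y. C * (1 / bracket y ^ (2 * DIM('a)))" and m = 2])
    fix y \<xi>
    let ?m = "\<lambda>t. ((1/2) *\<^sub>R (x + y), \<xi> + t *\<^sub>R b)"
    have m: "(?m has_vector_derivative (0, b)) (at 0)"
      by (auto intro!: derivative_eq_intros)
    have 1: "((\<lambda>t. a i (?m t)) has_vector_derivative dderiv [(0, b)] (a i) (?m 0)) (at 0)"
      using smooth_fun_has_vector_derivative[OF symbol_family_smooth[OF a i] m] unfolding dderiv_single .
    have 3: "((\<lambda>t. iexp (- ((x - y) \<bullet> (\<xi> + t *\<^sub>R b)))) has_vector_derivative
        - \<i> * complex_of_real ((x - y) \<bullet> b) * iexp (- ((x - y) \<bullet> \<xi>))) (at 0)"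
    proof -
      have "((\<lambda>t. \<i> * complex_of_real (- ((x - y) \<bullet> (\<xi> + t *\<^sub>R b)))) has_vector_derivative - \<i> * complex_of_real ((x - y) \<bullet> b)) (at 0)"
      proof -
        have "- ((x - y) \<bullet> (\<xi> + t *\<^sub>R b)) = - ((x - y) \<bullet> \<xi>) - t * ((x - y) \<bullet> b)" for t
          by (simp add: algebra_simps)
        then show ?thesis
          by (simp only:) (auto intro!: derivative_eq_intros)
      qed
      from field_vector_diff_chain_at[OF this DERIV_exp] show ?thesis by (simp add: o_def)
    qed
    show "((\<lambda>t. weyl_integrand (a i) \<phi> x (\<xi> + t *\<^sub>R b) y) has_vector_derivative ?f' y \<xi>) (at 0)"
      unfolding weyl_integrand_def
      by (rule has_vector_derivative_eq_rhs[OF has_vector_derivative_mult[OF has_vector_derivative_mult[OF 3 1] has_vector_derivative_const]])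
         (simp add: algebra_simps)
  next
    show "continuous_on UNIV (\<lambda>(y, \<xi>). ?f' y \<xi>)"
      unfolding case_prod_unfold using i
      by (intro continuous_intros continuous_on_weyl_integrand_family[OF a \<phi>] continuous_on_weyl_integrand_family[OF da \<phi>] continuous_on_weyl_integrand_family[OF a d\<phi>])
    show "integrable lborel (\<lambda>y::'a. C * (1 / bracket y ^ (2 * DIM('a))))"
      by (intro integrable_mult_right integrable_bracket_power) simp
    show "0 \<le> C * (1 / bracket y ^ (2 * DIM('a)))" for y :: 'a
      using C1(1) C2(1) C3(1) by (auto simp: C_def)
    show "norm (?f' y \<xi>) \<le> C * (1 / bracket y ^ (2 * DIM('a))) * bracket \<xi> ^ 2" for y \<xi>
    proof -
      have "norm (?f' y \<xi>) \<le> norm (- \<i> * complex_of_real (x \<bullet> b) * weyl_integrand (a i) \<phi> x \<xi> y) + norm (\<i> * weyl_integrand (a i) ?\<phi> x \<xi> y)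
         + norm (weyl_integrand (dderiv [(0, b)] (a i)) \<phi> x \<xi> y)"
        by (intro norm_triangle_le add_mono order_refl norm_triangle_ineq)
      also have "\<dots> = \<bar>x \<bullet> b\<bar> * norm (weyl_integrand (a i) \<phi> x \<xi> y) + norm (weyl_integrand (a i) ?\<phi> x \<xi> y)
         + norm (weyl_integrand (dderiv [(0, b)] (a i)) \<phi> x \<xi> y)"
        by (simp only: norm_mult norm_of_real norm_minus_cancel norm_ii mult_1)
      also have "\<dots> \<le> \<bar>x \<bullet> b\<bar> * (C1 * bracket x ^ 2 * bracket \<xi> ^ 2 / bracket y ^ (2 * DIM('a)))
         + C2 * bracket x ^ 2 * bracket \<xi> ^ 2 / bracket y ^ (2 * DIM('a)) + C3 * bracket x ^ 2 * bracket \<xi> ^ 2 / bracket y ^ (2 * DIM('a))"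
        by (intro add_mono mult_left_mono C1 C2 C3 i) auto
      also have "\<dots> = C * (1 / bracket y ^ (2 * DIM('a))) * bracket \<xi> ^ 2"
        unfolding C_def divide_inverse by (simp only: distrib_left distrib_right mult_1 mult_ac)
      finally show ?thesis .
    qed
    show "integrable lborel (\<lambda>y. weyl_integrand (a i) \<phi> x \<xi> y)" for \<xi>
      by (rule weyl_integrand_integrable[OF a \<phi> i])
    show "integrable lborel (\<lambda>\<xi>. \<integral>y. weyl_integrand (a i) \<phi> x \<xi> y \<partial>lborel)"
      using weyl_inner_integrable[OF a \<phi> i] by (simp add: weyl_inner_def)
    show "integrable lborel (\<lambda>\<xi>. \<integral>y. ?f' y \<xi> \<partial>lborel)"
      unfolding int using i
      by (intro Bochner_Integration.integrable_add integrable_mult_right weyl_inner_integrable[OF a \<phi>] weyl_inner_integrable[OF a d\<phi>] weyl_inner_integrable[OF da \<phi>])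
  qed
  then have "- \<i> * complex_of_real (x \<bullet> b) * conj_weyl (a i) \<phi> x + \<i> * conj_weyl (a i) ?\<phi> x + conj_weyl (dderiv [(0, b)] (a i)) \<phi> x = 0"
    unfolding int using i
    by (simp add: conj_weyl_def weyl_inner_integrable[OF a \<phi>] weyl_inner_integrable[OF a d\<phi>] weyl_inner_integrable[OF da \<phi>])
  then have "\<i> * (- \<i> * complex_of_real (x \<bullet> b) * conj_weyl (a i) \<phi> x + \<i> * conj_weyl (a i) ?\<phi> x + conj_weyl (dderiv [(0, b)] (a i)) \<phi> x) = 0"
    by simp
  then show ?thesis by (simp add: distrib_left flip: mult.assoc) (simp add: algebra_simps)
qed

text \<open>As for the inner integral, except that a step either multiplies \<open>\<phi>\<close> by
  a coordinate or differentiates the symbol in momentum; both stay within their classes.\<close>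

lemma conj_weyl_decay_coordinate:
  fixes a :: "'i \<Rightarrow> 'a::euclidean_space \<times> 'a \<Rightarrow> complex"
  assumes b: "b \<in> Basis"
  shows "symbol_family S a \<Longrightarrow> hermite \<phi> \<Longrightarrow>
    \<exists>C\<ge>0. \<forall>i\<in>S. \<forall>x. \<bar>x \<bullet> b\<bar> ^ k * norm (conj_weyl (a i) \<phi> x) \<le> C * bracket x ^ 2"
proof (induction k arbitrary: a \<phi>)
  case 0
  then show ?case using conj_weyl_family_bound[OF 0] by (metis mult_1 power_0)
next
  case (Suc k)
  note a = Suc.prems(1) and \<phi> = Suc.prems(2)
  obtain C where C: "C \<ge> 0" "\<And>i x. i \<in> S \<Longrightarrow> \<bar>x \<bullet> b\<bar> ^ k * norm (conj_weyl (dderiv [(0, b)] (a i)) \<phi> x) \<le> C * bracket x ^ 2"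
    using Suc.IH[OF symbol_family_dderiv[OF a Basis_prod_snd[OF b]] \<phi>] by blast
  obtain D where D: "D \<ge> 0" "\<And>i x. i \<in> S \<Longrightarrow> \<bar>x \<bullet> b\<bar> ^ k * norm (conj_weyl (a i) (\<lambda>y. complex_of_real (y \<bullet> b) * \<phi> y) x) \<le> D * bracket x ^ 2"
    using Suc.IH[OF a hermite_inner[OF \<phi>, of b]] by blast
  have "\<bar>x \<bullet> b\<bar> ^ Suc k * norm (conj_weyl (a i) \<phi> x) \<le> (C + D) * bracket x ^ 2" if i: "i \<in> S" for i x
  proof -
    have "\<bar>x \<bullet> b\<bar> * norm (conj_weyl (a i) \<phi> x) = norm (complex_of_real (x \<bullet> b) * conj_weyl (a i) \<phi> x)"
      by (simp add: norm_mult)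
    also have "\<dots> \<le> norm (conj_weyl (a i) (\<lambda>y. complex_of_real (y \<bullet> b) * \<phi> y) x) + norm (\<i> * conj_weyl (dderiv [(0, b)] (a i)) \<phi> x)"
      unfolding conj_weyl_position[OF a \<phi> i b] by (rule norm_triangle_ineq4)
    also have "\<dots> = norm (conj_weyl (a i) (\<lambda>y. complex_of_real (y \<bullet> b) * \<phi> y) x) + norm (conj_weyl (dderiv [(0, b)] (a i)) \<phi> x)"
      by (simp add: norm_mult)
    finally have "\<bar>x \<bullet> b\<bar> ^ k * (\<bar>x \<bullet> b\<bar> * norm (conj_weyl (a i) \<phi> x))
       \<le> \<bar>x \<bullet> b\<bar> ^ k * (norm (conj_weyl (a i) (\<lambda>y. complex_of_real (y \<bullet> b) * \<phi> y) x) + norm (conj_weyl (dderiv [(0, b)] (a i)) \<phi> x))"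
      by (intro mult_left_mono) auto
    then show ?thesis
      using C(2)[OF i, of x] D(2)[OF i, of x] by (simp add: algebra_simps)
  qed
  then show ?case using C(1) D(1) by (intro exI[of _ "C + D"]) auto
qed

lemma conj_weyl_decay:
  fixes a :: "'i \<Rightarrow> 'a::euclidean_space \<times> 'a \<Rightarrow> complex"
  assumes a: "symbol_family S a" and \<phi>: "hermite \<phi>"
  obtains C where "C \<ge> 0" "\<And>i x. i \<in> S \<Longrightarrow> norm (conj_weyl (a i) \<phi> x) \<le> C / bracket x ^ k"
proof -
  obtain A where A: "A \<ge> 0" "\<And>i x. i \<in> S \<Longrightarrow> norm (conj_weyl (a i) \<phi> x) \<le> A * bracket x ^ 2"
    using conj_weyl_family_bound[OF a \<phi>] by blast
  have "\<exists>B. \<forall>b\<in>(Basis::'a set). 0 \<le> B b \<and> (\<forall>i\<in>S. \<forall>x. \<bar>x \<bullet> b\<bar> ^ (k + 2) * norm (conj_weyl (a i) \<phi> x) \<le> B b * bracket x ^ 2)"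
    by (intro bchoice ballI) (use conj_weyl_decay_coordinate[OF _ a \<phi>, of _ "k + 2"] in blast)
  then obtain B where B: "\<And>b. b \<in> Basis \<Longrightarrow> 0 \<le> B b" "\<And>b i x. b \<in> Basis \<Longrightarrow> i \<in> S \<Longrightarrow>
      \<bar>x \<bullet> b\<bar> ^ (k + 2) * norm (conj_weyl (a i) \<phi> x) \<le> B b * bracket x ^ 2"
    by blast
  define C where "C = (1 + real DIM('a)) ^ (k + 2) * (A + (\<Sum>b\<in>Basis. B b))"
  have C: "C \<ge> 0" unfolding C_def using A B(1) by (auto intro!: mult_nonneg_nonneg add_nonneg_nonneg sum_nonneg)
  show thesis
  proof (rule that[OF C])
    fix i and x :: 'a assume i: "i \<in> S"
    have "bracket x ^ (k + 2) * norm (conj_weyl (a i) \<phi> x)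
      \<le> (1 + real DIM('a)) ^ (k + 2) * (A * bracket x ^ 2 + (\<Sum>b\<in>Basis. B b * bracket x ^ 2))"
      by (rule bracket_decay_of_coordinates) (use A(2) B(2) i in auto)
    also have "\<dots> = C * bracket x ^ 2"
      unfolding C_def sum_distrib_right[symmetric] by (simp only: distrib_left distrib_right mult.assoc)
    finally have "bracket x ^ 2 * (bracket x ^ k * norm (conj_weyl (a i) \<phi> x)) \<le> bracket x ^ 2 * C"
      by (simp add: power_add mult_ac power2_eq_square)
    then have "bracket x ^ k * norm (conj_weyl (a i) \<phi> x) \<le> C"
      by (simp only: mult_le_cancel_left_pos zero_less_power bracket_pos)
    then show "norm (conj_weyl (a i) \<phi> x) \<le> C / bracket x ^ k"
      using bracket_pos[of x] by (simp add: pos_le_divide_eq mult.commute)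
  qed
qed

text \<open>The order of integration is changed in two stages: \<open>(x, y)\<close> for fixed
  \<open>\<xi>\<close> converges absolutely by the decay of \<open>\<phi>\<close> and
  \<open>\<psi>\<close>, and \<open>(x, \<xi>)\<close> does so once the \<open>y\<close> integral
  has been taken. In the decay of \<open>\<psi>\<close> the two additional powers compensate the
  growth of the symbol in \<open>x\<close>.\<close>

lemma
  fixes a :: "'i \<Rightarrow> 'a::euclidean_space \<times> 'a \<Rightarrow> complex"
  assumes a: "symbol_family S a" and \<phi>: "hermite \<phi>" and i: "i \<in> S"
    and \<psi>: "\<psi> \<in> borel_measurable borel" "\<And>x. norm (\<psi> x) \<le> M / bracket x ^ (2 * DIM('a) + 2)"
  shows weyl_integrand_pair_integrable: "integrable lborel (\<lambda>p. weyl_integrand (a i) \<phi> (fst p) \<xi> (snd p) * \<psi> (fst p))"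
    and weyl_integrand_pair_integral_integrable: "integrable lborel (\<lambda>\<xi>. \<integral>p. weyl_integrand (a i) \<phi> (fst p) \<xi> (snd p) * \<psi> (fst p) \<partial>lborel)"
    and conj_weyl_pairing: "(\<integral>x. conj_weyl (a i) \<phi> x * \<psi> x \<partial>lborel)
      = (\<integral>\<xi>. \<integral>p. weyl_integrand (a i) \<phi> (fst p) \<xi> (snd p) * \<psi> (fst p) \<partial>lborel \<partial>lborel)"
proof -
  note [measurable] = \<psi>(1)
  let ?N = "2 * DIM('a)"
  have M: "0 \<le> M" using order_trans[OF norm_ge_zero \<psi>(2)[of 0]] by simp
  have \<psi>2: "bracket x ^ 2 * norm (\<psi> x) \<le> M * (1 / bracket x ^ ?N)" for x
  proof -
    have "bracket x ^ 2 * norm (\<psi> x) \<le> bracket x ^ 2 * (M / bracket x ^ (?N + 2))"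
      by (intro mult_left_mono \<psi>(2)) auto
    also have "\<dots> = M * (1 / bracket x ^ ?N)"
      using bracket_pos[of x] by (simp only: power_add) (simp add: field_simps)
    finally show ?thesis .
  qed
  obtain C where C: "C \<ge> 0"
    "\<And>x \<xi> y. norm (weyl_integrand (a i) \<phi> x \<xi> y) \<le> C * bracket x ^ 2 * bracket \<xi> ^ 2 / bracket y ^ ?N"
    using weyl_integrand_family_bound[OF a \<phi>, of ?N] i by metis
  have KKm: "(\<lambda>p::'a\<times>'a. weyl_integrand (a i) \<phi> (fst p) \<xi> (snd p)) \<in> borel_measurable (lborel \<Otimes>\<^sub>M lborel)" for \<xi>
    unfolding lborel_prod using i
    by (simp add: borel_measurable_continuous_onI continuous_on_weyl_integrand_family[OF a \<phi>] continuous_on_fst continuous_on_snd continuous_on_id)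
  have int: "integrable (lborel \<Otimes>\<^sub>M lborel) (\<lambda>p. weyl_integrand (a i) \<phi> (fst p) \<xi> (snd p) * \<psi> (fst p))" for \<xi>
  proof (rule integrable_pair_bound)
    show "(\<lambda>p. weyl_integrand (a i) \<phi> (fst p) \<xi> (snd p) * \<psi> (fst p)) \<in> borel_measurable (lborel \<Otimes>\<^sub>M lborel)"
      using KKm by measurable
    show "integrable lborel (\<lambda>x::'a. C * bracket \<xi> ^ 2 * M * (1 / bracket x ^ ?N))" "integrable lborel (\<lambda>x::'a. 1 / bracket x ^ ?N)"
      by (intro integrable_mult_right integrable_bracket_power, simp)+
    fix x y :: 'a
    have "norm (weyl_integrand (a i) \<phi> (fst (x, y)) \<xi> (snd (x, y)) * \<psi> (fst (x, y))) \<le> C * bracket x ^ 2 * bracket \<xi> ^ 2 / bracket y ^ ?N * norm (\<psi> x)"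
      unfolding norm_mult fst_conv snd_conv by (intro mult_right_mono C) auto
    also have "\<dots> = C * bracket \<xi> ^ 2 * (1 / bracket y ^ ?N) * (bracket x ^ 2 * norm (\<psi> x))"
      by (simp only: divide_inverse mult_1 mult_ac)
    also have "\<dots> \<le> C * bracket \<xi> ^ 2 * (1 / bracket y ^ ?N) * (M * (1 / bracket x ^ ?N))"
      by (intro mult_left_mono \<psi>2) (use C(1) in auto)
    finally show "norm (weyl_integrand (a i) \<phi> (fst (x, y)) \<xi> (snd (x, y)) * \<psi> (fst (x, y))) \<le> C * bracket \<xi> ^ 2 * M * (1 / bracket x ^ ?N) * (1 / bracket y ^ ?N)"
      by (simp only: mult_ac)
  qed
  then show "integrable lborel (\<lambda>p. weyl_integrand (a i) \<phi> (fst p) \<xi> (snd p) * \<psi> (fst p))"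
    by (simp add: lborel_prod)
  have inner: "(\<integral>p. weyl_integrand (a i) \<phi> (fst p) \<xi> (snd p) * \<psi> (fst p) \<partial>lborel) = (\<integral>x. weyl_inner (a i) \<phi> x \<xi> * \<psi> x \<partial>lborel)" for \<xi>
    using lborel_pair.integral_fst'[OF int, of \<xi>] by (simp add: lborel_prod weyl_inner_def)
  obtain D where D: "D \<ge> 0" "\<And>x \<xi>. norm (weyl_inner (a i) \<phi> x \<xi>) \<le> D * bracket x ^ 2 / bracket \<xi> ^ ?N"
    using weyl_inner_decay[OF a \<phi>, of ?N] i by metis
  have int2: "integrable (lborel \<Otimes>\<^sub>M lborel) (\<lambda>p. weyl_inner (a i) \<phi> (fst p) (snd p) * \<psi> (fst p))"
  proof (rule integrable_pair_bound)
    have "(\<lambda>p. weyl_inner (a i) \<phi> (fst p) (snd p)) \<in> borel_measurable (lborel \<Otimes>\<^sub>M lborel)"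
      unfolding lborel_prod using weyl_inner_measurable[OF a \<phi> i] by simp
    then show "(\<lambda>p. weyl_inner (a i) \<phi> (fst p) (snd p) * \<psi> (fst p)) \<in> borel_measurable (lborel \<Otimes>\<^sub>M lborel)"
      by measurable
    show "integrable lborel (\<lambda>x::'a. D * M * (1 / bracket x ^ ?N))" "integrable lborel (\<lambda>x::'a. 1 / bracket x ^ ?N)"
      by (intro integrable_mult_right integrable_bracket_power, simp)+
    fix x \<xi> :: 'a
    have "norm (weyl_inner (a i) \<phi> (fst (x, \<xi>)) (snd (x, \<xi>)) * \<psi> (fst (x, \<xi>))) \<le> D * bracket x ^ 2 / bracket \<xi> ^ ?N * norm (\<psi> x)"
      unfolding norm_mult fst_conv snd_conv by (intro mult_right_mono D) auto
    also have "\<dots> = D * (1 / bracket \<xi> ^ ?N) * (bracket x ^ 2 * norm (\<psi> x))"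
      by (simp only: divide_inverse mult_1 mult_ac)
    also have "\<dots> \<le> D * (1 / bracket \<xi> ^ ?N) * (M * (1 / bracket x ^ ?N))"
      by (intro mult_left_mono \<psi>2) (use D(1) in auto)
    finally show "norm (weyl_inner (a i) \<phi> (fst (x, \<xi>)) (snd (x, \<xi>)) * \<psi> (fst (x, \<xi>))) \<le> D * M * (1 / bracket x ^ ?N) * (1 / bracket \<xi> ^ ?N)"
      by (simp only: mult_ac)
  qed
  show "integrable lborel (\<lambda>\<xi>. \<integral>p. weyl_integrand (a i) \<phi> (fst p) \<xi> (snd p) * \<psi> (fst p) \<partial>lborel)"
    unfolding inner using lborel_pair.integrable_snd[of "\<lambda>x \<xi>. weyl_inner (a i) \<phi> x \<xi> * \<psi> x"] int2 by (simp add: case_prod_unfold)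
  have "(\<integral>x. conj_weyl (a i) \<phi> x * \<psi> x \<partial>lborel) = (\<integral>x. \<integral>\<xi>. weyl_inner (a i) \<phi> x \<xi> * \<psi> x \<partial>lborel \<partial>lborel)"
    by (simp add: conj_weyl_def)
  also have "\<dots> = (\<integral>\<xi>. \<integral>x. weyl_inner (a i) \<phi> x \<xi> * \<psi> x \<partial>lborel \<partial>lborel)"
    using lborel_pair.Fubini_integral[of "\<lambda>x \<xi>. weyl_inner (a i) \<phi> x \<xi> * \<psi> x"] int2 by (simp add: case_prod_unfold)
  finally show "(\<integral>x. conj_weyl (a i) \<phi> x * \<psi> x \<partial>lborel)
      = (\<integral>\<xi>. \<integral>p. weyl_integrand (a i) \<phi> (fst p) \<xi> (snd p) * \<psi> (fst p) \<partial>lborel \<partial>lborel)"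
    by (simp only: inner)
qed

text \<open>Differentiating in \<open>x\<close> alone would bring down a factor \<open>\<xi>\<close>
  from the exponential. Moving \<open>x\<close> and \<open>y\<close> together leaves the phase
  unchanged and shifts the midpoint by the full vector \<open>b\<close>, so the three terms are the
  derivatives of the symbol, of \<open>\<phi>\<close> and of \<open>\<psi>\<close>. The
  \<open>\<xi>\<close> integral is outermost and is not touched.\<close>

lemma conj_weyl_weak_derivative:
  fixes a :: "'i \<Rightarrow> 'a::euclidean_space \<times> 'a \<Rightarrow> complex"
  assumes a: "symbol_family S a" and \<phi>: "hermite \<phi>" and i: "i \<in> S" and b: "b \<in> Basis"
    and \<psi>: "continuous_on UNIV \<psi>" "\<And>x. norm (\<psi> x) \<le> M / bracket x ^ (2 * DIM('a) + 2)"
    and \<psi>': "continuous_on UNIV \<psi>'" "\<And>x. norm (\<psi>' x) \<le> M' / bracket x ^ (2 * DIM('a) + 2)"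
    and deriv: "\<And>x. ((\<lambda>t. \<psi> (x + t *\<^sub>R b)) has_vector_derivative \<psi>' x) (at 0)"
  shows "(\<integral>x. conj_weyl (dderiv [(b, 0)] (a i)) \<phi> x * \<psi> x \<partial>lborel) + (\<integral>x. conj_weyl (a i) (dderiv [b] \<phi>) x * \<psi> x \<partial>lborel)
    + (\<integral>x. conj_weyl (a i) \<phi> x * \<psi>' x \<partial>lborel) = 0"
proof -
  note da = symbol_family_dderiv[OF a Basis_prod_fst[OF b]]
  note d\<phi> = hermite_dderiv[OF \<phi>, of "[b]"]
  note \<psi>m = borel_measurable_continuous_onI[OF \<psi>(1)] and \<psi>'m = borel_measurable_continuous_onI[OF \<psi>'(1)]
  let ?K1 = "\<lambda>\<xi> p. weyl_integrand (dderiv [(b, 0)] (a i)) \<phi> (fst p) \<xi> (snd p) * \<psi> (fst p)"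
  let ?K2 = "\<lambda>\<xi> p. weyl_integrand (a i) (dderiv [b] \<phi>) (fst p) \<xi> (snd p) * \<psi> (fst p)"
  let ?K3 = "\<lambda>\<xi> p. weyl_integrand (a i) \<phi> (fst p) \<xi> (snd p) * \<psi>' (fst p)"
  note K1 = weyl_integrand_pair_integrable[OF da \<phi> i \<psi>m \<psi>(2)] weyl_integrand_pair_integral_integrable[OF da \<phi> i \<psi>m \<psi>(2)]
  note K2 = weyl_integrand_pair_integrable[OF a d\<phi> i \<psi>m \<psi>(2)] weyl_integrand_pair_integral_integrable[OF a d\<phi> i \<psi>m \<psi>(2)]
  note K3 = weyl_integrand_pair_integrable[OF a \<phi> i \<psi>'m \<psi>'(2)] weyl_integrand_pair_integral_integrable[OF a \<phi> i \<psi>'m \<psi>'(2)]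
  have zero: "(\<integral>p. ?K1 \<xi> p + ?K2 \<xi> p + ?K3 \<xi> p \<partial>lborel) = 0" for \<xi>
  proof (rule integral_derivative_zero[where e = "(b, b)"])
    fix p :: "'a \<times> 'a"
    obtain x y where p: "p = (x, y)" by fastforce
    let ?m = "\<lambda>t. ((1/2) *\<^sub>R ((x + t *\<^sub>R b) + (y + t *\<^sub>R b)), \<xi>)"
    have m: "(?m has_vector_derivative (b, 0)) (at 0)"
      by (auto intro!: derivative_eq_intros simp flip: scaleR_add_left)
    have 1: "((\<lambda>t. a i (?m t)) has_vector_derivative dderiv [(b, 0)] (a i) (?m 0)) (at 0)"
      using smooth_fun_has_vector_derivative[OF symbol_family_smooth[OF a i] m] unfolding dderiv_single .
    have 2: "((\<lambda>t. \<phi> (y + t *\<^sub>R b)) has_vector_derivative dderiv [b] \<phi> y) (at 0)"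
      unfolding dderiv_single by (rule has_vector_derivative_line[OF smooth_fun_differentiable[OF gpoly_smooth[OF \<phi>]]])
    have 3: "((\<lambda>t. iexp (- ((x + t *\<^sub>R b - (y + t *\<^sub>R b)) \<bullet> \<xi>))) has_vector_derivative 0) (at 0)"
      by simp
    show "((\<lambda>t. weyl_integrand (a i) \<phi> (fst (p + t *\<^sub>R (b, b))) \<xi> (snd (p + t *\<^sub>R (b, b))) * \<psi> (fst (p + t *\<^sub>R (b, b))))
      has_vector_derivative ?K1 \<xi> p + ?K2 \<xi> p + ?K3 \<xi> p) (at 0)"
      unfolding weyl_integrand_def p
      using has_vector_derivative_mult[OF has_vector_derivative_mult[OF has_vector_derivative_mult[OF 3 1] 2] deriv[of x]]
      by (simp add: algebra_simps)
  next
    show "continuous_on UNIV (\<lambda>p. ?K1 \<xi> p + ?K2 \<xi> p + ?K3 \<xi> p)"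
      using i by (intro continuous_intros continuous_on_weyl_integrand_family[OF a \<phi>] continuous_on_weyl_integrand_family[OF da \<phi>] continuous_on_weyl_integrand_family[OF a d\<phi>]
          continuous_on_compose2[OF \<psi>(1)] continuous_on_compose2[OF \<psi>'(1)]) auto
    show "integrable lborel (\<lambda>p. ?K1 \<xi> p + ?K2 \<xi> p + ?K3 \<xi> p)"
      by (intro Bochner_Integration.integrable_add K1 K2 K3)
    show "integrable lborel (\<lambda>p. weyl_integrand (a i) \<phi> (fst p) \<xi> (snd p) * \<psi> (fst p))"
      by (rule weyl_integrand_pair_integrable[OF a \<phi> i \<psi>m \<psi>(2)])
  qed
  have "0 = (\<integral>\<xi>. (\<integral>p. ?K1 \<xi> p \<partial>lborel) + (\<integral>p. ?K2 \<xi> p \<partial>lborel) + (\<integral>p. ?K3 \<xi> p \<partial>lborel) \<partial>lborel)"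
    using zero K1(1) K2(1) K3(1) by simp
  also have "\<dots> = (\<integral>\<xi>. \<integral>p. ?K1 \<xi> p \<partial>lborel \<partial>lborel) + (\<integral>\<xi>. \<integral>p. ?K2 \<xi> p \<partial>lborel \<partial>lborel) + (\<integral>\<xi>. \<integral>p. ?K3 \<xi> p \<partial>lborel \<partial>lborel)"
    using K1(2) K2(2) K3(2) by simp
  finally show ?thesis
    unfolding conj_weyl_pairing[OF da \<phi> i \<psi>m \<psi>(2)] conj_weyl_pairing[OF a d\<phi> i \<psi>m \<psi>(2)] conj_weyl_pairing[OF a \<phi> i \<psi>'m \<psi>'(2)] by simp
qed

section \<open>Phase space decay\<close>

text \<open>The scalar product of the quantized function with a wave packet at
  \<open>(\<alpha>, \<beta>)\<close>. The window \<open>g\<close> is left general because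
  integration by parts replaces it by its derivatives.\<close>

definition windowed_FT :: "('a::euclidean_space \<times> 'a \<Rightarrow> complex) \<Rightarrow> ('a \<Rightarrow> complex) \<Rightarrow> ('a \<Rightarrow> complex) \<Rightarrow> 'a \<Rightarrow> 'a \<Rightarrow> complex" where
  "windowed_FT a \<phi> g \<alpha> \<beta> = (\<integral>x. conj_weyl a \<phi> x * (iexp (- (\<beta> \<bullet> x)) * g (x - \<alpha>)) \<partial>lborel)"

text \<open>The growth in \<open>\<alpha>\<close> is harmless: the bound serves only to qualify the
  shifted window as a test function in the weak derivative formula for a fixed centre.\<close>

lemma hermite_shift_bound:
  fixes g :: "'a::euclidean_space \<Rightarrow> complex"
  assumes "hermite g"
  obtains D where "D \<ge> 0" "\<And>x \<alpha>. norm (g (x - \<alpha>)) \<le> D * bracket \<alpha> ^ k / bracket x ^ k"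
proof -
  obtain D where D: "D \<ge> 0" "\<And>x. norm (g x) \<le> D / bracket x ^ k"
    using hermite_bound[OF assms, of k] by blast
  show thesis
  proof (rule that[OF D(1)])
    fix x \<alpha> :: 'a
    have "bracket x ^ k \<le> bracket (x - \<alpha>) ^ k * bracket \<alpha> ^ k"
      using power_mono[OF Peetre[of x "- \<alpha>"], of k] by (simp add: power_mult_distrib)
    from mult_left_mono[OF this D(1)]
    have le: "D * bracket x ^ k \<le> D * bracket \<alpha> ^ k * bracket (x - \<alpha>) ^ k"
      by (simp only: mult_ac)
    then have "D / bracket (x - \<alpha>) ^ k \<le> D * bracket \<alpha> ^ k / bracket x ^ k"
    proof -
      have "r / q \<le> s / p" if "r * p \<le> s * q" "0 < p" "0 < q" for p q r s :: real
        using that by (simp add: field_simps)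
      then show ?thesis
        using le by (simp only: zero_less_power bracket_pos)
    qed
    with D(2)[of "x - \<alpha>"] show "norm (g (x - \<alpha>)) \<le> D * bracket \<alpha> ^ k / bracket x ^ k" by linarith
  qed
qed

text \<open>The weak derivative formula is applied to the modulated window: differentiating the
  modulation produces the frequency factor, and the other terms carry the derivative on the symbol,
  on \<open>\<phi>\<close> and on the window.\<close>

lemma windowed_FT_frequency:
  fixes a :: "'i \<Rightarrow> 'a::euclidean_space \<times> 'a \<Rightarrow> complex"
  assumes a: "symbol_family S a" and \<phi>: "hermite \<phi>" and g: "hermite g" and i: "i \<in> S" and b: "b \<in> Basis"
  shows "\<i> * complex_of_real (\<beta> \<bullet> b) * windowed_FT (a i) \<phi> g \<alpha> \<beta>
    = windowed_FT (dderiv [(b, 0)] (a i)) \<phi> g \<alpha> \<beta> + windowed_FT (a i) (dderiv [b] \<phi>) g \<alpha> \<beta> + windowed_FT (a i) \<phi> (dderiv [b] g) \<alpha> \<beta>"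
proof -
  let ?k = "2 * DIM('a) + 2"
  let ?e = "\<lambda>x. iexp (- (\<beta> \<bullet> x))"
  let ?\<psi> = "\<lambda>x. ?e x * g (x - \<alpha>)" and ?\<psi>1 = "\<lambda>x. ?e x * dderiv [b] g (x - \<alpha>)"
  let ?\<psi>' = "\<lambda>x. - \<i> * complex_of_real (\<beta> \<bullet> b) * ?\<psi> x + ?\<psi>1 x"
  note dg = hermite_dderiv[OF g, of "[b]"]
  obtain D where D: "D \<ge> 0" "\<And>x \<alpha>. norm (g (x - \<alpha>)) \<le> D * bracket \<alpha> ^ ?k / bracket x ^ ?k"
    using hermite_shift_bound[OF g] by blast
  obtain D1 where D1: "D1 \<ge> 0" "\<And>x \<alpha>. norm (dderiv [b] g (x - \<alpha>)) \<le> D1 * bracket \<alpha> ^ ?k / bracket x ^ ?k"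
    using hermite_shift_bound[OF dg] by blast
  have c: "continuous_on UNIV ?\<psi>" "continuous_on UNIV ?\<psi>1"
    by (intro continuous_intros continuous_on_compose2[OF hermite_continuous[OF g]] continuous_on_compose2[OF hermite_continuous[OF dg]]; simp)+
  have n: "norm (?\<psi> x) \<le> D * bracket \<alpha> ^ ?k / bracket x ^ ?k" "norm (?\<psi>1 x) \<le> D1 * bracket \<alpha> ^ ?k / bracket x ^ ?k" for x
    using D(2)[of x \<alpha>] D1(2)[of x \<alpha>] by (simp_all add: norm_mult)
  have n': "norm (?\<psi>' x) \<le> (\<bar>\<beta> \<bullet> b\<bar> * (D * bracket \<alpha> ^ ?k) + D1 * bracket \<alpha> ^ ?k) / bracket x ^ ?k" for x
  proof -
    have "norm (?\<psi>' x) \<le> norm (- \<i> * complex_of_real (\<beta> \<bullet> b) * ?\<psi> x) + norm (?\<psi>1 x)"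
      by (rule norm_triangle_ineq)
    also have "norm (- \<i> * complex_of_real (\<beta> \<bullet> b) * ?\<psi> x) = \<bar>\<beta> \<bullet> b\<bar> * norm (?\<psi> x)"
      by (simp add: norm_mult)
    also have "\<bar>\<beta> \<bullet> b\<bar> * norm (?\<psi> x) + norm (?\<psi>1 x) \<le> \<bar>\<beta> \<bullet> b\<bar> * (D * bracket \<alpha> ^ ?k / bracket x ^ ?k) + D1 * bracket \<alpha> ^ ?k / bracket x ^ ?k"
      by (intro add_mono mult_left_mono n) auto
    finally show ?thesis by (simp add: add_divide_distrib)
  qed
  have int: "integrable lborel (\<lambda>x. conj_weyl (a i) \<phi> x * ?\<psi> x)" "integrable lborel (\<lambda>x. conj_weyl (a i) \<phi> x * ?\<psi>1 x)"
  proof -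
    \<comment> \<open>Exponent zero is plain boundedness, which suffices because the test functions
      already decay.\<close>
    obtain C where C: "C \<ge> 0" "\<And>x. norm (conj_weyl (a i) \<phi> x) \<le> C / bracket x ^ 0"
      using conj_weyl_decay[OF a \<phi>, of 0] i by metis
    have *: "integrable lborel (\<lambda>x. conj_weyl (a i) \<phi> x * f x)"
      if "continuous_on UNIV f" "\<And>x. norm (f x) \<le> M / bracket x ^ ?k" for f M
    proof (rule integrable_bracket_bound)
      show "(\<lambda>x. conj_weyl (a i) \<phi> x * f x) \<in> borel_measurable borel"
        using conj_weyl_measurable[OF a \<phi> i] borel_measurable_continuous_onI[OF that(1)] by simp
      show "norm (conj_weyl (a i) \<phi> x * f x) \<le> C * M / bracket x ^ (2 * DIM('a))" for x
      proof -
        have M: "0 \<le> M" using order_trans[OF norm_ge_zero that(2)[of 0]] by simp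
        have "norm (conj_weyl (a i) \<phi> x * f x) \<le> C * (M / bracket x ^ ?k)"
          unfolding norm_mult using C that(2) by (intro mult_mono) auto
        also have "\<dots> \<le> C * (M / bracket x ^ (2 * DIM('a)))"
          using C M bracket_pos[of x] by (intro mult_left_mono divide_left_mono power_increasing mult_pos_pos zero_less_power) auto
        finally show ?thesis by simp
      qed
    qed
    show "integrable lborel (\<lambda>x. conj_weyl (a i) \<phi> x * ?\<psi> x)" "integrable lborel (\<lambda>x. conj_weyl (a i) \<phi> x * ?\<psi>1 x)"
      by (rule *[OF c(1) n(1)], rule *[OF c(2) n(2)])
  qed
  have deriv: "((\<lambda>t. ?\<psi> (x + t *\<^sub>R b)) has_vector_derivative ?\<psi>' x) (at 0)" for x
  proof -
    have 1: "((\<lambda>t. g (x - \<alpha> + t *\<^sub>R b)) has_vector_derivative dderiv [b] g (x - \<alpha>)) (at 0)"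
      unfolding dderiv_single by (rule has_vector_derivative_line[OF smooth_fun_differentiable[OF gpoly_smooth[OF g]]])
    have 2: "((\<lambda>t. ?e (x + t *\<^sub>R b)) has_vector_derivative - \<i> * complex_of_real (\<beta> \<bullet> b) * ?e x) (at 0)"
    proof -
      have "((\<lambda>t. \<i> * complex_of_real (- (\<beta> \<bullet> (x + t *\<^sub>R b)))) has_vector_derivative - \<i> * complex_of_real (\<beta> \<bullet> b)) (at 0)"
      proof -
        have "- (\<beta> \<bullet> (x + t *\<^sub>R b)) = - (\<beta> \<bullet> x) - t * (\<beta> \<bullet> b)" for t
          by (simp add: algebra_simps)
        then show ?thesis
          by (simp only:) (auto intro!: derivative_eq_intros)
      qed
      from field_vector_diff_chain_at[OF this DERIV_exp] show ?thesis by (simp add: o_def)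
    qed
    have "((\<lambda>t. ?e (x + t *\<^sub>R b) * g (x - \<alpha> + t *\<^sub>R b)) has_vector_derivative ?\<psi>' x) (at 0)"
      by (rule has_vector_derivative_eq_rhs[OF has_vector_derivative_mult[OF 2 1]]) simp
    then show ?thesis by (simp add: algebra_simps)
  qed
  have c': "continuous_on UNIV ?\<psi>'"
    by (intro continuous_intros c)
  have "(\<integral>x. conj_weyl (a i) \<phi> x * ?\<psi>' x \<partial>lborel) = (\<integral>x. - \<i> * complex_of_real (\<beta> \<bullet> b) * (conj_weyl (a i) \<phi> x * ?\<psi> x) + conj_weyl (a i) \<phi> x * ?\<psi>1 x \<partial>lborel)"
    by (intro Bochner_Integration.integral_cong refl) (simp only: distrib_left mult_ac)
  also have "\<dots> = - \<i> * complex_of_real (\<beta> \<bullet> b) * windowed_FT (a i) \<phi> g \<alpha> \<beta> + windowed_FT (a i) \<phi> (dderiv [b] g) \<alpha> \<beta>"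
    unfolding windowed_FT_def by (subst Bochner_Integration.integral_add) (use int in \<open>auto intro!: integrable_mult_right\<close>)
  finally have I3: "(\<integral>x. conj_weyl (a i) \<phi> x * ?\<psi>' x \<partial>lborel)
    = - \<i> * complex_of_real (\<beta> \<bullet> b) * windowed_FT (a i) \<phi> g \<alpha> \<beta> + windowed_FT (a i) \<phi> (dderiv [b] g) \<alpha> \<beta>" .
  have "windowed_FT (dderiv [(b, 0)] (a i)) \<phi> g \<alpha> \<beta> + windowed_FT (a i) (dderiv [b] \<phi>) g \<alpha> \<beta>
      + (- \<i> * complex_of_real (\<beta> \<bullet> b) * windowed_FT (a i) \<phi> g \<alpha> \<beta> + windowed_FT (a i) \<phi> (dderiv [b] g) \<alpha> \<beta>) = 0"
    using conj_weyl_weak_derivative[OF a \<phi> i b c(1) n(1) c' n' deriv] unfolding I3 by (simp only: windowed_FT_def)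
  then show ?thesis
    by (simp add: add_eq_0_iff algebra_simps)
qed

text \<open>The weight at \<open>\<alpha>\<close> is split by \<open>Peetre\<close> between
  \<open>x\<close>, where the quantized function decays, and \<open>x - \<alpha>\<close>, where the
  window decays; the remaining \<open>2 * DIM('a)\<close> powers make the integral converge.\<close>

lemma windowed_FT_bound:
  fixes a :: "'i \<Rightarrow> 'a::euclidean_space \<times> 'a \<Rightarrow> complex"
  assumes a: "symbol_family S a" and \<phi>: "hermite \<phi>" and g: "hermite g"
  obtains C where "C \<ge> 0" "\<And>i \<alpha> \<beta>. i \<in> S \<Longrightarrow> bracket \<alpha> ^ k * norm (windowed_FT (a i) \<phi> g \<alpha> \<beta>) \<le> C"
proof -
  obtain C where C: "C \<ge> 0" "\<And>i x. i \<in> S \<Longrightarrow> norm (conj_weyl (a i) \<phi> x) \<le> C / bracket x ^ (k + 2 * DIM('a))"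
    using conj_weyl_decay[OF a \<phi>] by blast
  obtain D where D: "D \<ge> 0" "\<And>x. norm (g x) \<le> D / bracket x ^ k"
    using hermite_bound[OF g] by blast
  show thesis
  proof (rule that[of "C * D * bracket_mass TYPE('a)"])
    fix i and \<alpha> \<beta> :: 'a assume i: "i \<in> S"
    have "norm (windowed_FT (a i) \<phi> g \<alpha> \<beta>) \<le> (C * D / bracket \<alpha> ^ k) * bracket_mass TYPE('a)"
      unfolding windowed_FT_def
    proof (rule norm_integral_bracket_bound)
      have [measurable]: "g \<in> borel_measurable borel"
        by (rule borel_measurable_continuous_onI[OF hermite_continuous[OF g]])
      note [measurable] = conj_weyl_measurable[OF a \<phi> i]
      show "(\<lambda>x. conj_weyl (a i) \<phi> x * (iexp (- (\<beta> \<bullet> x)) * g (x - \<alpha>))) \<in> borel_measurable borel"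
        by measurable
      fix x :: 'a
      have p: "0 < bracket x ^ j" "0 < bracket (x - \<alpha>) ^ j" "0 < bracket \<alpha> ^ j" for j
        by (intro zero_less_power bracket_pos)+
      have "bracket \<alpha> ^ k \<le> bracket x ^ k * bracket (x - \<alpha>) ^ k"
        using power_mono[OF Peetre[of \<alpha> "x - \<alpha>"], of k] by (simp add: power_mult_distrib)
      then have le: "1 / (bracket x ^ k * bracket (x - \<alpha>) ^ k) \<le> 1 / bracket \<alpha> ^ k"
        by (intro divide_left_mono mult_pos_pos p) auto
      have "norm (conj_weyl (a i) \<phi> x * (iexp (- (\<beta> \<bullet> x)) * g (x - \<alpha>))) = norm (conj_weyl (a i) \<phi> x) * norm (g (x - \<alpha>))"
        by (simp add: norm_mult)
      also have "\<dots> \<le> (C / bracket x ^ (k + 2 * DIM('a))) * (D / bracket (x - \<alpha>) ^ k)"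
        using C D i by (intro mult_mono) auto
      also have "\<dots> = (C * D / bracket x ^ (2 * DIM('a))) * (1 / (bracket x ^ k * bracket (x - \<alpha>) ^ k))"
        by (simp only: power_add) simp
      also have "\<dots> \<le> (C * D / bracket x ^ (2 * DIM('a))) * (1 / bracket \<alpha> ^ k)"
        by (intro mult_left_mono le) (use C D in auto)
      finally show "norm (conj_weyl (a i) \<phi> x * (iexp (- (\<beta> \<bullet> x)) * g (x - \<alpha>))) \<le> (C * D / bracket \<alpha> ^ k) / bracket x ^ (2 * DIM('a))"
        by (simp add: mult.commute)
    qed
    then show "bracket \<alpha> ^ k * norm (windowed_FT (a i) \<phi> g \<alpha> \<beta>) \<le> C * D * bracket_mass TYPE('a)"
      using zero_less_power[OF bracket_pos[of \<alpha>], of k] by (simp add: field_simps)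
  qed (intro mult_nonneg_nonneg C D bracket_mass_nonneg)
qed

lemma windowed_FT_decay_coordinate:
  fixes a :: "'i \<Rightarrow> 'a::euclidean_space \<times> 'a \<Rightarrow> complex"
  assumes b: "b \<in> Basis"
  shows "symbol_family S a \<Longrightarrow> hermite \<phi> \<Longrightarrow> hermite g \<Longrightarrow>
    \<exists>C\<ge>0. \<forall>i\<in>S. \<forall>\<alpha> \<beta>. \<bar>\<beta> \<bullet> b\<bar> ^ k * norm (windowed_FT (a i) \<phi> g \<alpha> \<beta>) \<le> C"
proof (induction k arbitrary: a \<phi> g)
  case 0
  then show ?case using windowed_FT_bound[OF 0, of 0] by (metis mult_1 power_0)
next
  case (Suc k)
  note a = Suc.prems(1) and \<phi> = Suc.prems(2) and g = Suc.prems(3)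
  obtain C where C: "C \<ge> 0" "\<And>i \<alpha> \<beta>. i \<in> S \<Longrightarrow> \<bar>\<beta> \<bullet> b\<bar> ^ k * norm (windowed_FT (dderiv [(b, 0)] (a i)) \<phi> g \<alpha> \<beta>) \<le> C"
    using Suc.IH[OF symbol_family_dderiv[OF a Basis_prod_fst[OF b]] \<phi> g] by blast
  obtain D where D: "D \<ge> 0" "\<And>i \<alpha> \<beta>. i \<in> S \<Longrightarrow> \<bar>\<beta> \<bullet> b\<bar> ^ k * norm (windowed_FT (a i) (dderiv [b] \<phi>) g \<alpha> \<beta>) \<le> D"
    using Suc.IH[OF a hermite_dderiv[OF \<phi>, of "[b]"] g] by blast
  obtain E where E: "E \<ge> 0" "\<And>i \<alpha> \<beta>. i \<in> S \<Longrightarrow> \<bar>\<beta> \<bullet> b\<bar> ^ k * norm (windowed_FT (a i) \<phi> (dderiv [b] g) \<alpha> \<beta>) \<le> E"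
    using Suc.IH[OF a \<phi> hermite_dderiv[OF g, of "[b]"]] by blast
  have "\<bar>\<beta> \<bullet> b\<bar> ^ Suc k * norm (windowed_FT (a i) \<phi> g \<alpha> \<beta>) \<le> C + D + E" if i: "i \<in> S" for i \<alpha> \<beta>
  proof -
    have "\<bar>\<beta> \<bullet> b\<bar> * norm (windowed_FT (a i) \<phi> g \<alpha> \<beta>) = norm (\<i> * complex_of_real (\<beta> \<bullet> b) * windowed_FT (a i) \<phi> g \<alpha> \<beta>)"
      by (simp add: norm_mult)
    also have "\<dots> \<le> norm (windowed_FT (dderiv [(b, 0)] (a i)) \<phi> g \<alpha> \<beta>) + norm (windowed_FT (a i) (dderiv [b] \<phi>) g \<alpha> \<beta>) + norm (windowed_FT (a i) \<phi> (dderiv [b] g) \<alpha> \<beta>)"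
      unfolding windowed_FT_frequency[OF a \<phi> g i b] by (intro norm_triangle_le add_mono order_refl norm_triangle_ineq)
    finally have "\<bar>\<beta> \<bullet> b\<bar> ^ k * (\<bar>\<beta> \<bullet> b\<bar> * norm (windowed_FT (a i) \<phi> g \<alpha> \<beta>))
       \<le> \<bar>\<beta> \<bullet> b\<bar> ^ k * (norm (windowed_FT (dderiv [(b, 0)] (a i)) \<phi> g \<alpha> \<beta>) + norm (windowed_FT (a i) (dderiv [b] \<phi>) g \<alpha> \<beta>) + norm (windowed_FT (a i) \<phi> (dderiv [b] g) \<alpha> \<beta>))"
      by (intro mult_left_mono) auto
    then show ?thesis
      using C(2)[OF i, of \<beta> \<alpha>] D(2)[OF i, of \<beta> \<alpha>] E(2)[OF i, of \<beta> \<alpha>] by (simp add: algebra_simps)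
  qed
  then show ?case using C(1) D(1) E(1) by (intro exI[of _ "C + D + E"]) auto
qed

text \<open>Decay in \<open>\<alpha>\<close> and decay in \<open>\<beta>\<close> are known
  separately. Taking each to order \<open>2 * k\<close> and passing to the geometric mean gives
  joint decay of order \<open>k\<close> in both, whence the square root in the constant.\<close>

lemma windowed_FT_decay:
  fixes a :: "'i \<Rightarrow> 'a::euclidean_space \<times> 'a \<Rightarrow> complex"
  assumes a: "symbol_family S a" and \<phi>: "hermite \<phi>" and g: "hermite g"
  obtains C where "C \<ge> 0" "\<And>i \<alpha> \<beta>. i \<in> S \<Longrightarrow> norm (windowed_FT (a i) \<phi> g \<alpha> \<beta>) \<le> C / (bracket \<alpha> ^ k * bracket \<beta> ^ k)"
proof -
  obtain A where A: "A \<ge> 0" "\<And>i \<alpha> \<beta>. i \<in> S \<Longrightarrow> bracket \<alpha> ^ (2 * k) * norm (windowed_FT (a i) \<phi> g \<alpha> \<beta>) \<le> A"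
    using windowed_FT_bound[OF a \<phi> g] by blast
  obtain A0 where A0: "A0 \<ge> 0" "\<And>i \<alpha> \<beta>. i \<in> S \<Longrightarrow> bracket \<alpha> ^ 0 * norm (windowed_FT (a i) \<phi> g \<alpha> \<beta>) \<le> A0"
    using windowed_FT_bound[OF a \<phi> g, of 0] by blast
  have "\<exists>B. \<forall>b\<in>(Basis::'a set). 0 \<le> B b \<and> (\<forall>i\<in>S. \<forall>\<alpha> \<beta>. \<bar>\<beta> \<bullet> b\<bar> ^ (2 * k) * norm (windowed_FT (a i) \<phi> g \<alpha> \<beta>) \<le> B b)"
    by (intro bchoice ballI) (use windowed_FT_decay_coordinate[OF _ a \<phi> g, of _ "2 * k"] in blast)
  then obtain B where B: "\<And>b. b \<in> Basis \<Longrightarrow> 0 \<le> B b" "\<And>b i \<alpha> \<beta>. b \<in> Basis \<Longrightarrow> i \<in> S \<Longrightarrow>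
      \<bar>\<beta> \<bullet> b\<bar> ^ (2 * k) * norm (windowed_FT (a i) \<phi> g \<alpha> \<beta>) \<le> B b"
    by blast
  define C where "C = (1 + real DIM('a)) ^ (2 * k) * (A0 + (\<Sum>b\<in>Basis. B b))"
  show thesis
  proof (rule that[of "sqrt (A * C)"])
    fix i and \<alpha> \<beta> :: 'a assume i: "i \<in> S"
    let ?w = "norm (windowed_FT (a i) \<phi> g \<alpha> \<beta>)"
    have C: "bracket \<beta> ^ (2 * k) * ?w \<le> C"
      unfolding C_def by (rule bracket_decay_of_coordinates) (use A0(2)[OF i] B(2) i in auto)
    have "(bracket \<alpha> ^ k * bracket \<beta> ^ k * ?w)\<^sup>2 = (bracket \<alpha> ^ (2 * k) * ?w) * (bracket \<beta> ^ (2 * k) * ?w)"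
      by (simp only: power_mult_distrib power_mult[symmetric] mult.commute[of k 2] power2_eq_square[of ?w]) (simp only: mult_ac)
    also have "\<dots> \<le> A * C"
      using A C i by (intro mult_mono) auto
    finally have "bracket \<alpha> ^ k * bracket \<beta> ^ k * ?w \<le> sqrt (A * C)"
      by (rule real_le_rsqrt)
    then show "?w \<le> sqrt (A * C) / (bracket \<alpha> ^ k * bracket \<beta> ^ k)"
      using mult_pos_pos[OF zero_less_power[OF bracket_pos[of \<alpha>], of k] zero_less_power[OF bracket_pos[of \<beta>], of k]]
      by (simp add: pos_le_divide_eq mult.commute)
  qed (auto simp: C_def intro!: A0 A B mult_nonneg_nonneg add_nonneg_nonneg sum_nonneg)
qed

text \<open>A substitute for the Cauchy-Schwarz inequality: the elementary
  \<open>2 * a * b \<le> a\<^sup>2 + b\<^sup>2\<close> is enough, since the functions it is used for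
  have controlled norms.\<close>

lemma integrable_mult_of_squares:
  fixes f g :: "'a::euclidean_space \<Rightarrow> complex"
  assumes [measurable]: "f \<in> borel_measurable M" "g \<in> borel_measurable M"
    and "integrable M (\<lambda>x. (norm (f x))\<^sup>2)" "integrable M (\<lambda>x. (norm (g x))\<^sup>2)"
  shows "integrable M (\<lambda>x. f x * g x)"
    and "norm (\<integral>x. f x * g x \<partial>M) \<le> (\<integral>x. (norm (f x))\<^sup>2 \<partial>M) + (\<integral>x. (norm (g x))\<^sup>2 \<partial>M)"
proof -
  have le: "norm (f x * g x) \<le> (norm (f x))\<^sup>2 + (norm (g x))\<^sup>2" for x
  proof -
    have "0 \<le> norm (f x) * norm (g x)" by simp
    then show ?thesis
      using sum_squares_bound[of "norm (f x)" "norm (g x)"] unfolding norm_mult mult.assoc by linarith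
  qed
  have int: "integrable M (\<lambda>x. (norm (f x))\<^sup>2 + (norm (g x))\<^sup>2)"
    using assms by simp
  show *: "integrable M (\<lambda>x. f x * g x)"
    by (rule Bochner_Integration.integrable_bound[OF int]) (use le in auto)
  have "norm (\<integral>x. f x * g x \<partial>M) \<le> (\<integral>x. (norm (f x))\<^sup>2 + (norm (g x))\<^sup>2 \<partial>M)"
    by (rule Bochner_Integration.integral_norm_bound_integral[OF * int]) (rule le)
  then show "norm (\<integral>x. f x * g x \<partial>M) \<le> (\<integral>x. (norm (f x))\<^sup>2 \<partial>M) + (\<integral>x. (norm (g x))\<^sup>2 \<partial>M)"
    using assms by simp
qed

section \<open>Coherent states and square integrable functions\<close>

lemma
  fixes \<alpha> :: "'a::euclidean_space"
  shows integrable_gauss_square: "integrable lborel (\<lambda>x. (gauss (x - \<alpha>))\<^sup>2)"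
    and integral_gauss_square: "(\<integral>x. (gauss (x - \<alpha>))\<^sup>2 \<partial>lborel) = sqrt pi ^ DIM('a)"
proof -
  have eq: "(gauss x)\<^sup>2 = gauss (sqrt 2 *\<^sub>R x)" for x :: 'a
    by (simp add: gauss_def power2_eq_square flip: exp_add)
  have "integrable lborel (\<lambda>x::'a. (gauss x)\<^sup>2)"
    unfolding eq by (rule integrable_gauss_scaled) simp
  then show "integrable lborel (\<lambda>x::'a. (gauss (x - \<alpha>))\<^sup>2)"
    using lborel_integrable_translate_iff[of "\<lambda>x::'a. (gauss x)\<^sup>2" "- \<alpha>"] by simp
  have "(\<integral>x. (gauss (x - \<alpha>))\<^sup>2 \<partial>lborel) = integral\<^sup>L lborel (\<lambda>x::'a. (gauss x)\<^sup>2)"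
    using lborel_integral_translate[of "\<lambda>x::'a. (gauss x)\<^sup>2" "- \<alpha>"] by simp
  also have "complex_of_real \<dots> = complex_of_real ((sqrt (2 * pi) / sqrt 2) ^ DIM('a))"
    using integral_iexp_gauss_scaled(2)[of "sqrt 2" "0::'a"]
    unfolding eq by (simp add: integral_complex_of_real del: of_real_power of_real_divide)
  finally show "(\<integral>x. (gauss (x - \<alpha>))\<^sup>2 \<partial>lborel) = sqrt pi ^ DIM('a)"
    by (simp only: of_real_eq_iff) (simp add: real_sqrt_mult)
qed

abbreviation cgauss :: "'a::euclidean_space \<Rightarrow> complex" where
  "cgauss x \<equiv> complex_of_real (gauss x)"

text \<open>The Gaussian windowed Fourier transform, that is, the scalar product with a coherent state.\<close>
definition gabor :: "('a::euclidean_space \<Rightarrow> complex) \<Rightarrow> 'a \<Rightarrow> 'a \<Rightarrow> complex" where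
  "gabor v \<alpha> \<beta> = FT (\<lambda>x. v x * cgauss (x - \<alpha>)) \<beta>"

lemma window_integrable:
  fixes v :: "'a::euclidean_space \<Rightarrow> complex"
  assumes v: "v \<in> borel_measurable borel" "integrable lborel (\<lambda>x. (norm (v x))\<^sup>2)"
  shows "integrable lborel (\<lambda>x. v x * cgauss (x - \<alpha>))"
  by (rule integrable_mult_of_squares) (use v in \<open>auto simp: integrable_gauss_square\<close>)

text \<open>The starting point of the bootstrap: a bound without decay, but uniform over all centres
  in phase space.\<close>

lemma gabor_bound:
  fixes v :: "'a::euclidean_space \<Rightarrow> complex"
  assumes v: "v \<in> borel_measurable borel" "integrable lborel (\<lambda>x. (norm (v x))\<^sup>2)"
  shows "norm (gabor v \<alpha> \<beta>) \<le> (\<integral>x. (norm (v x))\<^sup>2 \<partial>lborel) + sqrt pi ^ DIM('a)"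
proof -
  note [measurable] = v(1)
  have "norm (\<integral>x. (iexp (- (\<beta> \<bullet> x)) * v x) * cgauss (x - \<alpha>) \<partial>lborel) \<le>
    (\<integral>x. (norm (iexp (- (\<beta> \<bullet> x)) * v x))\<^sup>2 \<partial>lborel) + (\<integral>x. (norm (cgauss (x - \<alpha>)))\<^sup>2 \<partial>lborel)"
    by (rule integrable_mult_of_squares(2)) (use v(2) in \<open>auto simp: integrable_gauss_square norm_mult\<close>)
  then show ?thesis
    by (simp add: gabor_def FT_def norm_mult integral_gauss_square mult.assoc)
qed

text \<open>Resolution of the identity by coherent states: the pairing of \<open>v\<close> with \<open>conj_weyl (a i) cgauss\<close> is an
  average of products of windowed Fourier transforms.\<close>
lemma conj_weyl_pairing_bound:
  fixes a :: "'i \<Rightarrow> 'a::euclidean_space \<times> 'a \<Rightarrow> complex"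
  assumes a: "symbol_family S a"
  obtains C where "C \<ge> 0" "\<And>i v A. i \<in> S \<Longrightarrow> v \<in> borel_measurable borel \<Longrightarrow> integrable lborel (\<lambda>x. (norm (v x))\<^sup>2) \<Longrightarrow>
    (\<And>\<alpha> \<beta>. norm (gabor v \<alpha> \<beta>) \<le> A * bracket \<alpha> ^ k * bracket \<beta> ^ k) \<Longrightarrow>
    norm (\<integral>x. v x * conj_weyl (a i) cgauss x \<partial>lborel) \<le> C * A"
proof -
  let ?N = "2 * DIM('a)"
  define m where "m = bracket_mass TYPE('a)"
  have m: "0 \<le> m" unfolding m_def by (rule bracket_mass_nonneg)
  \<comment> \<open>Of the exponent, \<open>k\<close> absorbs the growth permitted to
    \<open>gabor v\<close>, and \<open>?N\<close> makes the integrals over \<open>\<alpha>\<close>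
    and \<open>\<beta>\<close> converge.\<close>
  obtain C where C: "C \<ge> 0" "\<And>i \<alpha> \<beta>. i \<in> S \<Longrightarrow>
      norm (windowed_FT (a i) cgauss cgauss \<alpha> \<beta>) \<le> C / (bracket \<alpha> ^ (k + ?N) * bracket \<beta> ^ (k + ?N))"
    using windowed_FT_decay[OF a hermite_gauss hermite_gauss] by blast
  show thesis
  proof (rule that[of "C * m * m"])
    fix i A and v :: "'a \<Rightarrow> complex"
    assume i: "i \<in> S" and vm [measurable]: "v \<in> borel_measurable borel" and v: "integrable lborel (\<lambda>x. (norm (v x))\<^sup>2)"
      and A: "\<And>\<alpha> \<beta>. norm (gabor v \<alpha> \<beta>) \<le> A * bracket \<alpha> ^ k * bracket \<beta> ^ k"
    have A0: "0 \<le> A" using order_trans[OF norm_ge_zero A[of 0 0]] by simp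
    define r where "r = conj_weyl (a i) cgauss"
    have r_cont: "continuous_on UNIV r" unfolding r_def by (rule continuous_on_conj_weyl[OF a hermite_gauss i])
    then have [measurable]: "r \<in> borel_measurable borel" by (rule borel_measurable_continuous_onI)
    obtain B where B: "B \<ge> 0" "\<And>x. norm (r x) \<le> B / bracket x ^ ?N"
      using conj_weyl_decay[OF a hermite_gauss, of ?N] i unfolding r_def by metis
    have B': "norm (r x) \<le> B" for x :: 'a
    proof -
      have "B / bracket x ^ ?N \<le> B / 1"
        using B(1) by (intro divide_left_mono) (auto simp: one_le_power bracket_pos)
      with B(2)[of x] show ?thesis by simp
    qed
    have r_int: "integrable lborel r"
      by (rule integrable_bracket_bound[OF _ B(2)]) simp
    have r2: "integrable lborel (\<lambda>x. (norm (r x))\<^sup>2)"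
    proof (rule Bochner_Integration.integrable_bound)
      show "integrable lborel (\<lambda>x. B * norm (r x))" using r_int by simp
      show "AE x in lborel. norm ((norm (r x))\<^sup>2) \<le> norm (B * norm (r x))"
        using B(1) B' by (auto simp: power2_eq_square abs_mult intro!: mult_right_mono)
    qed simp
    have vr: "integrable lborel (\<lambda>x. v x * r x)"
      by (rule integrable_mult_of_squares) (use v r2 in auto)
    \<comment> \<open>The pairing localised by the squared window at \<open>\<alpha>\<close>. Its
      integral over all \<open>\<alpha>\<close> recovers the full pairing up to the integral of the
      squared Gaussian.\<close>
    define J where "J \<alpha> = (\<integral>x. v x * r x * complex_of_real ((gauss (x - \<alpha>))\<^sup>2) \<partial>lborel)" for \<alpha>
    have J: "norm (J \<alpha>) \<le> (C * A * m) / bracket \<alpha> ^ ?N" for \<alpha>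
    proof -
      \<comment> \<open>One factor of the squared window is given to \<open>v\<close> and the other
        to \<open>r\<close>, so that Parseval turns \<open>J \<alpha>\<close> into an integral of
        \<open>gabor v\<close> against a rapidly decaying transform.\<close>
      let ?h = "\<lambda>x. v x * cgauss (x - \<alpha>)" and ?k = "\<lambda>x. r x * cgauss (x - \<alpha>)"
      have FTk: "FT ?k (- \<beta>) = windowed_FT (a i) cgauss cgauss \<alpha> (- \<beta>)" for \<beta>
        by (simp add: FT_def windowed_FT_def r_def mult_ac)
      have bd: "norm (FT ?h \<beta> * FT ?k (- \<beta>)) \<le> (C * A / bracket \<alpha> ^ ?N) / bracket \<beta> ^ ?N" for \<beta>
      proof -
        have "norm (FT ?h \<beta> * FT ?k (- \<beta>)) \<le> (A * bracket \<alpha> ^ k * bracket \<beta> ^ k) * (C / (bracket \<alpha> ^ (k + ?N) * bracket \<beta> ^ (k + ?N)))"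
          unfolding norm_mult FTk using A[of \<alpha> \<beta>] C(2)[OF i, of \<alpha> "- \<beta>"] A0
          by (intro mult_mono) (auto simp: gabor_def)
        also have "\<dots> = (C * A / bracket \<alpha> ^ ?N) / bracket \<beta> ^ ?N"
          using zero_less_power[OF bracket_pos[of \<alpha>], of k] zero_less_power[OF bracket_pos[of \<beta>], of k]
          by (simp only: power_add) simp
        finally show ?thesis .
      qed
      have meas: "(\<lambda>\<beta>. FT ?h \<beta> * FT ?k (- \<beta>)) \<in> borel_measurable borel" by measurable
      have "complex_of_real ((2 * pi) ^ DIM('a)) * J \<alpha> = (\<integral>\<beta>. FT ?h \<beta> * FT ?k (- \<beta>) \<partial>lborel)"
      proof -
        have "(\<integral>\<beta>. FT ?h \<beta> * FT ?k (- \<beta>) \<partial>lborel) = complex_of_real ((2 * pi) ^ DIM('a)) * (\<integral>x. ?h x * ?k x \<partial>lborel)"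
        proof (rule Parseval)
          show "integrable lborel ?h" by (rule window_integrable[OF vm v])
          show "integrable lborel ?k"
            by (rule Bochner_Integration.integrable_bound[OF r_int]) (auto simp: norm_mult gauss_le_1 mult_left_le)
          show "continuous_on UNIV ?k" by (intro continuous_intros r_cont)
          show "norm (?k x) \<le> B" for x
            using mult_mono[OF B'[of x] gauss_le_1[of "x - \<alpha>"]] B(1) by (simp add: norm_mult)
          show "integrable lborel (\<lambda>\<beta>. FT ?h \<beta> * FT ?k (- \<beta>))"
            by (rule integrable_bracket_bound[OF meas bd])
        qed
        then show ?thesis by (simp add: J_def power2_eq_square mult_ac)
      qed
      then have "(2 * pi) ^ DIM('a) * norm (J \<alpha>) = norm (\<integral>\<beta>. FT ?h \<beta> * FT ?k (- \<beta>) \<partial>lborel)"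
        by (metis norm_mult norm_of_real abs_of_nonneg pi_ge_zero zero_le_mult_iff zero_le_numeral zero_le_power)
      also have "\<dots> \<le> (C * A / bracket \<alpha> ^ ?N) * m"
        unfolding m_def by (rule norm_integral_bracket_bound[OF meas bd])
      finally have "(2 * pi) ^ DIM('a) * norm (J \<alpha>) \<le> (C * A * m) / bracket \<alpha> ^ ?N" by (simp add: mult_ac)
      moreover have "1 * norm (J \<alpha>) \<le> (2 * pi) ^ DIM('a) * norm (J \<alpha>)"
        using pi_gt3 by (intro mult_right_mono one_le_power) auto
      ultimately show ?thesis by simp
    qed
    have int2: "integrable (lborel \<Otimes>\<^sub>M lborel) (\<lambda>(x, \<alpha>). v x * r x * complex_of_real ((gauss (x - \<alpha>))\<^sup>2))"
    proof (rule lborel_pair.Fubini_integrable)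
      have sym: "gauss (x - \<alpha>) = gauss (\<alpha> - x)" for x \<alpha> :: 'a
        by (metis gauss_minus minus_diff_eq)
      have c0: "(\<integral>\<alpha>. (gauss (x - \<alpha>))\<^sup>2 \<partial>lborel) = sqrt pi ^ DIM('a)" for x :: 'a
        using integral_gauss_square[of x] by (simp only: sym[of x])
      show "integrable lborel (\<lambda>x. \<integral>\<alpha>. norm (case (x, \<alpha>) of (x, \<alpha>) \<Rightarrow> v x * r x * complex_of_real ((gauss (x - \<alpha>))\<^sup>2)) \<partial>lborel)"
        using integrable_norm[OF vr] by (simp add: norm_mult norm_power c0)
      show "AE x in lborel. integrable lborel (\<lambda>\<alpha>. case (x, \<alpha>) of (x, \<alpha>) \<Rightarrow> v x * r x * complex_of_real ((gauss (x - \<alpha>))\<^sup>2))"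
        proof (intro always_eventually allI)
        fix x :: 'a
        have "integrable lborel (\<lambda>\<alpha>. complex_of_real ((gauss (x - \<alpha>))\<^sup>2))"
          using integrable_gauss_square[of x] by (intro integrable_of_real) (simp only: sym[of x])
        then show "integrable lborel (\<lambda>\<alpha>. case (x, \<alpha>) of (x, \<alpha>) \<Rightarrow> v x * r x * complex_of_real ((gauss (x - \<alpha>))\<^sup>2))"
          unfolding prod.case by (rule integrable_mult_right)
      qed
    qed measurable
    have "(\<integral>\<alpha>. J \<alpha> \<partial>lborel) = (\<integral>x. \<integral>\<alpha>. v x * r x * complex_of_real ((gauss (x - \<alpha>))\<^sup>2) \<partial>lborel \<partial>lborel)"
      unfolding J_def by (rule lborel_pair.Fubini_integral[OF int2])
    also have "\<dots> = (\<integral>x. v x * r x * complex_of_real (sqrt pi ^ DIM('a)) \<partial>lborel)"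
    proof (intro Bochner_Integration.integral_cong refl)
      fix x :: 'a
      have "(\<integral>\<alpha>. complex_of_real ((gauss (x - \<alpha>))\<^sup>2) \<partial>lborel) = complex_of_real (\<integral>\<alpha>. (gauss (\<alpha> - x))\<^sup>2 \<partial>lborel)"
        unfolding integral_complex_of_real by (metis gauss_minus minus_diff_eq)
      then show "(\<integral>\<alpha>. v x * r x * complex_of_real ((gauss (x - \<alpha>))\<^sup>2) \<partial>lborel) = v x * r x * complex_of_real (sqrt pi ^ DIM('a))"
        by (simp only: integral_mult_right_zero integral_gauss_square)
    qed
    also have "\<dots> = complex_of_real (sqrt pi ^ DIM('a)) * (\<integral>x. v x * r x \<partial>lborel)"
      by (simp only: integral_mult_left_zero mult.commute)
    finally have Jint: "(\<integral>\<alpha>. J \<alpha> \<partial>lborel) = complex_of_real (sqrt pi ^ DIM('a)) * (\<integral>x. v x * r x \<partial>lborel)" .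
    have "1 * norm (\<integral>x. v x * r x \<partial>lborel) \<le> sqrt pi ^ DIM('a) * norm (\<integral>x. v x * r x \<partial>lborel)"
      using pi_gt3 by (intro mult_right_mono one_le_power) auto
    also have "\<dots> = norm (\<integral>\<alpha>. J \<alpha> \<partial>lborel)"
      unfolding Jint norm_mult norm_of_real by simp
    also have "\<dots> \<le> (C * A * m) * m"
      unfolding m_def
    proof (rule norm_integral_bracket_bound)
      show "J \<in> borel_measurable borel" unfolding J_def by measurable
    qed (use J in \<open>simp add: m_def\<close>)
    finally show "norm (\<integral>x. v x * conj_weyl (a i) cgauss x \<partial>lborel) \<le> C * m * m * A"
      by (simp add: r_def mult_ac)
  qed (intro mult_nonneg_nonneg C m)
qed

section \<open>Linearity and the constant symbol\<close>

lemma dderiv_const: "dderiv vs (\<lambda>_. c) = (\<lambda>_. if vs = [] then c else 0)"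
proof (induction vs)
  case (Cons v vs)
  then show ?case by (simp add: dderiv.simps)
qed (simp add: dderiv.simps)

lemma symbol_family_const: "symbol_family S (\<lambda>i X. c)"
  unfolding symbol_family_def smooth_fun_def dderiv_const
proof (intro conjI ballI allI impI exI[of _ "norm c"])
  fix vs :: "'b list" and X :: 'b
  have "1 \<le> bracket X ^ 2" by (rule one_le_power) simp
  then have "norm c * 1 \<le> norm c * bracket X ^ 2" by (rule mult_left_mono) simp
  then show "norm (if vs = [] then c else 0) \<le> norm c * bracket X ^ 2" by simp
qed simp

lemma conj_weyl_linear:
  fixes a :: "'i \<Rightarrow> 'a::euclidean_space \<times> 'a \<Rightarrow> complex"
  assumes a: "symbol_family S a" "i \<in> S" and b: "symbol_family T b" "j \<in> T" and \<phi>: "hermite \<phi>"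
  shows "conj_weyl (\<lambda>X. c * a i X + d * b j X) \<phi> x = c * conj_weyl (a i) \<phi> x + d * conj_weyl (b j) \<phi> x"
proof -
  have "weyl_integrand (\<lambda>X. c * a i X + d * b j X) \<phi> x \<xi> y = c * weyl_integrand (a i) \<phi> x \<xi> y + d * weyl_integrand (b j) \<phi> x \<xi> y" for \<xi> y
    by (simp add: weyl_integrand_def algebra_simps)
  then have "weyl_inner (\<lambda>X. c * a i X + d * b j X) \<phi> x \<xi> = c * weyl_inner (a i) \<phi> x \<xi> + d * weyl_inner (b j) \<phi> x \<xi>" for \<xi>
    by (simp add: weyl_inner_def weyl_integrand_integrable[OF a(1) \<phi> a(2)] weyl_integrand_integrable[OF b(1) \<phi> b(2)])
  then show ?thesis
    by (simp add: conj_weyl_def weyl_inner_integrable[OF a(1) \<phi> a(2)] weyl_inner_integrable[OF b(1) \<phi> b(2)])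
qed

text \<open>Quantizing the symbol one is Fourier inversion; for the Gaussian this is two explicit
  Fourier integrals, each giving a factor \<open>sqrt (2 * pi) ^ DIM('a)\<close>.\<close>

lemma conj_weyl_one_cgauss: "conj_weyl (\<lambda>X. 1) cgauss (x::'a::euclidean_space) = complex_of_real ((2 * pi) ^ DIM('a)) * cgauss x"
proof -
  have "weyl_inner (\<lambda>X. 1) cgauss x \<xi> = iexp (- (x \<bullet> \<xi>)) * (\<integral>y. iexp (\<xi> \<bullet> y) * cgauss y \<partial>lborel)" for \<xi>
    unfolding weyl_inner_def integral_mult_right_zero[symmetric]
    by (intro Bochner_Integration.integral_cong refl)
       (simp add: weyl_integrand_def inner_diff_left exp_diff exp_minus inner_commute algebra_simps divide_inverse)
  then have weyl_inner: "weyl_inner (\<lambda>X. 1) cgauss x \<xi> = complex_of_real (sqrt (2 * pi) ^ DIM('a)) * (iexp ((- x) \<bullet> \<xi>) * cgauss \<xi>)" for \<xi>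
    unfolding integral_iexp_gauss by simp
  have "conj_weyl (\<lambda>X. 1) cgauss x = complex_of_real (sqrt (2 * pi) ^ DIM('a)) * complex_of_real (sqrt (2 * pi) ^ DIM('a) * gauss (- x))"
    unfolding conj_weyl_def weyl_inner integral_mult_right_zero integral_iexp_gauss ..
  also have "\<dots> = complex_of_real ((sqrt (2 * pi) ^ DIM('a) * sqrt (2 * pi) ^ DIM('a)) * gauss x)"
    by simp
  also have "sqrt (2 * pi) ^ DIM('a) * sqrt (2 * pi) ^ DIM('a) = (2 * pi) ^ DIM('a)"
    by (simp only: power_mult_distrib[symmetric] real_sqrt_mult_self) simp
  finally show ?thesis by simp
qed

section \<open>The rescaled symbol\<close>

lemma frechet_derivative_basis_sum:
  fixes f :: "'a::euclidean_space \<Rightarrow> complex"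
  assumes "f differentiable (at x)"
  shows "frechet_derivative f (at x) v = (\<Sum>b\<in>Basis. complex_of_real (v \<bullet> b) * dderiv [b] f x)"
proof -
  have lin: "linear (frechet_derivative f (at x))"
    using assms by (rule linear_frechet_derivative)
  have "frechet_derivative f (at x) v = frechet_derivative f (at x) (\<Sum>b\<in>Basis. (v \<bullet> b) *\<^sub>R b)"
    by (simp add: euclidean_representation)
  also have "\<dots> = (\<Sum>b\<in>Basis. (v \<bullet> b) *\<^sub>R frechet_derivative f (at x) b)"
    using lin by (simp add: linear_sum linear_cmul)
  finally show ?thesis by (simp add: dderiv_single scaleR_conv_of_real)
qed

lemma norm_frechet_derivative_le:
  fixes f :: "'a::euclidean_space \<Rightarrow> complex"
  assumes "f differentiable (at x)" and "\<And>b. b \<in> Basis \<Longrightarrow> norm (dderiv [b] f x) \<le> M"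
  shows "norm (frechet_derivative f (at x) v) \<le> real DIM('a) * M * norm v"
proof -
  have "norm (frechet_derivative f (at x) v) \<le> (\<Sum>b\<in>(Basis::'a set). norm v * M)"
    unfolding frechet_derivative_basis_sum[OF assms(1)]
    by (intro order_trans[OF norm_sum] sum_mono)
       (auto simp: norm_mult Basis_le_norm intro!: mult_mono assms(2))
  then show ?thesis by (simp add: mult_ac)
qed

lemma norm_diff_le_of_dderiv:
  fixes f :: "'a::euclidean_space \<Rightarrow> complex"
  assumes "smooth_fun f" and M: "\<And>b z. b \<in> Basis \<Longrightarrow> norm z \<le> r \<Longrightarrow> norm (dderiv [b] f z) \<le> M"
    and "norm x \<le> r" "norm y \<le> r"
  shows "norm (f x - f y) \<le> real DIM('a) * M * norm (x - y)"
proof (rule differentiable_bound[of "cball 0 r" f "\<lambda>z. frechet_derivative f (at z)"])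
  fix z :: 'a assume z: "z \<in> cball 0 r"
  show "(f has_derivative frechet_derivative f (at z)) (at z within cball 0 r)"
    using smooth_fun_differentiable[OF assms(1)] by (simp add: frechet_derivative_works has_derivative_at_withinI)
  show "onorm (frechet_derivative f (at z)) \<le> real DIM('a) * M"
    by (rule onorm_le, rule norm_frechet_derivative_le[OF smooth_fun_differentiable[OF assms(1)]])
       (use z M in auto)
qed (use assms in auto)

lemma
  fixes f :: "'a::euclidean_space \<Rightarrow> complex" and s :: real
  assumes f: "smooth_fun f" and vs: "set vs \<subseteq> Basis"
  shows dderiv_affine: "dderiv vs (\<lambda>Y. complex_of_real c * (f (s *\<^sub>R (Y + Z)) - k))
      = (\<lambda>Y. complex_of_real (c * s ^ length vs) * (dderiv vs f (s *\<^sub>R (Y + Z)) - (if vs = [] then k else 0)))" (is "?A vs")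
    and dderiv_affine_differentiable: "dderiv vs (\<lambda>Y. complex_of_real c * (f (s *\<^sub>R (Y + Z)) - k)) differentiable (at Y)" (is "?B vs")
proof -
  have D: "((\<lambda>Y. complex_of_real c' * (g (s *\<^sub>R (Y + Z)) - k')) has_derivative
      (\<lambda>v. complex_of_real c' * frechet_derivative g (at (s *\<^sub>R (Y + Z))) (s *\<^sub>R v))) (at Y)"
    if "smooth_fun g" for c' k' Y and g :: "'a \<Rightarrow> complex"
  proof -
    have 1: "((\<lambda>Y. s *\<^sub>R (Y + Z)) has_derivative (\<lambda>v. s *\<^sub>R v)) (at Y)"
      by (auto intro!: derivative_eq_intros)
    have 2: "(g has_derivative frechet_derivative g (at (s *\<^sub>R (Y + Z)))) (at (s *\<^sub>R (Y + Z)))"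
      using smooth_fun_differentiable[OF that] by (simp add: frechet_derivative_works)
    show ?thesis
      by (rule derivative_eq_intros has_derivative_compose[OF 1 2] refl)+ simp
  qed
  show A: "?A vs" using vs
  proof (induction vs)
    case (Cons v vs)
    have g: "smooth_fun (dderiv vs f)" using Cons.prems f by (intro smooth_fun_dderiv) auto
    have "dderiv (v # vs) (\<lambda>Y. complex_of_real c * (f (s *\<^sub>R (Y + Z)) - k)) = (\<lambda>Y. frechet_derivative
       (\<lambda>Y. complex_of_real (c * s ^ length vs) * (dderiv vs f (s *\<^sub>R (Y + Z)) - (if vs = [] then k else 0))) (at Y) v)"
      using Cons by (simp add: dderiv.simps)
    also have "\<dots> = (\<lambda>Y. complex_of_real (c * s ^ length vs) * frechet_derivative (dderiv vs f) (at (s *\<^sub>R (Y + Z))) (s *\<^sub>R v))"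
      by (intro ext) (subst frechet_derivative_at[OF D[OF g], symmetric], rule refl)
    also have "\<dots> = (\<lambda>Y. complex_of_real (c * s ^ length (v # vs)) * (dderiv (v # vs) f (s *\<^sub>R (Y + Z)) - (if v # vs = [] then k else 0)))"
      by (intro ext) (simp add: dderiv.simps scaleR_conv_of_real linear_cmul[OF linear_frechet_derivative[OF smooth_fun_differentiable[OF g]]])
    finally show ?case .
  qed (simp add: dderiv.simps)
  show "?B vs"
    unfolding A differentiable_def using D[OF smooth_fun_dderiv[OF f vs]] by blast
qed

section \<open>Growth of the symbol and of its derivatives\<close>

context
  fixes p :: "'a::euclidean_space \<Rightarrow> complex"
  assumes p: "standing_symbol p"
begin

lemma p_smooth: "smooth_fun p"
  using p by (simp add: standing_symbol_def)

lemma p_bounded: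
  assumes "set vs \<subseteq> Basis" "length vs \<ge> 2"
  obtains M where "M \<ge> 0" "\<And>X. norm (dderiv vs p X) \<le> M"
proof -
  have "bounded (range (dderiv vs p))" using p assms by (simp add: standing_symbol_def)
  then obtain M where "\<And>X. norm (dderiv vs p X) \<le> M" unfolding bounded_iff by auto
  then show thesis using order_trans[OF norm_ge_zero] by (intro that[of M]) auto
qed

lemma Re_p_zero: "Re (p X) = 0 \<longleftrightarrow> X = 0"
proof -
  have "{X. Re (p X) = 0} = {0}" using p by (simp add: standing_symbol_def)
  then show ?thesis by auto
qed

lemma Re_p_nonneg: "0 \<le> Re (p X)"
  using p by (simp add: standing_symbol_def)

text \<open>For the real part the gradient vanishes because the origin is a minimum; for the
  imaginary part it vanishes by assumption.\<close>

lemma p_critical: "frechet_derivative p (at 0) v = 0"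
proof (rule complex_eqI)
  show "Im (frechet_derivative p (at 0) v) = Im 0" using p by (simp add: standing_symbol_def)
  have "(p has_derivative frechet_derivative p (at 0)) (at 0)"
    using smooth_fun_differentiable[OF p_smooth] by (simp add: frechet_derivative_works)
  then have "((\<lambda>X. Re (p X)) has_derivative (\<lambda>v. Re (frechet_derivative p (at 0) v))) (at 0)"
    by (rule has_derivative_Re)
  then have "(\<lambda>v. Re (frechet_derivative p (at 0) v)) = (\<lambda>v. 0)"
    by (rule has_derivative_local_min) (use Re_p_zero[of 0] Re_p_nonneg in auto)
  then show "Re (frechet_derivative p (at 0) v) = Re 0" by (simp add: fun_eq_iff)
qed

text \<open>The gradient vanishes at the origin and the second derivatives are bounded, so the mean
  value inequality gives linear growth.\<close>

lemma p_gradient_bound: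
  obtains L where "L \<ge> 0" "\<And>b X. b \<in> Basis \<Longrightarrow> norm (dderiv [b] p X) \<le> L * norm X"
proof -
  have "\<exists>M. \<forall>q\<in>(Basis::'a set) \<times> Basis. M q \<ge> 0 \<and> (\<forall>X. norm (dderiv [fst q, snd q] p X) \<le> M q)"
  proof (intro bchoice ballI)
    fix q :: "'a \<times> 'a" assume "q \<in> Basis \<times> Basis"
    then have "set [fst q, snd q] \<subseteq> Basis" by auto
    then obtain M where "M \<ge> 0" "\<And>X. norm (dderiv [fst q, snd q] p X) \<le> M"
      using p_bounded[of "[fst q, snd q]"] by auto
    then show "\<exists>M. M \<ge> 0 \<and> (\<forall>X. norm (dderiv [fst q, snd q] p X) \<le> M)" by blast
  qed
  then obtain M where M: "\<And>b c. b \<in> Basis \<Longrightarrow> c \<in> Basis \<Longrightarrow> M (b, c) \<ge> 0 \<and> (\<forall>X. norm (dderiv [b, c] p X) \<le> M (b, c))"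
    by force
  define K where "K = (\<Sum>q\<in>(Basis::'a set) \<times> Basis. M q)"
  have K0: "K \<ge> 0" unfolding K_def using M by (intro sum_nonneg) auto
  have K: "norm (dderiv [b, c] p X) \<le> K" if "b \<in> Basis" "c \<in> Basis" for b c X
  proof -
    have "M (b, c) \<le> K" unfolding K_def using that M by (intro member_le_sum) auto
    then show ?thesis using M[OF that] order_trans by blast
  qed
  show thesis
  proof (rule that[of "real DIM('a) * K"])
    fix b X :: 'a assume b: "b \<in> Basis"
    have sm: "smooth_fun (dderiv [b] p)" using b by (intro smooth_fun_dderiv p_smooth) auto
    have "norm (dderiv [b] p X - dderiv [b] p 0) \<le> real DIM('a) * K * norm (X - 0)"
      by (rule norm_diff_le_of_dderiv[OF sm, of "norm X"])
         (use K b in \<open>auto simp: dderiv_append[of "[_]" "[_]", symmetric, simplified]\<close>)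
    then show "norm (dderiv [b] p X) \<le> real DIM('a) * K * norm X"
      by (simp add: dderiv_single p_critical)
  qed (use K0 in auto)
qed

text \<open>The symbol \<open>p (sqrt h *\<^sub>R Y) / h\<close>, recentred at \<open>Z\<close>,
  with its value at the centre removed and divided by \<open>bracket Z\<close>. Removing the value
  lowers the size at \<open>Z\<close> from quadratic to linear, and the division makes it uniformly
  bounded in \<open>Z\<close>.\<close>

definition rescaled_symbol :: "real \<times> 'a \<Rightarrow> 'a \<Rightarrow> complex" where
  "rescaled_symbol = (\<lambda>(h, Z) Y. complex_of_real (1 / (h * bracket Z)) * (p (sqrt h *\<^sub>R (Y + Z)) - p (sqrt h *\<^sub>R Z)))"

text \<open>Without derivatives, the mean value inequality brings one factor \<open>sqrt h\<close>
  from the increment and one from the linear growth of the gradient, which cancel the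
  \<open>h\<close> in the denominator. One derivative gives the same two factors. From two
  derivatives on, the chain rule supplies them and any further ones are at most one because
  \<open>h \<le> 1\<close>.\<close>

lemma rescaled_symbol_family: "symbol_family ({0<..1} \<times> UNIV) rescaled_symbol"
  unfolding symbol_family_def
proof (intro conjI ballI allI impI)
  fix i :: "real \<times> 'a" assume "i \<in> {0<..1} \<times> UNIV"
  then show "smooth_fun (rescaled_symbol i)"
    unfolding smooth_fun_def rescaled_symbol_def case_prod_unfold
    using dderiv_affine_differentiable[OF p_smooth] by blast
next
  fix vs :: "'a list" assume vs: "set vs \<subseteq> Basis"
  have "\<exists>C. \<forall>h Z Y. 0 < h \<and> h \<le> 1 \<longrightarrow> norm (dderiv vs (rescaled_symbol (h, Z)) Y) \<le> C * bracket Y ^ 2"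
  proof -
    have eq: "dderiv vs (rescaled_symbol (h, Z)) Y = complex_of_real (1 / (h * bracket Z) * sqrt h ^ length vs) *
      (dderiv vs p (sqrt h *\<^sub>R (Y + Z)) - (if vs = [] then p (sqrt h *\<^sub>R Z) else 0))" for h Z Y
      unfolding rescaled_symbol_def prod.case dderiv_affine[OF p_smooth vs] ..
    obtain L where L: "L \<ge> 0" "\<And>b X. b \<in> Basis \<Longrightarrow> norm (dderiv [b] p X) \<le> L * norm X"
      using p_gradient_bound by blast
    consider "vs = []" | b where "vs = [b]" | "length vs \<ge> 2"
      by (cases vs; cases "tl vs") auto
    then show ?thesis
    proof cases
      case 1
      have "norm (dderiv vs (rescaled_symbol (h, Z)) Y) \<le> (real DIM('a) * L) * bracket Y ^ 2"
        if h: "0 < h" "h \<le> 1" for h Z Y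
      proof -
        define r where "r = sqrt h * (norm Y + norm Z)"
        have r: "norm (sqrt h *\<^sub>R (Y + Z)) \<le> r" "norm (sqrt h *\<^sub>R Z) \<le> r"
          unfolding r_def using h norm_triangle_ineq[of Y Z] by (auto intro!: mult_left_mono)
        have "norm (p (sqrt h *\<^sub>R (Y + Z)) - p (sqrt h *\<^sub>R Z)) \<le> real DIM('a) * (L * r) * norm (sqrt h *\<^sub>R (Y + Z) - sqrt h *\<^sub>R Z)"
          by (rule norm_diff_le_of_dderiv[OF p_smooth _ r]) (use L in \<open>auto intro: order_trans[OF _ mult_left_mono]\<close>)
        also have "sqrt h *\<^sub>R (Y + Z) - sqrt h *\<^sub>R Z = sqrt h *\<^sub>R Y" by (simp add: algebra_simps)
        also have "real DIM('a) * (L * r) * norm (sqrt h *\<^sub>R Y) = real DIM('a) * L * (norm Y + norm Z) * norm Y * (sqrt h * sqrt h)"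
          using h by (simp add: r_def mult_ac)
        also have "sqrt h * sqrt h = h" using h by simp
        also have "real DIM('a) * L * (norm Y + norm Z) * norm Y * h \<le> real DIM('a) * L * (bracket Y * bracket Z) * bracket Y * h"
          using L h by (intro mult_right_mono mult_mono mult_left_mono) (auto simp: algebra_simps)
        finally have "norm (p (sqrt h *\<^sub>R (Y + Z)) - p (sqrt h *\<^sub>R Z)) \<le> (real DIM('a) * L * bracket Y ^ 2) * (h * bracket Z)"
          by (simp add: power2_eq_square mult_ac)
        then have "norm (p (sqrt h *\<^sub>R (Y + Z)) - p (sqrt h *\<^sub>R Z)) / (h * bracket Z) \<le> real DIM('a) * L * bracket Y ^ 2"
          by (subst pos_divide_le_eq) (auto intro!: mult_pos_pos h bracket_pos)
        moreover have "norm (dderiv vs (rescaled_symbol (h, Z)) Y) = norm (p (sqrt h *\<^sub>R (Y + Z)) - p (sqrt h *\<^sub>R Z)) / (h * bracket Z)"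
          unfolding eq norm_mult norm_of_real using 1 h by (simp add: dderiv.simps abs_mult)
        ultimately show ?thesis by simp
      qed
      then show ?thesis by blast
    next
      case (2 b)
      have "norm (dderiv vs (rescaled_symbol (h, Z)) Y) \<le> L * bracket Y ^ 2"
        if h: "0 < h" "h \<le> 1" for h Z Y
      proof -
        have b: "b \<in> Basis" using vs 2 by simp
        have "norm (dderiv vs (rescaled_symbol (h, Z)) Y) = sqrt h * norm (dderiv [b] p (sqrt h *\<^sub>R (Y + Z))) / (h * bracket Z)"
          unfolding eq norm_mult norm_of_real using 2 h by (simp add: abs_mult)
        also have "\<dots> \<le> sqrt h * (L * norm (sqrt h *\<^sub>R (Y + Z))) / (h * bracket Z)"
          by (intro divide_right_mono mult_left_mono L(2)[OF b]) (use h in auto)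
        also have "norm (sqrt h *\<^sub>R (Y + Z)) = sqrt h * norm (Y + Z)"
          using h by simp
        also have "sqrt h * (L * (sqrt h * norm (Y + Z))) / (h * bracket Z) = L * norm (Y + Z) * ((sqrt h * sqrt h) / (h * bracket Z))"
          by (simp only: times_divide_eq_right mult_ac)
        also have "\<dots> = L * (norm (Y + Z) / bracket Z)"
          using h by simp
        also have "\<dots> \<le> L * bracket Y ^ 2"
        proof (intro mult_left_mono L(1))
          have "norm (Y + Z) \<le> bracket Y * bracket Z"
            using norm_triangle_ineq[of Y Z] mult_nonneg_nonneg[of "norm Y" "norm Z"] norm_ge_zero[of Y] norm_ge_zero[of Z]
            unfolding distrib_left distrib_right by linarith
          then have "norm (Y + Z) / bracket Z \<le> bracket Y"
            by (subst pos_divide_le_eq) (auto intro!: bracket_pos)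
          also have "\<dots> \<le> bracket Y ^ 2"
            by (intro self_le_power) auto
          finally show "norm (Y + Z) / bracket Z \<le> bracket Y ^ 2" .
        qed
        finally show ?thesis .
      qed
      then show ?thesis by blast
    next
      case 3
      then obtain l where l: "length vs = 2 + l" using le_Suc_ex by blast
      obtain M where M: "M \<ge> 0" "\<And>X. norm (dderiv vs p X) \<le> M"
        using p_bounded[OF vs 3] by blast
      have "norm (dderiv vs (rescaled_symbol (h, Z)) Y) \<le> M * bracket Y ^ 2"
        if h: "0 < h" "h \<le> 1" for h Z Y
      proof -
        have "1 / (h * bracket Z) * sqrt h ^ length vs = sqrt h ^ l / bracket Z"
          using h unfolding l power_add by simp
        also have "\<dots> \<le> 1 / 1"
          using h by (intro frac_le power_le_one) auto
        finally have 1: "1 / (h * bracket Z) * sqrt h ^ length vs \<le> 1" by simp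
        have "norm (dderiv vs (rescaled_symbol (h, Z)) Y) = \<bar>1 / (h * bracket Z) * sqrt h ^ length vs\<bar> * norm (dderiv vs p (sqrt h *\<^sub>R (Y + Z)))"
          unfolding eq norm_mult norm_of_real using 3 by auto
        also have "\<dots> \<le> 1 * M"
          using 1 h bracket_pos[of Z] M by (intro mult_mono) (auto simp: abs_of_nonneg simp del: mult_le_cancel_right1)
        also have "\<dots> \<le> M * bracket Y ^ 2"
          using M(1) mult_left_mono[OF one_le_power[of "bracket Y" 2] M(1)] by simp
        finally show ?thesis .
      qed
      then show ?thesis by blast
    qed
  qed
  then obtain C where "\<And>h Z Y. 0 < h \<Longrightarrow> h \<le> 1 \<Longrightarrow> norm (dderiv vs (rescaled_symbol (h, Z)) Y) \<le> C * bracket Y ^ 2"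
    by blast
  then show "\<exists>C. \<forall>i\<in>{0<..1} \<times> UNIV. \<forall>Y. norm (dderiv vs (rescaled_symbol i) Y) \<le> C * bracket Y ^ 2"
    by (intro exI[of _ C] ballI allI) (auto simp: mem_Times_iff)
qed

section \<open>Ellipticity of the real part\<close>

definition hess :: "'a \<Rightarrow> 'a \<Rightarrow> real" where
  "hess Y X = (\<Sum>i\<in>Basis. \<Sum>j\<in>Basis. (X \<bullet> i) * (X \<bullet> j) * Re (dderiv [i, j] p Y))"

text \<open>The assumption on the quadratic part concerns two derivatives along an arbitrary
  \<open>X\<close>; expanding both in the basis identifies it with the coordinate form, which is
  continuous in the base point.\<close>

lemma hess_zero_pos: "X \<noteq> 0 \<Longrightarrow> 0 < hess 0 X"
proof -
  assume X: "X \<noteq> 0"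
  have e: "dderiv [X] p = (\<lambda>Y. \<Sum>j\<in>Basis. complex_of_real (X \<bullet> j) * dderiv [j] p Y)"
    by (intro ext, subst dderiv_single) (rule frechet_derivative_basis_sum[OF smooth_fun_differentiable[OF p_smooth]])
  have d: "(dderiv [j] p has_derivative frechet_derivative (dderiv [j] p) (at 0)) (at 0)" if "j \<in> Basis" for j
    using smooth_fun_differentiable[OF smooth_fun_dderiv[OF p_smooth, of "[j]"]] that
    by (simp add: frechet_derivative_works)
  have D: "((\<lambda>Y. \<Sum>j\<in>Basis. complex_of_real (X \<bullet> j) * dderiv [j] p Y) has_derivative
      (\<lambda>v. \<Sum>j\<in>Basis. complex_of_real (X \<bullet> j) * frechet_derivative (dderiv [j] p) (at 0) v)) (at 0)"
    by (intro has_derivative_sum has_derivative_mult_right d)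
  have "dderiv [X, X] p 0 = frechet_derivative (dderiv [X] p) (at 0) X"
    by (simp add: dderiv.simps)
  also have "\<dots> = (\<Sum>j\<in>Basis. complex_of_real (X \<bullet> j) * frechet_derivative (dderiv [j] p) (at 0) X)"
    unfolding e frechet_derivative_at[OF D, symmetric] ..
  also have "\<dots> = (\<Sum>j\<in>Basis. complex_of_real (X \<bullet> j) * (\<Sum>i\<in>Basis. complex_of_real (X \<bullet> i) * dderiv [i, j] p 0))"
  proof (intro sum.cong refl arg_cong2[of _ _ _ _ "(*)"])
    fix j :: 'a assume j: "j \<in> Basis"
    have "dderiv [j] p differentiable at 0"
      using smooth_fun_differentiable[OF smooth_fun_dderiv[OF p_smooth, of "[j]"]] j by simp
    have "dderiv [i, j] p = dderiv [i] (dderiv [j] p)" for i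
      using dderiv_append[of "[i]" "[j]" p] by simp
    then show "frechet_derivative (dderiv [j] p) (at 0) X = (\<Sum>i\<in>Basis. complex_of_real (X \<bullet> i) * dderiv [i, j] p 0)"
      using frechet_derivative_basis_sum[OF \<open>dderiv [j] p differentiable at 0\<close>, of X] by (simp only:)
  qed
  finally have "Re (dderiv [X, X] p 0) = (\<Sum>j\<in>Basis. \<Sum>i\<in>Basis. (X \<bullet> j) * ((X \<bullet> i) * Re (dderiv [i, j] p 0)))"
    by (simp add: sum_distrib_left)
  also have "\<dots> = hess 0 X"
    unfolding hess_def by (subst sum.swap) (simp add: mult_ac)
  finally have "hess 0 X = Re (dderiv [X, X] p 0)" ..
  moreover have "Re ((1/2) * dderiv [X, X] p 0) > 0"
    using p X unfolding standing_symbol_def by blast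
  ultimately show ?thesis by simp
qed

lemma hess_scale: "hess Y (c *\<^sub>R X) = c\<^sup>2 * hess Y X"
  by (simp add: hess_def sum_distrib_left power2_eq_square mult_ac)

lemma dderiv_p_continuous:
  assumes "set vs \<subseteq> Basis"
  shows "continuous_on UNIV (dderiv vs p)"
  by (intro smooth_fun_continuous smooth_fun_dderiv p_smooth assms)

lemma continuous_on_hess: "continuous_on UNIV (\<lambda>q. hess (fst q) (snd q))"
  unfolding hess_def
  by (intro continuous_intros continuous_on_compose2[OF dderiv_p_continuous]) auto

text \<open>Positivity at the origin is uniform on the unit sphere by compactness, persists for
  nearby base points by uniform continuity, and extends to all vectors by homogeneity.\<close>

lemma hess_near_zero:
  obtains c \<delta> where "c > 0" "\<delta> > 0" "\<And>Y X. norm Y \<le> \<delta> \<Longrightarrow> c * (norm X)\<^sup>2 \<le> hess Y X"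
proof -
  let ?S = "sphere (0::'a) 1"
  have "\<exists>z\<in>?S. \<forall>X\<in>?S. hess 0 z \<le> hess 0 X"
  proof (rule continuous_attains_inf)
    show "?S \<noteq> {}" by simp
    show "continuous_on ?S (hess 0)"
      using continuous_on_compose2[OF continuous_on_hess continuous_on_Pair[OF continuous_on_const continuous_on_id]] by simp
  qed simp
  then obtain z where z: "norm z = 1" "\<And>X. norm X = 1 \<Longrightarrow> hess 0 z \<le> hess 0 X" by auto
  \<comment> \<open>Half of the minimum over the sphere is kept; the other half pays for moving the
    base point.\<close>
  define c where "c = hess 0 z / 2"
  have c: "c > 0" unfolding c_def using hess_zero_pos[of z] z by force
  have "uniformly_continuous_on (cball 0 1 \<times> ?S) (\<lambda>q. hess (fst q) (snd q))"
    by (intro compact_uniformly_continuous continuous_on_subset[OF continuous_on_hess] compact_Times) auto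
  then obtain d where d: "d > 0" "\<And>q q'. q \<in> cball 0 1 \<times> ?S \<Longrightarrow> q' \<in> cball 0 1 \<times> ?S \<Longrightarrow> dist q' q < d \<Longrightarrow>
      dist (hess (fst q') (snd q')) (hess (fst q) (snd q)) < c"
    unfolding uniformly_continuous_on_def using c by metis
  define \<delta> where "\<delta> = min 1 (d / 2)"
  show thesis
  proof (rule that[OF c])
    show "\<delta> > 0" using d by (simp add: \<delta>_def)
    fix Y X :: 'a assume Y: "norm Y \<le> \<delta>"
    have unit: "c \<le> hess Y U" if U: "norm U = 1" for U
    proof -
      have "dist (Y, U) (0, U) < d" using Y d(1) by (simp add: dist_Pair_Pair \<delta>_def)
      then have "dist (hess Y U) (hess 0 U) < c"
        using d(2)[of "(0, U)" "(Y, U)"] Y U by (simp add: \<delta>_def)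
      then show ?thesis using z(2)[OF U] unfolding dist_real_def c_def by linarith
    qed
    show "c * (norm X)\<^sup>2 \<le> hess Y X"
    proof (cases "X = 0")
      case True
      then show ?thesis by (simp add: hess_def)
    next
      case False
      then have "hess Y X = (norm X)\<^sup>2 * hess Y (X /\<^sub>R norm X)"
        by (simp add: hess_scale[symmetric] del: scaleR_scaleR) (simp add: hess_scale power2_eq_square)
      moreover have "c * (norm X)\<^sup>2 \<le> hess Y (X /\<^sub>R norm X) * (norm X)\<^sup>2"
        using False by (intro mult_right_mono unit) auto
      ultimately show ?thesis by (simp add: mult.commute)
    qed
  qed
qed

text \<open>Second order Taylor expansion along the segment from the origin: value and first
  derivative vanish there, and the remainder is half the Hessian at an intermediate point, which is
  still near the origin.\<close>

lemma Re_p_near_zero: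
  obtains c \<delta> where "c > 0" "\<delta> > 0" "\<And>X. norm X \<le> \<delta> \<Longrightarrow> c * (norm X)\<^sup>2 \<le> Re (p X)"
proof -
  obtain c \<delta> where c: "c > 0" "\<delta> > 0" "\<And>Y X. norm Y \<le> \<delta> \<Longrightarrow> c * (norm X)\<^sup>2 \<le> hess Y X"
    using hess_near_zero by blast
  show thesis
  proof (rule that[of "c / 2" \<delta>])
    fix X :: 'a assume X: "norm X \<le> \<delta>"
    \<comment> \<open>The value and the first two derivatives along the segment, indexed as the
      Maclaurin formula expects them.\<close>
    define diff where "diff m t = (if m = 0 then Re (p (t *\<^sub>R X)) else if m = 1 then \<Sum>j\<in>Basis. (X \<bullet> j) * Re (dderiv [j] p (t *\<^sub>R X))
       else hess (t *\<^sub>R X) X)" for m :: nat and t :: real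
    have line: "((\<lambda>t. Re (f (t *\<^sub>R X))) has_real_derivative (\<Sum>i\<in>Basis. (X \<bullet> i) * Re (dderiv [i] f (t *\<^sub>R X)))) (at t)"
      if f: "smooth_fun f" for f t
    proof -
      have "((\<lambda>t. t *\<^sub>R X) has_vector_derivative X) (at t)"
        by (auto intro!: derivative_eq_intros)
      from smooth_fun_has_vector_derivative[OF f this]
      have "((\<lambda>t. f (t *\<^sub>R X)) has_vector_derivative (\<Sum>i\<in>Basis. complex_of_real (X \<bullet> i) * dderiv [i] f (t *\<^sub>R X))) (at t)"
        unfolding frechet_derivative_basis_sum[OF smooth_fun_differentiable[OF f]] .
      from bounded_linear.has_vector_derivative[OF bounded_linear_Re this] show ?thesis
        by (simp add: has_real_derivative_iff_has_vector_derivative)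
    qed
    have D0: "(diff 0 has_real_derivative diff 1 t) (at t)" for t
      unfolding diff_def using line[OF p_smooth] by simp
    have D1: "(diff 1 has_real_derivative diff 2 t) (at t)" for t
    proof -
      have "((\<lambda>t. \<Sum>j\<in>Basis. (X \<bullet> j) * Re (dderiv [j] p (t *\<^sub>R X))) has_real_derivative
         (\<Sum>j\<in>Basis. (X \<bullet> j) * (\<Sum>i\<in>Basis. (X \<bullet> i) * Re (dderiv [i] (dderiv [j] p) (t *\<^sub>R X))))) (at t)"
        by (intro DERIV_sum DERIV_cmult line smooth_fun_dderiv p_smooth) auto
      also have "(\<Sum>j\<in>Basis. (X \<bullet> j) * (\<Sum>i\<in>Basis. (X \<bullet> i) * Re (dderiv [i] (dderiv [j] p) (t *\<^sub>R X)))) = hess (t *\<^sub>R X) X"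
        unfolding hess_def sum_distrib_left by (subst sum.swap) (simp add: dderiv.simps mult_ac)
      finally show ?thesis by (simp add: diff_def[abs_def])
    qed
    have "\<exists>t. 0 < t \<and> t < 1 \<and> diff 0 1 = (\<Sum>m<2. diff m 0 / fact m * 1 ^ m) + diff 2 t / fact 2 * 1 ^ 2"
    proof (rule Maclaurin)
      show "\<forall>m t. m < 2 \<and> 0 \<le> t \<and> t \<le> 1 \<longrightarrow> (diff m has_real_derivative diff (Suc m) t) (at t)"
      proof (intro allI impI)
        fix m :: nat and t :: real assume "m < 2 \<and> 0 \<le> t \<and> t \<le> 1"
        then have "m = 0 \<or> m = 1" by auto
        then show "(diff m has_real_derivative diff (Suc m) t) (at t)"
          using D0[of t] D1[of t] by (auto simp: numeral_2_eq_2)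
      qed
    qed auto
    then obtain t where t: "0 < t" "t < 1" "diff 0 1 = (\<Sum>m<2. diff m 0 / fact m) + diff 2 t / 2" by auto
    have "diff 1 0 = 0" "diff 0 0 = 0"
      using p_critical Re_p_zero[of 0] by (simp_all add: diff_def dderiv_single)
    then have "Re (p X) = hess (t *\<^sub>R X) X / 2"
      using t(3) by (simp add: diff_def numeral_2_eq_2)
    moreover have "norm (t *\<^sub>R X) \<le> \<delta>"
      using t X mult_right_mono[of t 1 "norm X"] by auto
    then have "c * (norm X)\<^sup>2 \<le> hess (t *\<^sub>R X) X" by (rule c(3))
    ultimately show "c / 2 * (norm X)\<^sup>2 \<le> Re (p X)" by simp
  qed (use c in auto)
qed

text \<open>Three zones: the quadratic lower bound near the origin, the growth assumption at
  infinity, and in between a compact set on which the real part is positive and attains its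
  minimum.\<close>

lemma Re_p_elliptic:
  obtains c where "c > 0" "\<And>X. c * (norm X)\<^sup>2 \<le> Re (p X)"
proof -
  obtain c \<delta> where c: "c > 0" "\<delta> > 0" "\<And>X. norm X \<le> \<delta> \<Longrightarrow> c * (norm X)\<^sup>2 \<le> Re (p X)"
    using Re_p_near_zero by blast
  obtain R where R: "R > 1" "\<And>X. norm X \<ge> R \<Longrightarrow> (1 + (norm X)\<^sup>2) / R \<le> Re (p X)"
    using p unfolding standing_symbol_def by auto
  define A where "A = cball (0::'a) R - ball 0 \<delta>"
  have A: "compact A" unfolding A_def by (intro compact_diff) auto
  \<comment> \<open>The intermediate zone is empty when the outer radius is smaller than the inner
    one; any positive \<open>m\<close> then serves.\<close>
  have "\<exists>m>0. \<forall>X\<in>A. m \<le> Re (p X)"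
  proof (cases "A = {}")
    case False
    have "continuous_on A (\<lambda>X. Re (p X))"
      using continuous_on_subset[OF smooth_fun_continuous[OF p_smooth]] by (intro continuous_intros) auto
    from continuous_attains_inf[OF A False this]
    obtain Y where Y: "Y \<in> A" "\<And>X. X \<in> A \<Longrightarrow> Re (p Y) \<le> Re (p X)" by auto
    have "Y \<noteq> 0" using Y(1) c(2) by (auto simp: A_def)
    then have "Re (p Y) > 0" using Re_p_zero[of Y] Re_p_nonneg[of Y] by linarith
    then show ?thesis using Y by blast
  qed (auto intro: exI[of _ 1])
  then obtain m where m: "m > 0" "\<And>X. X \<in> A \<Longrightarrow> m \<le> Re (p X)" by blast
  \<comment> \<open>One entry per zone; in the middle zone \<open>norm X < R\<close>, so the minimum
    \<open>m\<close> is spread over \<open>R\<^sup>2\<close>.\<close>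
  define k where "k = min c (min (m / R\<^sup>2) (1 / R))"
  show thesis
  proof (rule that[of k])
    show "k > 0" using c m R by (simp add: k_def)
    fix X :: 'a
    consider "norm X \<le> \<delta>" | "norm X \<ge> R" | "\<delta> < norm X" "norm X < R" by linarith
    then show "k * (norm X)\<^sup>2 \<le> Re (p X)"
    proof cases
      case 1
      have "k * (norm X)\<^sup>2 \<le> c * (norm X)\<^sup>2" by (intro mult_right_mono) (auto simp: k_def)
      with c(3)[OF 1] show ?thesis by simp
    next
      case 2
      have "k * (norm X)\<^sup>2 \<le> 1 / R * (norm X)\<^sup>2" by (intro mult_right_mono) (auto simp: k_def)
      also have "\<dots> \<le> (1 + (norm X)\<^sup>2) / R" using R by (simp add: divide_right_mono)
      finally show ?thesis using R(2)[OF 2] by simp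
    next
      case 3
      have "k * (norm X)\<^sup>2 \<le> m / R\<^sup>2 * R\<^sup>2"
        using 3 m(1) R(1) by (intro mult_mono power_mono) (auto simp: k_def)
      then have "k * (norm X)\<^sup>2 \<le> m" using R(1) by simp
      moreover have "X \<in> A" using 3 by (simp add: A_def)
      ultimately show ?thesis using m(2) by force
    qed
  qed
qed

end

section \<open>Bootstrap for the windowed Fourier transform\<close>

text \<open>A phase space translation carrying \<open>(\<alpha>, \<beta>)\<close> to the origin. The
  phase is taken at \<open>x + \<alpha>\<close> so that \<open>gabor v \<alpha> \<beta>\<close> is
  exactly the integral of \<open>modulate \<alpha> \<beta> v\<close> against the standard Gaussian,
  without a further phase.\<close>

definition modulate :: "'a::euclidean_space \<Rightarrow> 'a \<Rightarrow> ('a \<Rightarrow> complex) \<Rightarrow> 'a \<Rightarrow> complex" where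
  "modulate \<alpha> \<beta> v x = v (x + \<alpha>) * iexp (- (\<beta> \<bullet> (x + \<alpha>)))"

lemma borel_measurable_modulate [measurable]:
  assumes [measurable]: "v \<in> borel_measurable borel"
  shows "modulate \<alpha> \<beta> v \<in> borel_measurable borel"
  unfolding modulate_def by measurable

lemma modulate_square:
  fixes v :: "'a::euclidean_space \<Rightarrow> complex"
  assumes v: "v \<in> borel_measurable borel" "integrable lborel (\<lambda>x. (norm (v x))\<^sup>2)"
  shows "integrable lborel (\<lambda>x. (norm (modulate \<alpha> \<beta> v x))\<^sup>2)"
  using v lborel_integrable_translate_iff[of "\<lambda>x. (norm (v x))\<^sup>2" \<alpha>]
  by (simp add: modulate_def norm_mult)

text \<open>Covariance under phase space translations. The extra factor has modulus one, so bounds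
  for \<open>v\<close> around \<open>(\<alpha>, \<beta>)\<close> become bounds for the modulated
  function around the origin.\<close>

lemma gabor_modulate:
  fixes v :: "'a::euclidean_space \<Rightarrow> complex"
  assumes [measurable]: "v \<in> borel_measurable borel"
  shows "gabor v (\<alpha> + \<alpha>') (\<beta> + \<beta>') = iexp (- (\<beta>' \<bullet> \<alpha>)) * gabor (modulate \<alpha> \<beta> v) \<alpha>' \<beta>'"
proof -
  have "gabor v (\<alpha> + \<alpha>') (\<beta> + \<beta>') = (\<integral>x. iexp (- ((\<beta> + \<beta>') \<bullet> (x + \<alpha>))) * (v (x + \<alpha>) * cgauss (x + \<alpha> - (\<alpha> + \<alpha>'))) \<partial>lborel)"
    unfolding gabor_def FT_def
    using lborel_integral_translate[of "\<lambda>x. iexp (- ((\<beta> + \<beta>') \<bullet> x)) * (v x * cgauss (x - (\<alpha> + \<alpha>')))" \<alpha>] by simp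
  also have "\<dots> = (\<integral>x. iexp (- (\<beta>' \<bullet> \<alpha>)) * (iexp (- (\<beta>' \<bullet> x)) * (modulate \<alpha> \<beta> v x * cgauss (x - \<alpha>'))) \<partial>lborel)"
    by (intro Bochner_Integration.integral_cong refl)
       (simp add: modulate_def inner_add_left inner_add_right exp_diff exp_minus field_simps exp_add)
  finally show ?thesis unfolding gabor_def FT_def by simp
qed

lemma bracket_Pair_le: "bracket (x, y) \<le> bracket x * bracket y"
proof -
  have "bracket (x, y) \<le> 1 + norm x + norm y" using norm_Pair_le[of x y] by simp
  also have "\<dots> \<le> bracket x * bracket y" by (simp add: algebra_simps)
  finally show ?thesis .
qed

context
  fixes p :: "'a::euclidean_space \<times> 'a \<Rightarrow> complex" and C :: real
  assumes p: "standing_symbol p" and C: "C > 0"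
begin

text \<open>The eigenvalue equation for the rescaled function \<open>v x = h powr (n/4) * u (sqrt h * x)\<close>,
  tested against coherent states; \<open>h * \<mu>\<close> is the eigenvalue.\<close>
definition admissible :: "real \<Rightarrow> complex \<Rightarrow> ('a \<Rightarrow> complex) \<Rightarrow> bool" where
  "admissible h \<mu> v \<longleftrightarrow> 0 < h \<and> h \<le> 1 \<and> norm \<mu> < C \<and> v \<in> borel_measurable borel \<and>
     integrable lborel (\<lambda>x. (norm (v x))\<^sup>2) \<and> (\<integral>x. (norm (v x))\<^sup>2 \<partial>lborel) = 1 \<and>
     (\<forall>\<alpha> \<beta>. (\<integral>x. modulate \<alpha> \<beta> v x * conj_weyl (\<lambda>Y. p (sqrt h *\<^sub>R (Y + (\<alpha>, \<beta>)))) cgauss x \<partial>lborel)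
        = complex_of_real ((2 * pi) ^ DIM('a)) * (complex_of_real h * \<mu>) * gabor v \<alpha> \<beta>)"

lemma conj_weyl_translated_symbol:
  assumes h: "0 < h" "h \<le> 1"
  shows "conj_weyl (\<lambda>Y. p (sqrt h *\<^sub>R (Y + Z))) cgauss x = complex_of_real (h * bracket Z) * conj_weyl (rescaled_symbol p (h, Z)) cgauss x
      + p (sqrt h *\<^sub>R Z) * (complex_of_real ((2 * pi) ^ DIM('a)) * cgauss x)"
proof -
  have hZ: "(h, Z) \<in> {0<..1} \<times> UNIV" using h by auto
  have ne: "complex_of_real (h * bracket Z) \<noteq> 0"
    unfolding of_real_eq_0_iff using h bracket_pos[of Z] by (metis less_irrefl mult_pos_pos)
  have dec: "p (sqrt h *\<^sub>R (Y + Z)) = complex_of_real (h * bracket Z) * rescaled_symbol p (h, Z) Y + p (sqrt h *\<^sub>R Z) * 1" for Y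
    unfolding rescaled_symbol_def[OF p] prod.case of_real_divide using ne by simp
  show ?thesis
    unfolding dec
    using conj_weyl_linear[OF rescaled_symbol_family[OF p] hZ symbol_family_const[of UNIV 1] UNIV_I hermite_gauss,
        of "complex_of_real (h * bracket Z)" "p (sqrt h *\<^sub>R Z)" x]
    by (simp only: conj_weyl_one_cgauss)
qed

lemma conj_weyl_translated_symbol_measurable:
  assumes h: "0 < h" "h \<le> 1"
  shows "conj_weyl (\<lambda>Y. p (sqrt h *\<^sub>R (Y + Z))) cgauss \<in> borel_measurable borel"
proof -
  have "(h, Z) \<in> {0<..1} \<times> UNIV" using h by auto
  note [measurable] = conj_weyl_measurable[OF rescaled_symbol_family[OF p] hermite_gauss this]
  have "conj_weyl (\<lambda>Y. p (sqrt h *\<^sub>R (Y + Z))) cgauss = (\<lambda>x. complex_of_real (h * bracket Z) * conj_weyl (rescaled_symbol p (h, Z)) cgauss x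
      + p (sqrt h *\<^sub>R Z) * (complex_of_real ((2 * pi) ^ DIM('a)) * cgauss x))"
    by (intro ext conj_weyl_translated_symbol h)
  then show ?thesis by simp
qed

lemma admissible_identity:
  assumes adm: "admissible h \<mu> v"
  shows "complex_of_real ((2 * pi) ^ DIM('a)) * (\<mu> - p (sqrt h *\<^sub>R (\<alpha>, \<beta>)) / complex_of_real h) * gabor v \<alpha> \<beta>
    = complex_of_real (bracket (\<alpha>, \<beta>)) * (\<integral>x. modulate \<alpha> \<beta> v x * conj_weyl (rescaled_symbol p (h, (\<alpha>, \<beta>))) cgauss x \<partial>lborel)"
proof -
  let ?Z = "(\<alpha>, \<beta>)" and ?c = "complex_of_real ((2 * pi) ^ DIM('a))"
  note fam = rescaled_symbol_family[OF p]
  have h: "0 < h" "h \<le> 1" and vm [measurable]: "v \<in> borel_measurable borel" and v2: "integrable lborel (\<lambda>x. (norm (v x))\<^sup>2)"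
    and E: "(\<integral>x. modulate \<alpha> \<beta> v x * conj_weyl (\<lambda>Y. p (sqrt h *\<^sub>R (Y + ?Z))) cgauss x \<partial>lborel)
        = ?c * (complex_of_real h * \<mu>) * gabor v \<alpha> \<beta>"
    using adm by (auto simp: admissible_def)
  have hZ: "(h, ?Z) \<in> {0<..1} \<times> UNIV" using h by auto
  note conj_weyl = conj_weyl_translated_symbol[OF h, of ?Z]
  have int1: "integrable lborel (\<lambda>x. modulate \<alpha> \<beta> v x * conj_weyl (rescaled_symbol p (h, ?Z)) cgauss x)"
  proof (rule integrable_mult_of_squares)
    obtain B where B: "B \<ge> 0" "\<And>x. norm (conj_weyl (rescaled_symbol p (h, ?Z)) cgauss x) \<le> B / bracket x ^ DIM('a)"
      using conj_weyl_decay[OF fam hermite_gauss, of "DIM('a)"] hZ by metis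
    note [measurable] = conj_weyl_measurable[OF fam hermite_gauss hZ]
    show "integrable lborel (\<lambda>x. (norm (conj_weyl (rescaled_symbol p (h, ?Z)) cgauss x))\<^sup>2)"
    proof (rule Bochner_Integration.integrable_bound)
      show "integrable lborel (\<lambda>x::'a. B\<^sup>2 * (1 / bracket x ^ (2 * DIM('a))))"
        by (intro integrable_mult_right integrable_bracket_power) simp
      have "(norm (conj_weyl (rescaled_symbol p (h, ?Z)) cgauss x))\<^sup>2 \<le> B\<^sup>2 * (1 / bracket x ^ (2 * DIM('a)))" for x
        using power_mono[OF B(2)[of x] norm_ge_zero, of 2] by (simp add: power_divide power_mult[symmetric] mult.commute)
      then show "AE x in lborel. norm ((norm (conj_weyl (rescaled_symbol p (h, ?Z)) cgauss x))\<^sup>2) \<le> norm (B\<^sup>2 * (1 / bracket x ^ (2 * DIM('a))))"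
        by simp
    qed measurable
  qed (use modulate_square[OF vm v2] conj_weyl_measurable[OF fam hermite_gauss hZ] in auto)
  have int2: "integrable lborel (\<lambda>x. modulate \<alpha> \<beta> v x * cgauss x)"
    using window_integrable[of "modulate \<alpha> \<beta> v" 0] modulate_square[OF vm v2] by simp
  have V: "(\<integral>x. modulate \<alpha> \<beta> v x * cgauss x \<partial>lborel) = gabor v \<alpha> \<beta>"
    using gabor_modulate[OF vm, of \<alpha> 0 \<beta> 0] by (simp add: gabor_def FT_def)
  let ?J = "\<integral>x. modulate \<alpha> \<beta> v x * conj_weyl (rescaled_symbol p (h, ?Z)) cgauss x \<partial>lborel"
  have "?c * (complex_of_real h * \<mu>) * gabor v \<alpha> \<beta> = (\<integral>x. complex_of_real (h * bracket ?Z) * (modulate \<alpha> \<beta> v x * conj_weyl (rescaled_symbol p (h, ?Z)) cgauss x)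
      + p (sqrt h *\<^sub>R ?Z) * ?c * (modulate \<alpha> \<beta> v x * cgauss x) \<partial>lborel)"
    unfolding E[symmetric] conj_weyl by (intro Bochner_Integration.integral_cong refl) (simp only: distrib_left mult_ac)
  also have "\<dots> = complex_of_real (h * bracket ?Z) * ?J + p (sqrt h *\<^sub>R ?Z) * ?c * gabor v \<alpha> \<beta>"
    unfolding V[symmetric] using int1 int2 by (subst Bochner_Integration.integral_add) (simp_all add: mult.assoc)
  finally have "?c * (complex_of_real h * \<mu>) * gabor v \<alpha> \<beta> = complex_of_real (h * bracket ?Z) * ?J + p (sqrt h *\<^sub>R ?Z) * ?c * gabor v \<alpha> \<beta>" .
  then have "complex_of_real h * (?c * \<mu> * gabor v \<alpha> \<beta>) = complex_of_real h * (complex_of_real (bracket ?Z) * ?J) + p (sqrt h *\<^sub>R ?Z) * ?c * gabor v \<alpha> \<beta>"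
    by (simp only: of_real_mult mult_ac)
  moreover have "complex_of_real h \<noteq> 0" using h by simp
  ultimately have "?c * \<mu> * gabor v \<alpha> \<beta> = complex_of_real (bracket ?Z) * ?J + p (sqrt h *\<^sub>R ?Z) / complex_of_real h * ?c * gabor v \<alpha> \<beta>"
    by (simp add: field_simps)
  then show ?thesis by (simp only: left_diff_distrib right_diff_distrib) (simp add: mult_ac)
qed

lemma admissible_bound:
  assumes "admissible h \<mu> v"
  shows "norm (gabor v \<alpha> \<beta>) \<le> 1 + sqrt pi ^ DIM('a)"
  using gabor_bound[of v \<alpha> \<beta>] assms by (auto simp: admissible_def)

text \<open>Ellipticity gains two powers of the bracket and the derivatives of the symbol cost one.\<close>
lemma admissible_decay:
  "\<exists>A\<ge>0. \<forall>h \<mu> v \<alpha> \<beta>. admissible h \<mu> v \<longrightarrow> norm (gabor v \<alpha> \<beta>) \<le> A / bracket (\<alpha>, \<beta>) ^ k"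
proof (induction k)
  case 0
  show ?case
    using admissible_bound by (intro exI[of _ "1 + sqrt pi ^ DIM('a)"]) auto
next
  case (Suc k)
  then obtain A where A: "A \<ge> 0" "\<And>h \<mu> v \<alpha> \<beta>. admissible h \<mu> v \<Longrightarrow> norm (gabor v \<alpha> \<beta>) \<le> A / bracket (\<alpha>, \<beta>) ^ k"
    by blast
  obtain c where c: "c > 0" "\<And>X. c * (norm X)\<^sup>2 \<le> Re (p X)"
    using Re_p_elliptic[OF p] by blast
  obtain D where D: "D \<ge> 0" "\<And>i v A. i \<in> {0<..1} \<times> UNIV \<Longrightarrow> v \<in> borel_measurable borel \<Longrightarrow> integrable lborel (\<lambda>x. (norm (v x))\<^sup>2) \<Longrightarrow>
    (\<And>\<alpha> \<beta>. norm (gabor v \<alpha> \<beta>) \<le> A * bracket \<alpha> ^ k * bracket \<beta> ^ k) \<Longrightarrow>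
    norm (\<integral>x. v x * conj_weyl (rescaled_symbol p i) cgauss x \<partial>lborel) \<le> D * A"
    using conj_weyl_pairing_bound[OF rescaled_symbol_family[OF p], of k] by blast
  \<comment> \<open>Beyond this radius \<open>c * (norm Z)\<^sup>2 \<ge> 2 * C\<close>, so the
    eigenvalue takes away at most half of the elliptic lower bound; the summand one also gives
    \<open>bracket Z \<le> 2 * norm Z\<close> there.\<close>
  define R where "R = 1 + 2 * C / c"
  have R: "R \<ge> 1" unfolding R_def using C c by simp
  \<comment> \<open>The first summand covers the ball of radius \<open>R\<close>, where boundedness
    suffices; the second is the constant gained outside it.\<close>
  define A' where "A' = (1 + sqrt pi ^ DIM('a)) * (1 + R) ^ Suc k + 8 / c * D * A"
  have A'1: "(1 + sqrt pi ^ DIM('a)) * (1 + R) ^ Suc k \<le> A'" "8 / c * D * A \<le> A'"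
    unfolding A'_def using c D A R by auto
  have A'0: "0 \<le> A'" using A'1(2) c D A by (meson divide_nonneg_pos mult_nonneg_nonneg order_trans zero_le_numeral)
  have "norm (gabor v \<alpha> \<beta>) \<le> A' / bracket (\<alpha>, \<beta>) ^ Suc k" if adm: "admissible h \<mu> v" for h \<mu> v \<alpha> \<beta>
  proof -
    let ?Z = "(\<alpha>, \<beta>)"
    have bp: "0 < bracket ?Z ^ j" for j by (intro zero_less_power bracket_pos)
    have h: "0 < h" "h \<le> 1" and \<mu>: "norm \<mu> < C" and vm: "v \<in> borel_measurable borel" and v2: "integrable lborel (\<lambda>x. (norm (v x))\<^sup>2)"
      using adm by (auto simp: admissible_def)
    show ?thesis
    proof (cases "norm ?Z < R")
      case True
      have "norm (gabor v \<alpha> \<beta>) * bracket ?Z ^ Suc k \<le> (1 + sqrt pi ^ DIM('a)) * (1 + R) ^ Suc k"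
        using True by (intro mult_mono power_mono admissible_bound[OF adm]) auto
      also note A'1(1)
      finally show ?thesis using bp by (subst pos_le_divide_eq)
    next
      case False
      let ?J = "\<integral>x. modulate \<alpha> \<beta> v x * conj_weyl (rescaled_symbol p (h, ?Z)) cgauss x \<partial>lborel"
      \<comment> \<open>The induction hypothesis, recentred at \<open>?Z\<close> by
        \<open>Peetre\<close>, says that the transform of the modulated function is at most
        \<open>A / bracket ?Z ^ k\<close> times a polynomial in the displacement. The pairing bound
        is applied with this quotient in the place of its constant.\<close>
      have J: "norm ?J \<le> D * (A / bracket ?Z ^ k)"
      proof (rule D(2))
        show "(h, ?Z) \<in> {0<..1} \<times> UNIV" using h by auto
        show "modulate \<alpha> \<beta> v \<in> borel_measurable borel" using vm by simp
        show "integrable lborel (\<lambda>x. (norm (modulate \<alpha> \<beta> v x))\<^sup>2)" by (rule modulate_square[OF vm v2])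
        fix \<alpha>' \<beta>' :: 'a
        let ?W = "(\<alpha>', \<beta>')"
        have bp': "0 < bracket (?Z + ?W) ^ k" by (intro zero_less_power bracket_pos)
        have "norm (gabor (modulate \<alpha> \<beta> v) \<alpha>' \<beta>') = norm (gabor v (\<alpha> + \<alpha>') (\<beta> + \<beta>'))"
          using gabor_modulate[OF vm] by (simp add: norm_mult)
        also have "\<dots> \<le> A / bracket (?Z + ?W) ^ k"
          using A(2)[OF adm, of "\<alpha> + \<alpha>'" "\<beta> + \<beta>'"] by simp
        also have "\<dots> \<le> A / bracket ?Z ^ k * bracket ?W ^ k"
        proof -
          have "bracket ?Z ^ k \<le> bracket (?Z + ?W) ^ k * bracket ?W ^ k"
            using power_mono[OF Peetre[of ?Z ?W], of k] by (simp only: power_mult_distrib) (auto simp: bracket_pos)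
          from mult_left_mono[OF this A(1)]
          have "A * bracket ?Z ^ k \<le> A * bracket ?W ^ k * bracket (?Z + ?W) ^ k" by (simp only: mult_ac)
          moreover have "r / q \<le> s / p" if "r * p \<le> s * q" "0 < p" "0 < q" for p q r s :: real
            using that by (simp add: field_simps)
          ultimately have "A / bracket (?Z + ?W) ^ k \<le> A * bracket ?W ^ k / bracket ?Z ^ k"
            using bp bp' by blast
          then show ?thesis by (simp only: times_divide_eq_left)
        qed
        also have "\<dots> \<le> A / bracket ?Z ^ k * (bracket \<alpha>' ^ k * bracket \<beta>' ^ k)"
          using power_mono[OF bracket_Pair_le[of \<alpha>' \<beta>'], of k] A(1) bp
          by (intro mult_left_mono) (auto simp: power_mult_distrib)
        finally show "norm (gabor (modulate \<alpha> \<beta> v) \<alpha>' \<beta>') \<le> A / bracket ?Z ^ k * bracket \<alpha>' ^ k * bracket \<beta>' ^ k"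
          by (simp only: mult.assoc)
      qed
      \<comment> \<open>A factor one half is lost to the eigenvalue and a factor one quarter to
        replacing \<open>norm ?Z\<close> by half of its bracket.\<close>
      have lower: "c / 8 * bracket ?Z ^ 2 \<le> norm (\<mu> - p (sqrt h *\<^sub>R ?Z) / complex_of_real h)"
      proof -
        have "c * (norm (sqrt h *\<^sub>R ?Z))\<^sup>2 \<le> Re (p (sqrt h *\<^sub>R ?Z))" by (rule c(2))
        moreover have "(norm (sqrt h *\<^sub>R ?Z))\<^sup>2 = h * (norm ?Z)\<^sup>2"
          using h by (simp only: norm_scaleR power_mult_distrib) simp
        ultimately have "(c * (norm ?Z)\<^sup>2) * h \<le> Re (p (sqrt h *\<^sub>R ?Z))"
          by (simp only: mult_ac)
        then have "c * (norm ?Z)\<^sup>2 \<le> Re (p (sqrt h *\<^sub>R ?Z)) / h"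
          using h by (subst pos_le_divide_eq)
        also have "\<dots> = Re (p (sqrt h *\<^sub>R ?Z) / complex_of_real h)" by simp
        also have "\<dots> \<le> norm (p (sqrt h *\<^sub>R ?Z) / complex_of_real h)" by (rule complex_Re_le_cmod)
        finally have 1: "c * (norm ?Z)\<^sup>2 \<le> norm (p (sqrt h *\<^sub>R ?Z) / complex_of_real h)" .
        have 2: "norm (p (sqrt h *\<^sub>R ?Z) / complex_of_real h) \<le> norm (\<mu> - p (sqrt h *\<^sub>R ?Z) / complex_of_real h) + norm \<mu>"
          using norm_triangle_ineq4[of \<mu> "\<mu> - p (sqrt h *\<^sub>R ?Z) / complex_of_real h"] by simp
        have Z: "norm ?Z \<ge> R" using False by simp
        have "2 * C / c \<le> R" unfolding R_def by simp
        also have "R \<le> R\<^sup>2" using R by (intro self_le_power) auto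
        also have "R\<^sup>2 \<le> (norm ?Z)\<^sup>2" using Z R by (intro power_mono) auto
        finally have 3: "2 * C \<le> c * (norm ?Z)\<^sup>2" using c by (simp add: pos_divide_le_eq mult.commute)
        have "bracket ?Z ^ 2 \<le> (2 * norm ?Z) ^ 2" using Z R by (intro power_mono) auto
        then have "c * bracket ?Z ^ 2 \<le> c * (4 * (norm ?Z)\<^sup>2)" using c by (intro mult_left_mono) (auto simp: power_mult_distrib)
        then show ?thesis using 1 2 3 \<mu> by linarith
      qed
      have "c / 8 * bracket ?Z ^ 2 * norm (gabor v \<alpha> \<beta>) \<le> norm (\<mu> - p (sqrt h *\<^sub>R ?Z) / complex_of_real h) * norm (gabor v \<alpha> \<beta>)"
        by (intro mult_right_mono lower) auto
      also have "\<dots> = 1 * (norm (\<mu> - p (sqrt h *\<^sub>R ?Z) / complex_of_real h) * norm (gabor v \<alpha> \<beta>))" by simp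
      also have "\<dots> \<le> (2 * pi) ^ DIM('a) * (norm (\<mu> - p (sqrt h *\<^sub>R ?Z) / complex_of_real h) * norm (gabor v \<alpha> \<beta>))"
        using pi_gt3 by (intro mult_right_mono one_le_power) auto
      also have "\<dots> = norm (complex_of_real ((2 * pi) ^ DIM('a)) * (\<mu> - p (sqrt h *\<^sub>R ?Z) / complex_of_real h) * gabor v \<alpha> \<beta>)"
        unfolding norm_mult norm_of_real by simp
      also have "\<dots> = bracket ?Z * norm ?J"
        unfolding admissible_identity[OF adm] norm_mult norm_of_real using bracket_pos[of ?Z] by (simp only: abs_of_pos)
      also have "\<dots> \<le> bracket ?Z * (D * (A / bracket ?Z ^ k))"
        using bracket_pos[of ?Z] by (intro mult_left_mono J) simp
      finally have le: "c / 8 * bracket ?Z ^ 2 * norm (gabor v \<alpha> \<beta>) \<le> bracket ?Z * (D * (A / bracket ?Z ^ k))" .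
      have alg: "V \<le> 8 / c * D * A / b ^ Suc k" if "c / 8 * b ^ 2 * V \<le> b * (D * (A / b ^ k))" "0 < b" for V b :: real
        using that c by (simp add: field_simps power2_eq_square)
      have "norm (gabor v \<alpha> \<beta>) \<le> 8 / c * D * A / bracket ?Z ^ Suc k"
        by (rule alg[OF le bracket_pos])
      also have "\<dots> \<le> A' / bracket ?Z ^ Suc k"
        by (intro divide_right_mono A'1(2)) (rule less_imp_le[OF bp])
      finally show ?thesis .
    qed
  qed
  then show ?case using A'0 by blast
qed

text \<open>The transform of \<open>v\<close> times a fixed window is integrable with a bound
  independent of the centre, so Parseval against continuous test functions bounds this product
  almost everywhere. The window is then removed by choosing a centre close to the point.\<close>

lemma admissible_sup_bound:
  obtains K where "K \<ge> 1" "\<And>h \<mu> v. admissible h \<mu> v \<Longrightarrow> AE x in lborel. norm (v x) \<le> K"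
proof -
  let ?N = "2 * DIM('a)"
  obtain A where A: "A \<ge> 0" "\<And>h \<mu> v \<alpha> \<beta>. admissible h \<mu> v \<Longrightarrow> norm (gabor v \<alpha> \<beta>) \<le> A / bracket (\<alpha>, \<beta>) ^ ?N"
    using admissible_decay[of ?N] by blast
  define m where "m = A * bracket_mass TYPE('a)"
  have m: "0 \<le> m" unfolding m_def by (intro mult_nonneg_nonneg A bracket_mass_nonneg)
  show thesis
  \<comment> \<open>Every window centred within distance one is at least
    \<open>exp (- 1 / 2)\<close>, whence the factor \<open>exp (1/2)\<close>; the maximum with one
    prepares the interpolation, where powers of the constant are compared.\<close>
  proof (rule that[of "max 1 (m * exp (1/2))"])
    fix h \<mu> v assume adm: "admissible h \<mu> v"
    then have vm [measurable]: "v \<in> borel_measurable borel" and v2: "integrable lborel (\<lambda>x. (norm (v x))\<^sup>2)"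
      by (auto simp: admissible_def)
    have AE: "AE x in lborel. norm (v x * cgauss (x - \<alpha>)) \<le> m" for \<alpha>
    proof (rule AE_norm_le_of_continuous_test[OF window_integrable[OF vm v2] m])
      fix k :: "'a \<Rightarrow> complex" and B
      assume k: "continuous_on UNIV k" "\<And>x. norm (k x) \<le> B" "integrable lborel k"
      let ?h = "\<lambda>x. v x * cgauss (x - \<alpha>)" and ?n = "\<integral>x. norm (k x) \<partial>lborel"
      have [measurable]: "k \<in> borel_measurable borel" using k(3) by auto
      have FTh: "norm (FT ?h \<beta>) \<le> A / bracket \<beta> ^ ?N" for \<beta>
      proof -
        have "norm \<beta> \<le> norm (\<alpha>, \<beta>)" by (rule norm_snd_le)
        then have "A / bracket (\<alpha>, \<beta>) ^ ?N \<le> A / bracket \<beta> ^ ?N"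
          using A(1) by (intro divide_left_mono power_mono mult_pos_pos zero_less_power bracket_pos) auto
        then show ?thesis using A(2)[OF adm, of \<alpha> \<beta>] by (simp add: gabor_def)
      qed
      have bd: "norm (FT ?h \<beta> * FT k (- \<beta>)) \<le> (A * ?n) / bracket \<beta> ^ ?N" for \<beta>
      proof -
        have "norm (FT ?h \<beta> * FT k (- \<beta>)) \<le> (A / bracket \<beta> ^ ?N) * ?n"
          unfolding norm_mult by (intro mult_mono FTh norm_FT_le k) (use A(1) in auto)
        then show ?thesis by simp
      qed
      have meas: "(\<lambda>\<beta>. FT ?h \<beta> * FT k (- \<beta>)) \<in> borel_measurable borel" by measurable
      have "1 * norm (\<integral>x. ?h x * k x \<partial>lborel) \<le> (2 * pi) ^ DIM('a) * norm (\<integral>x. ?h x * k x \<partial>lborel)"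
        using pi_gt3 by (intro mult_right_mono one_le_power) auto
      also have "\<dots> = norm (complex_of_real ((2 * pi) ^ DIM('a)) * (\<integral>x. ?h x * k x \<partial>lborel))"
        unfolding norm_mult norm_of_real by simp
      also have "\<dots> = norm (\<integral>\<beta>. FT ?h \<beta> * FT k (- \<beta>) \<partial>lborel)"
        by (subst Parseval[OF window_integrable[OF vm v2] k(3,1,2) integrable_bracket_bound[OF meas bd]]) (rule refl)
      also have "\<dots> \<le> (A * ?n) * bracket_mass TYPE('a)"
        by (rule norm_integral_bracket_bound[OF meas bd])
      finally show "norm (\<integral>x. ?h x * k x \<partial>lborel) \<le> m * ?n"
        by (simp add: m_def mult_ac)
    qed
    obtain E :: "'a set" where E: "countable E" "\<And>X. open X \<Longrightarrow> X \<noteq> {} \<Longrightarrow> \<exists>d\<in>E. d \<in> X"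
      using countable_dense_setE by blast
    have "AE x in lborel. \<forall>\<alpha>\<in>E. norm (v x * cgauss (x - \<alpha>)) \<le> m"
      using AE by (subst AE_ball_countable[OF E(1)]) blast
    then show "AE x in lborel. norm (v x) \<le> max 1 (m * exp (1/2))"
    proof eventually_elim
      case (elim x)
      obtain \<alpha> where \<alpha>: "\<alpha> \<in> E" "dist x \<alpha> < 1" using E(2)[of "ball x 1"] by auto
      have "(x - \<alpha>) \<bullet> (x - \<alpha>) \<le> 1"
        using \<alpha>(2) power_le_one[of "norm (x - \<alpha>)" 2] by (simp add: dist_norm power2_norm_eq_inner)
      then have g: "exp (- 1 / 2) \<le> gauss (x - \<alpha>)" by (simp add: gauss_def)
      have "norm (v x) * exp (- 1 / 2) \<le> norm (v x) * gauss (x - \<alpha>)" by (intro mult_left_mono g) auto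
      also have "\<dots> \<le> m" using elim \<alpha>(1) by (auto simp: norm_mult)
      finally have "norm (v x) * exp (- 1 / 2) * exp (1 / 2) \<le> m * exp (1 / 2)" by (rule mult_right_mono) simp
      then have "norm (v x) \<le> m * exp (1/2)" by (simp add: mult.assoc flip: exp_add)
      then show ?case by simp
    qed
  qed simp
qed

end

section \<open>Rescaled eigenfunctions\<close>

text \<open>The coherent state in the original variables; with \<open>s = sqrt h\<close> the
  dilation by \<open>s\<close> turns it into the standard one centred at
  \<open>(\<alpha>, \<beta>)\<close>.\<close>

definition coherent :: "real \<Rightarrow> 'a::euclidean_space \<Rightarrow> 'a \<Rightarrow> 'a \<Rightarrow> complex" where
  "coherent s \<alpha> \<beta> y = iexp (\<beta> \<bullet> ((1/s) *\<^sub>R y)) * cgauss ((1/s) *\<^sub>R y - \<alpha>)"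

lemma coherent_schwartz:
  assumes "s > 0"
  shows "schwartz (coherent s \<alpha> \<beta>)"
proof -
  let ?g = "gexp (1 / (2 * s\<^sup>2)) ((1/s) *\<^sub>R \<alpha>) ((1/s) *\<^sub>R \<beta>)"
  have "coherent s \<alpha> \<beta> y = complex_of_real (exp (- (\<alpha> \<bullet> \<alpha>) / 2)) * ?g y" for y
  proof -
    have "- ((((1/s) *\<^sub>R y - \<alpha>) \<bullet> ((1/s) *\<^sub>R y - \<alpha>))) / 2 = - (\<alpha> \<bullet> \<alpha>) / 2 + (- (1 / (2 * s\<^sup>2)) * (y \<bullet> y) + y \<bullet> ((1/s) *\<^sub>R \<alpha>))"
      using assms by (simp add: inner_diff_left inner_diff_right inner_commute power2_eq_square field_simps)
    then have g: "gauss ((1/s) *\<^sub>R y - \<alpha>) = exp (- (\<alpha> \<bullet> \<alpha>) / 2) * exp (- (1 / (2 * s\<^sup>2)) * (y \<bullet> y) + y \<bullet> ((1/s) *\<^sub>R \<alpha>))"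
      by (simp only: gauss_def exp_add[symmetric])
    show ?thesis
    proof -
      have inn: "\<beta> \<bullet> ((1/s) *\<^sub>R y) = y \<bullet> ((1/s) *\<^sub>R \<beta>)" by (simp add: inner_commute)
      show ?thesis
        unfolding coherent_def gexp_def exp_add[of "complex_of_real _"] exp_of_real inn
        by (simp only: g of_real_mult mult_ac)
    qed
  qed
  then have "coherent s \<alpha> \<beta> = (\<lambda>y. complex_of_real (exp (- (\<alpha> \<bullet> \<alpha>) / 2)) * ?g y)" by blast
  moreover have "gpoly ?g (\<lambda>y. complex_of_real (exp (- (\<alpha> \<bullet> \<alpha>) / 2)) * ?g y)"
    by (rule gpoly.gpoly_scale[OF gpoly.gpoly_base])
  ultimately show ?thesis
    using gpoly_schwartz assms by (metis divide_pos_pos mult_pos_pos zero_less_numeral zero_less_one zero_less_power)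
qed

lemma lebesgue_integral_borel:
  fixes f :: "'a::euclidean_space \<Rightarrow> complex"
  assumes "f \<in> borel_measurable borel"
  shows "(\<integral>x. f x \<partial>lebesgue) = (\<integral>x. f x \<partial>lborel)"
  by (rule integral_completion) (use assms in simp)

lemma integral_integral_cnj:
  "(\<integral>x. \<integral>y. cnj (f x y) \<partial>N \<partial>M) = cnj (\<integral>x. \<integral>y. f x y \<partial>N \<partial>M)"
  by simp

text \<open>Dilation and phase space translation covariance in one formula. Both integration
  variables are shifted to the centre and scaled by \<open>sqrt h\<close>; the two Jacobians give
  \<open>h ^ CARD('n)\<close>, which cancels the power of \<open>h\<close> in the prefactor. The
  conjugations are those of the weak equation, which tests with the formal adjoint.\<close>

lemma weyl_op_coherent:
  fixes p :: "(real^'n) \<times> (real^'n) \<Rightarrow> complex"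
  assumes p: "continuous_on UNIV p" and h: "h > 0"
  shows "cnj (weyl_op h (\<lambda>X. cnj (p X)) (coherent (sqrt h) \<alpha> \<beta>) (sqrt h *\<^sub>R (x + \<alpha>)))
    = complex_of_real (1 / (2 * pi) ^ CARD('n)) *
      (iexp (- (\<beta> \<bullet> (x + \<alpha>))) * conj_weyl (\<lambda>Y. p (sqrt h *\<^sub>R (Y + (\<alpha>, \<beta>)))) cgauss x)"
proof -
  define s where "s = sqrt h"
  have s: "s > 0" "s \<noteq> 0" "s * s = h" using h by (auto simp: s_def)
  let ?x = "s *\<^sub>R (x + \<alpha>)"
  define F where "F \<xi> y = iexp (- (((?x - y) \<bullet> \<xi>) / h)) * p ((1/2) *\<^sub>R (?x + y), \<xi>) * cnj (coherent s \<alpha> \<beta> y)" for \<xi> y :: "real^'n"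
  have coh: "continuous_on UNIV (coherent s \<alpha> \<beta>)"
    unfolding coherent_def by (intro continuous_intros)
  \<comment> \<open>Joint continuity gives Borel measurability of the integrand and of its inner
    integral, so the Lebesgue integrals can be replaced by Borel ones before substituting.\<close>
  have Fc: "continuous_on UNIV (\<lambda>q. F (fst q) (snd q))"
    unfolding F_def by (intro continuous_intros continuous_on_compose2[OF p] continuous_on_compose2[OF coh]) (use h in auto)
  have Fm [measurable]: "case_prod F \<in> borel_measurable (borel \<Otimes>\<^sub>M borel)"
    using borel_measurable_continuous_onI[OF Fc] by (simp add: borel_prod case_prod_unfold)
  have Fm1: "F \<xi> \<in> borel_measurable borel" for \<xi>
    by measurable
  define G where "G \<xi> = (\<integral>y. F \<xi> y \<partial>lborel)" for \<xi>
  have Gm [measurable]: "G \<in> borel_measurable borel"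
    unfolding G_def by (rule lborel.borel_measurable_lebesgue_integral) simp
  have "cnj (weyl_op h (\<lambda>X. cnj (p X)) (coherent s \<alpha> \<beta>) ?x)
    = complex_of_real (1 / (2 * pi * h) ^ CARD('n)) * (\<integral>\<xi>. \<integral>y. F \<xi> y \<partial>lebesgue \<partial>lebesgue)"
  proof -
    let ?f = "\<lambda>\<xi> y. exp (\<i> * complex_of_real (((?x - y) \<bullet> \<xi>) / h)) * cnj (p ((1/2) *\<^sub>R (?x + y), \<xi>)) * coherent s \<alpha> \<beta> y"
    have F: "F \<xi> y = cnj (?f \<xi> y)" for \<xi> y
      by (simp add: F_def exp_cnj)
    have "weyl_op h (\<lambda>X. cnj (p X)) (coherent s \<alpha> \<beta>) ?x
      = complex_of_real (1 / (2 * pi * h) ^ CARD('n)) * (\<integral>\<xi>. \<integral>y. ?f \<xi> y \<partial>lebesgue \<partial>lebesgue)"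
      by (rule weyl_op_def)
    moreover have "(\<integral>\<xi>. \<integral>y. F \<xi> y \<partial>lebesgue \<partial>lebesgue) = cnj (\<integral>\<xi>. \<integral>y. ?f \<xi> y \<partial>lebesgue \<partial>lebesgue)"
      unfolding F by (rule integral_integral_cnj)
    ultimately show ?thesis
      by (simp only: complex_cnj_mult[of "complex_of_real _"] complex_cnj_complex_of_real)
  qed
  also have "(\<integral>\<xi>. \<integral>y. F \<xi> y \<partial>lebesgue \<partial>lebesgue) = (\<integral>\<xi>. G \<xi> \<partial>lborel)"
    unfolding lebesgue_integral_borel[OF Fm1] G_def[symmetric] by (rule lebesgue_integral_borel[OF Gm])
  \<comment> \<open>Substitution of \<open>s *\<^sub>R (\<beta> + \<xi>)\<close> for the frequency;
    the next step substitutes \<open>s *\<^sub>R (\<alpha> + y)\<close> in the inner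
    integral.\<close>
  also have "\<dots> = \<bar>s\<bar> ^ CARD('n) *\<^sub>R (\<integral>\<xi>. G (s *\<^sub>R \<beta> + s *\<^sub>R \<xi>) \<partial>lborel)"
    using lborel_integral_affine[OF Gm s(2), of "s *\<^sub>R \<beta>"] by simp
  also have "\<dots> = \<bar>s\<bar> ^ CARD('n) *\<^sub>R (\<integral>\<xi>. \<bar>s\<bar> ^ CARD('n) *\<^sub>R (\<integral>y. F (s *\<^sub>R \<beta> + s *\<^sub>R \<xi>) (s *\<^sub>R \<alpha> + s *\<^sub>R y) \<partial>lborel) \<partial>lborel)"
    unfolding G_def using lborel_integral_affine[OF Fm1 s(2), of _ "s *\<^sub>R \<alpha>"] by simp
  also have "\<dots> = (\<bar>s\<bar> ^ CARD('n) * \<bar>s\<bar> ^ CARD('n)) *\<^sub>R (\<integral>\<xi>. \<integral>y. F (s *\<^sub>R \<beta> + s *\<^sub>R \<xi>) (s *\<^sub>R \<alpha> + s *\<^sub>R y) \<partial>lborel \<partial>lborel)"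
    by simp
  also have "\<bar>s\<bar> ^ CARD('n) * \<bar>s\<bar> ^ CARD('n) = h ^ CARD('n)"
    using s by (simp add: power_mult_distrib[symmetric])
  also have "(\<integral>\<xi>. \<integral>y. F (s *\<^sub>R \<beta> + s *\<^sub>R \<xi>) (s *\<^sub>R \<alpha> + s *\<^sub>R y) \<partial>lborel \<partial>lborel)
    = (\<integral>\<xi>. \<integral>y. iexp (- (\<beta> \<bullet> (x + \<alpha>))) * weyl_integrand (\<lambda>Y. p (s *\<^sub>R (Y + (\<alpha>, \<beta>)))) cgauss x \<xi> y \<partial>lborel \<partial>lborel)"
  proof (intro Bochner_Integration.integral_cong refl)
    fix \<xi> y :: "real^'n"
    have 1: "(?x - (s *\<^sub>R \<alpha> + s *\<^sub>R y)) \<bullet> (s *\<^sub>R \<beta> + s *\<^sub>R \<xi>) / h = (x - y) \<bullet> (\<beta> + \<xi>)"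
    proof -
      have "(?x - (s *\<^sub>R \<alpha> + s *\<^sub>R y)) = s *\<^sub>R (x - y)" "s *\<^sub>R \<beta> + s *\<^sub>R \<xi> = s *\<^sub>R (\<beta> + \<xi>)"
        by (simp_all add: algebra_simps)
      then have "(?x - (s *\<^sub>R \<alpha> + s *\<^sub>R y)) \<bullet> (s *\<^sub>R \<beta> + s *\<^sub>R \<xi>) = h * ((x - y) \<bullet> (\<beta> + \<xi>))"
        by (simp only: inner_scaleR_left inner_scaleR_right mult.assoc[symmetric] s(3))
      then show ?thesis using h by simp
    qed
    have 2: "((1/2) *\<^sub>R (?x + (s *\<^sub>R \<alpha> + s *\<^sub>R y)), s *\<^sub>R \<beta> + s *\<^sub>R \<xi>) = s *\<^sub>R (((1/2) *\<^sub>R (x + y), \<xi>) + (\<alpha>, \<beta>))"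
    proof -
      have "?x + (s *\<^sub>R \<alpha> + s *\<^sub>R y) = s *\<^sub>R (x + y) + 2 *\<^sub>R (s *\<^sub>R \<alpha>)"
        by (simp only: scaleR_2 scaleR_add_right add_ac)
      then have "(1/2) *\<^sub>R (?x + (s *\<^sub>R \<alpha> + s *\<^sub>R y)) = s *\<^sub>R ((1/2) *\<^sub>R (x + y) + \<alpha>)"
        by (simp add: scaleR_add_right)
      then show ?thesis by (simp add: scaleR_add_right)
    qed
    have 3: "(1/s) *\<^sub>R (s *\<^sub>R \<alpha> + s *\<^sub>R y) = \<alpha> + y" using s by (simp add: scaleR_add_right)
    have "F (s *\<^sub>R \<beta> + s *\<^sub>R \<xi>) (s *\<^sub>R \<alpha> + s *\<^sub>R y)
      = (iexp (- ((x - y) \<bullet> (\<beta> + \<xi>))) * iexp (- (\<beta> \<bullet> (\<alpha> + y)))) * p (s *\<^sub>R (((1/2) *\<^sub>R (x + y), \<xi>) + (\<alpha>, \<beta>))) * cgauss y"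
      unfolding F_def 1 2 coherent_def 3 by (simp add: exp_cnj)
    also have "iexp (- ((x - y) \<bullet> (\<beta> + \<xi>))) * iexp (- (\<beta> \<bullet> (\<alpha> + y))) = iexp (- (\<beta> \<bullet> (x + \<alpha>))) * iexp (- ((x - y) \<bullet> \<xi>))"
      by (simp add: algebra_simps inner_commute flip: exp_add)
    finally show "F (s *\<^sub>R \<beta> + s *\<^sub>R \<xi>) (s *\<^sub>R \<alpha> + s *\<^sub>R y)
      = iexp (- (\<beta> \<bullet> (x + \<alpha>))) * weyl_integrand (\<lambda>Y. p (s *\<^sub>R (Y + (\<alpha>, \<beta>)))) cgauss x \<xi> y"
      unfolding weyl_integrand_def by (simp only: mult.assoc)
  qed
  also have "\<dots> = iexp (- (\<beta> \<bullet> (x + \<alpha>))) * conj_weyl (\<lambda>Y. p (s *\<^sub>R (Y + (\<alpha>, \<beta>)))) cgauss x"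
    unfolding conj_weyl_def weyl_inner_def integral_mult_right_zero ..
  finally show ?thesis
    using h unfolding s_def by (simp add: scaleR_conv_of_real power_mult_distrib)
qed

text \<open>Eigenfunctions are only Lebesgue measurable, while the estimates are made for Borel
  functions; this provides a Borel representative, from real and imaginary parts.\<close>

lemma completion_ex_borel_measurable_complex:
  fixes g :: "'a \<Rightarrow> complex"
  assumes "g \<in> borel_measurable (completion M)"
  shows "\<exists>g'\<in>borel_measurable M. (AE x in M. g x = g' x)"
proof -
  have "(\<lambda>x. Re (g x)) \<in> borel_measurable (completion M)" "(\<lambda>x. Im (g x)) \<in> borel_measurable (completion M)"
    using assms by simp_all
  then obtain r i where "r \<in> borel_measurable M" "AE x in M. Re (g x) = r x" "i \<in> borel_measurable M" "AE x in M. Im (g x) = i x"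
    using completion_ex_borel_measurable_real[of "\<lambda>x. Re (g x)" M] completion_ex_borel_measurable_real[of "\<lambda>x. Im (g x)" M] by blast
  then show ?thesis
    by (intro bexI[of _ "\<lambda>x. Complex (r x) (i x)"]) (auto simp: complex_eq_iff borel_measurable_complex_iff)
qed

text \<open>Only coherent states are inserted as test functions into the weak equation. After the
  dilation both of its sides carry the same Jacobian, which cancels.\<close>

lemma rescaled_eigenfunction_admissible:
  fixes p :: "(real^'n) \<times> (real^'n) \<Rightarrow> complex"
  assumes p: "standing_symbol p" and C: "C > 0" and h: "0 < h" "h \<le> 1" and lam: "norm lam < C * h"
    and eig: "weyl_eigenfunction h p lam u" and u1: "(\<integral>x. (norm (u x))\<^sup>2 \<partial>lebesgue) = 1"
    and w: "w \<in> borel_measurable borel" "AE x in lborel. u x = w x"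
  shows "admissible p C h (lam / complex_of_real h) (\<lambda>x. complex_of_real (h powr (real CARD('n) / 4)) * w (sqrt h *\<^sub>R x))"
proof -
  define s where "s = sqrt h"
  have s: "s > 0" "s \<noteq> 0" "s * s = h" using h by (auto simp: s_def)
  \<comment> \<open>The power that keeps the norm in the space of square integrable functions equal
    to one: its square is the Jacobian of the dilation by \<open>s\<close>.\<close>
  define \<kappa> where "\<kappa> = h powr (real CARD('n) / 4)"
  have \<kappa>: "\<kappa> > 0" "\<kappa>\<^sup>2 = s ^ CARD('n)"
  proof -
    have "\<kappa>\<^sup>2 = h powr (real CARD('n) / 2)"
      by (simp add: \<kappa>_def power2_eq_square flip: powr_add)
    also have "\<dots> = s powr (real CARD('n))"
    proof -
      have "s = h powr (1/2)" using powr_half_sqrt[of h] h by (simp add: s_def)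
      then show ?thesis by (simp add: powr_powr)
    qed
    finally show "\<kappa>\<^sup>2 = s ^ CARD('n)" using s by (simp add: powr_realpow)
  qed (use h in \<open>simp add: \<kappa>_def\<close>)
  note [measurable] = w(1)
  define v where "v x = complex_of_real \<kappa> * w (s *\<^sub>R x)" for x
  have vm [measurable]: "v \<in> borel_measurable borel" unfolding v_def by measurable
  have um: "u \<in> borel_measurable lebesgue" and u2: "integrable lebesgue (\<lambda>x. (norm (u x))\<^sup>2)"
    using eig by (auto simp: weyl_eigenfunction_def in_domain_def L2_def)
  have AE: "AE x in lebesgue. u x = w x" using w(2) by (rule AE_completion)
  have wm: "w \<in> borel_measurable lebesgue" using w(1) by (intro measurable_completion) simp
  have w2: "integrable lborel (\<lambda>x. (norm (w x))\<^sup>2)"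
  proof -
    have "integrable lebesgue (\<lambda>x. (norm (w x))\<^sup>2)"
      using u2 by (rule integrable_cong_AE_imp) (use AE wm in auto)
    then show ?thesis by (subst (asm) integrable_completion) auto
  qed
  have w1: "(\<integral>x. (norm (w x))\<^sup>2 \<partial>lborel) = 1"
  proof -
    have "(\<integral>x. (norm (u x))\<^sup>2 \<partial>lebesgue) = (\<integral>x. (norm (w x))\<^sup>2 \<partial>lebesgue)"
      by (rule integral_cong_AE) (use um wm AE in auto)
    also have "\<dots> = (\<integral>x. (norm (w x))\<^sup>2 \<partial>lborel)" by (rule integral_completion) simp
    finally show ?thesis using u1 by simp
  qed
  \<comment> \<open>Passes from \<open>u\<close> to its Borel representative and changes variables
    in one step, for both sides of the weak equation.\<close>
  have transfer: "(\<integral>x. u x * cnj (H x) \<partial>lebesgue) = s ^ CARD('n) *\<^sub>R (\<integral>x. w (s *\<^sub>R (x + \<alpha>)) * cnj (H (s *\<^sub>R (x + \<alpha>))) \<partial>lborel)"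
    if H: "(\<lambda>x. cnj (H x)) \<in> borel_measurable borel" for H and \<alpha> :: "real^'n"
  proof -
    have "(\<lambda>x. cnj (H x)) \<in> borel_measurable lebesgue" using H by (intro measurable_completion) simp
    then have "(\<integral>x. u x * cnj (H x) \<partial>lebesgue) = (\<integral>x. w x * cnj (H x) \<partial>lebesgue)"
      by (intro integral_cong_AE) (use um wm AE in auto)
    also have "\<dots> = (\<integral>x. w x * cnj (H x) \<partial>lborel)" by (rule lebesgue_integral_borel) (use H in simp)
    also have "\<dots> = s ^ CARD('n) *\<^sub>R (\<integral>x. w (s *\<^sub>R \<alpha> + s *\<^sub>R x) * cnj (H (s *\<^sub>R \<alpha> + s *\<^sub>R x)) \<partial>lborel)"
      using lborel_integral_affine[of "\<lambda>x. w x * cnj (H x)" s "s *\<^sub>R \<alpha>"] H s by simp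
    finally show ?thesis by (simp add: algebra_simps)
  qed
  have "admissible p C h (lam / complex_of_real h) v"
    unfolding admissible_def[OF p C]
  proof (intro conjI allI)
    show "norm (lam / complex_of_real h) < C" using lam h by (simp add: norm_divide divide_less_eq)
    show "integrable lborel (\<lambda>x. (norm (v x))\<^sup>2)"
      using lborel_integrable_affine_iff[of "\<lambda>x. (norm (w x))\<^sup>2" s 0] s w2 by (simp add: v_def norm_mult power_mult_distrib)
    have "(\<integral>x. (norm (v x))\<^sup>2 \<partial>lborel) = \<kappa>\<^sup>2 * (\<integral>x. (norm (w (s *\<^sub>R x)))\<^sup>2 \<partial>lborel)"
      by (simp add: v_def norm_mult power_mult_distrib)
    also have "\<dots> = (\<integral>x. (norm (w x))\<^sup>2 \<partial>lborel)"
      using lborel_integral_affine[of "\<lambda>x. (norm (w x))\<^sup>2" s 0] s \<kappa>(2) by simp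
    finally show "(\<integral>x. (norm (v x))\<^sup>2 \<partial>lborel) = 1" using w1 by simp
  next
    fix \<alpha> \<beta> :: "real^'n"
    let ?R = "conj_weyl (\<lambda>Y. p (sqrt h *\<^sub>R (Y + (\<alpha>, \<beta>)))) cgauss"
    let ?\<phi> = "coherent s \<alpha> \<beta>" and ?N = "CARD('n)"
    note pc = smooth_fun_continuous[OF p_smooth[OF p]]
    have W: "cnj (weyl_op h (\<lambda>X. cnj (p X)) ?\<phi> (s *\<^sub>R (x + \<alpha>)))
      = complex_of_real (1 / (2 * pi) ^ ?N) * (iexp (- (\<beta> \<bullet> (x + \<alpha>))) * ?R x)" for x
      using weyl_op_coherent[OF pc h(1), of \<alpha> \<beta> x] unfolding s_def .
    have Rm [measurable]: "?R \<in> borel_measurable borel"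
      by (rule conj_weyl_translated_symbol_measurable[OF p C h])
    \<comment> \<open>Measurability of the Weyl operator on the coherent state is read off its
      explicit form, after undoing the affine substitution.\<close>
    have Wm: "(\<lambda>x. cnj (weyl_op h (\<lambda>X. cnj (p X)) ?\<phi> x)) \<in> borel_measurable borel"
    proof -
      have "cnj (weyl_op h (\<lambda>X. cnj (p X)) ?\<phi> x)
        = complex_of_real (1 / (2 * pi) ^ ?N) * (iexp (- (\<beta> \<bullet> ((1/s) *\<^sub>R x - \<alpha> + \<alpha>))) * ?R ((1/s) *\<^sub>R x - \<alpha>))" for x
        using W[of "(1/s) *\<^sub>R x - \<alpha>"] s by simp
      then show ?thesis by simp
    qed
    have coh: "continuous_on UNIV ?\<phi>"
      unfolding coherent_def by (intro continuous_intros)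
    have \<phi>m: "(\<lambda>x. cnj (?\<phi> x)) \<in> borel_measurable borel"
      by (intro borel_measurable_continuous_onI continuous_intros coh)
    have \<phi>: "cnj (?\<phi> (s *\<^sub>R (x + \<alpha>))) = iexp (- (\<beta> \<bullet> (x + \<alpha>))) * cgauss x" for x
      using s by (simp add: coherent_def exp_cnj)
    have "(\<integral>x. u x * cnj (weyl_op h (\<lambda>X. cnj (p X)) ?\<phi> x) \<partial>lebesgue) = lam * (\<integral>x. u x * cnj (?\<phi> x) \<partial>lebesgue)"
      using eig coherent_schwartz[OF s(1), of \<alpha> \<beta>] unfolding weyl_eigenfunction_def by blast
    then have scaled: "s ^ ?N *\<^sub>R (\<integral>x. w (s *\<^sub>R (x + \<alpha>)) * (complex_of_real (1 / (2 * pi) ^ ?N) * (iexp (- (\<beta> \<bullet> (x + \<alpha>))) * ?R x)) \<partial>lborel)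
      = lam * (s ^ ?N *\<^sub>R (\<integral>x. w (s *\<^sub>R (x + \<alpha>)) * (iexp (- (\<beta> \<bullet> (x + \<alpha>))) * cgauss x) \<partial>lborel))"
      unfolding transfer[OF Wm, of \<alpha>] transfer[OF \<phi>m, of \<alpha>] W \<phi> .
    then have eq: "(\<integral>x. w (s *\<^sub>R (x + \<alpha>)) * (complex_of_real (1 / (2 * pi) ^ ?N) * (iexp (- (\<beta> \<bullet> (x + \<alpha>))) * ?R x)) \<partial>lborel)
      = lam * (\<integral>x. w (s *\<^sub>R (x + \<alpha>)) * (iexp (- (\<beta> \<bullet> (x + \<alpha>))) * cgauss x) \<partial>lborel)"
    proof -
      have "A = lam * B" if "s ^ ?N *\<^sub>R A = lam * (s ^ ?N *\<^sub>R B)" for A B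
      proof -
        have "complex_of_real (s ^ ?N) * A = complex_of_real (s ^ ?N) * (lam * B)"
          using that by (simp only: scaleR_conv_of_real mult.left_commute)
        moreover have "complex_of_real (s ^ ?N) \<noteq> 0" using s by simp
        ultimately show ?thesis using mult_left_cancel[of "complex_of_real (s ^ ?N)" A "lam * B"] by blast
      qed
      from this[OF scaled] show ?thesis .
    qed
    have mod: "modulate \<alpha> \<beta> v x = complex_of_real \<kappa> * (w (s *\<^sub>R (x + \<alpha>)) * iexp (- (\<beta> \<bullet> (x + \<alpha>))))" for x
      by (simp add: modulate_def v_def)
    have "(\<integral>x. modulate \<alpha> \<beta> v x * ?R x \<partial>lborel)
      = complex_of_real (\<kappa> * (2 * pi) ^ ?N) * (\<integral>x. w (s *\<^sub>R (x + \<alpha>)) * (complex_of_real (1 / (2 * pi) ^ ?N) * (iexp (- (\<beta> \<bullet> (x + \<alpha>))) * ?R x)) \<partial>lborel)"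
      unfolding mod integral_mult_right_zero[symmetric]
      by (intro Bochner_Integration.integral_cong refl) simp
    also have "\<dots> = complex_of_real ((2 * pi) ^ ?N) * lam * (\<integral>x. modulate \<alpha> \<beta> v x * cgauss x \<partial>lborel)"
      unfolding eq mod by (simp add: mult.assoc mult.left_commute)
    also have "(\<integral>x. modulate \<alpha> \<beta> v x * cgauss x \<partial>lborel) = gabor v \<alpha> \<beta>"
      using gabor_modulate[OF vm, of \<alpha> 0 \<beta> 0] by (simp add: gabor_def FT_def)
    finally show "(\<integral>x. modulate \<alpha> \<beta> v x * ?R x \<partial>lborel)
       = complex_of_real ((2 * pi) ^ DIM(real^'n)) * (complex_of_real h * (lam / complex_of_real h)) * gabor v \<alpha> \<beta>"
      using h by simp
  qed (use h vm in auto)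
  then show ?thesis by (simp add: v_def[abs_def] \<kappa>_def s_def)
qed

text \<open>Pointwise, \<open>r - 2\<close> of the \<open>r\<close> powers are bounded by the
  supremum and the other two are left to the normalised square integral.\<close>

lemma Lp_interpolation:
  fixes u :: "'a::euclidean_space \<Rightarrow> complex"
  assumes um: "u \<in> borel_measurable lebesgue" and u2: "integrable lebesgue (\<lambda>x. (norm (u x))\<^sup>2)"
    and u1: "(\<integral>x. (norm (u x))\<^sup>2 \<partial>lebesgue) = 1" and M: "M > 0" "AE x in lebesgue. norm (u x) \<le> M" and r: "r \<ge> 2"
  shows "integrable lebesgue (\<lambda>x. norm (u x) powr r)"
    and "(\<integral>x. norm (u x) powr r \<partial>lebesgue) powr (1 / r) \<le> M powr (1 - 2 / r)"
proof -
  have le: "AE x in lebesgue. norm (u x) powr r \<le> M powr (r - 2) * (norm (u x))\<^sup>2"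
    using M(2)
  proof eventually_elim
    case (elim x)
    have "norm (u x) powr r = norm (u x) powr (r - 2) * norm (u x) powr 2"
      using powr_add[of "norm (u x)" "r - 2" 2] by (simp del: powr_numeral)
    also have "\<dots> \<le> M powr (r - 2) * norm (u x) powr 2"
      using elim r by (intro mult_right_mono powr_mono2) auto
    finally show ?case by (cases "u x = 0") (simp_all add: powr_numeral)
  qed
  have int: "integrable lebesgue (\<lambda>x. M powr (r - 2) * (norm (u x))\<^sup>2)" using u2 by simp
  show *: "integrable lebesgue (\<lambda>x. norm (u x) powr r)"
    by (rule Bochner_Integration.integrable_bound[OF int]) (use um le in auto)
  have "(\<integral>x. norm (u x) powr r \<partial>lebesgue) \<le> (\<integral>x. M powr (r - 2) * (norm (u x))\<^sup>2 \<partial>lebesgue)"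
    by (rule integral_mono_AE[OF * int le])
  then have "(\<integral>x. norm (u x) powr r \<partial>lebesgue) \<le> M powr (r - 2)" using u1 by simp
  then have "(\<integral>x. norm (u x) powr r \<partial>lebesgue) powr (1 / r) \<le> (M powr (r - 2)) powr (1 / r)"
    using r by (intro powr_mono2) auto
  also have "\<dots> = M powr (1 - 2 / r)" using r by (simp add: powr_powr diff_divide_distrib)
  finally show "(\<integral>x. norm (u x) powr r \<partial>lebesgue) powr (1 / r) \<le> M powr (1 - 2 / r)" .
qed

theorem theorem1p1:
  fixes p :: "(real^'n) \<times> (real^'n) \<Rightarrow> complex" and C :: real
  assumes "CARD('n) \<ge> 2"
    and "standing_symbol p"
    and "C > 0"
  shows "\<exists>h0>0. \<exists>K>0. \<forall>h lam u. 0 < h \<and> h \<le> h0 \<and> cmod lam < C * h \<and>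
           weyl_eigenfunction h p lam u \<and> (\<integral>x. (norm (u x))\<^sup>2 \<partial>lebesgue) = 1 \<longrightarrow>
           (AE x in lebesgue. norm (u x) \<le> K * h powr (- real CARD('n) / 4)) \<and>
           (\<forall>r::real. r \<ge> 2 \<longrightarrow> integrable lebesgue (\<lambda>x. norm (u x) powr r) \<and>
              (\<integral>x. norm (u x) powr r \<partial>lebesgue) powr (1 / r)
                \<le> K * h powr (real CARD('n) / (2 * r) - real CARD('n) / 4))"
proof -
  note p = assms(2) and C = assms(3)
  obtain K where K: "K \<ge> 1" "\<And>h \<mu> v. admissible p C h \<mu> v \<Longrightarrow> AE x in lborel. norm (v x) \<le> K"
    using admissible_sup_bound[OF p C] by blast
  have main: "(AE x in lebesgue. norm (u x) \<le> K * h powr (- real CARD('n) / 4)) \<and>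
           (\<forall>r::real. r \<ge> 2 \<longrightarrow> integrable lebesgue (\<lambda>x. norm (u x) powr r) \<and>
              (\<integral>x. norm (u x) powr r \<partial>lebesgue) powr (1 / r)
                \<le> K * h powr (real CARD('n) / (2 * r) - real CARD('n) / 4))"
    if h: "0 < h" "h \<le> 1" and lam: "cmod lam < C * h" and eig: "weyl_eigenfunction h p lam u"
      and u1: "(\<integral>x. (norm (u x))\<^sup>2 \<partial>lebesgue) = 1" for h lam and u :: "real^'n \<Rightarrow> complex"
  proof -
    have um: "u \<in> borel_measurable lebesgue" and u2: "integrable lebesgue (\<lambda>x. (norm (u x))\<^sup>2)"
      using eig by (auto simp: weyl_eigenfunction_def in_domain_def L2_def)
    \<comment> \<open>The bound is proved for a Borel representative and carried back almost
      everywhere at the end.\<close>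
    obtain w where w0: "w \<in> borel_measurable lborel" and w2: "AE x in lborel. u x = w x"
      using completion_ex_borel_measurable_complex[OF um] by blast
    have w [measurable]: "w \<in> borel_measurable borel" using w0 by simp
    have "AE x in lborel. norm (complex_of_real (h powr (real CARD('n) / 4)) * w (sqrt h *\<^sub>R x)) \<le> K"
      by (rule K(2)[OF rescaled_eigenfunction_admissible[OF p C h lam eig u1 w w2]])
    then have "AE x in lborel. norm (w (sqrt h *\<^sub>R x)) \<le> K * h powr (- real CARD('n) / 4)"
    proof eventually_elim
      case (elim x)
      then have "h powr (real CARD('n) / 4) * norm (w (sqrt h *\<^sub>R x)) \<le> K" by (simp add: norm_mult)
      then have "h powr (- real CARD('n) / 4) * (h powr (real CARD('n) / 4) * norm (w (sqrt h *\<^sub>R x))) \<le> h powr (- real CARD('n) / 4) * K"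
        by (intro mult_left_mono) auto
      moreover have "h powr (- real CARD('n) / 4) * h powr (real CARD('n) / 4) = 1"
        using h by (simp flip: powr_add)
      ultimately show ?case by (simp only: mult.assoc[symmetric] mult_1 mult.commute[of K])
    qed
    \<comment> \<open>A nonzero dilation preserves null sets, so the almost everywhere bound
      survives undoing the rescaling.\<close>
    then have "AE x in lborel. norm (w x) \<le> K * h powr (- real CARD('n) / 4)"
      using h by (subst lborel_affine[of "sqrt h" 0]) (simp_all add: AE_density AE_distr_iff)
    with w2 have "AE x in lborel. norm (u x) \<le> K * h powr (- real CARD('n) / 4)"
      by eventually_elim simp
    then have sup: "AE x in lebesgue. norm (u x) \<le> K * h powr (- real CARD('n) / 4)" by (rule AE_completion)
    have M: "K * h powr (- real CARD('n) / 4) > 0" using K h by simp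
    show ?thesis
    proof (intro conjI allI impI)
      fix r :: real assume r: "r \<ge> 2"
      show "integrable lebesgue (\<lambda>x. norm (u x) powr r)"
        by (rule Lp_interpolation(1)[OF um u2 u1 M sup r])
      have "(\<integral>x. norm (u x) powr r \<partial>lebesgue) powr (1 / r) \<le> (K * h powr (- real CARD('n) / 4)) powr (1 - 2 / r)"
        by (rule Lp_interpolation(2)[OF um u2 u1 M sup r])
      also have "\<dots> = K powr (1 - 2 / r) * h powr (- real CARD('n) / 4 * (1 - 2 / r))"
        using K h by (simp add: powr_mult powr_powr)
      also have "- real CARD('n) / 4 * (1 - 2 / r) = real CARD('n) / (2 * r) - real CARD('n) / 4"
        using r by (simp add: field_simps)
      \<comment> \<open>Because \<open>K \<ge> 1\<close> and \<open>1 - 2 / r \<le> 1\<close>, the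
        power of \<open>K\<close> is at most \<open>K\<close>, so one constant serves all exponents
        \<open>r\<close>.\<close>
      also have "K powr (1 - 2 / r) * h powr (real CARD('n) / (2 * r) - real CARD('n) / 4) \<le> K * h powr (real CARD('n) / (2 * r) - real CARD('n) / 4)"
        using K r powr_mono[of "1 - 2 / r" 1 K] by (intro mult_right_mono) auto
      finally show "(\<integral>x. norm (u x) powr r \<partial>lebesgue) powr (1 / r) \<le> K * h powr (real CARD('n) / (2 * r) - real CARD('n) / 4)" .
    qed (rule sup)
  qed
  \<comment> \<open>The threshold is \<open>h0 = 1\<close>, as the family of rescaled symbols is
    controlled uniformly for all \<open>h\<close> up to one.\<close>
  show ?thesis
    using main K(1) by (intro exI[of _ 1] conjI exI[of _ K]) auto
qed

end
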